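(* Let $D=(0,\infty)$. For $\lambda>0$, the function $$\psi_\lambda(x)=\sin\left(\lambda x+\tfrac{\pi}{8}\right)-r_\lambda(x),\qquad x>0,$$ where $$r_\lambda(x)=r(\lambda x)=\frac{\sqrt2}{2\pi}\int_0^\infty\frac{t}{1+t^2}\exp\left(-\frac1\pi\int_0^\infty\frac{\log(t+s)}{1+s^2}\,ds\right)e^{-t\lambda x}\,dt,$$ is an eigenfunction of the semigroup $(P^D_t)$ acting on $C(D)$, corresponding to $\lambda$; that is, $\psi_\lambda\in C(D)$ is not identically zero and $$P^D_t\psi_\lambda(x)=e^{-\lambda t}\psi_\lambda(x)\qquad\text{for all } t\ge0,\ x>0.$$
   Context: $(X_t)_{t\ge0}$ is the one-dimensional Cauchy process (symmetric $1$-stable Lévy process), with $\mathbf{P}_x(X_t\in dy)=p_t(y-x)\,dy$, $p_t(x)=\frac1\pi\frac{t}{t^2+x^2}$; $\mathbf{P}_x,\mathbf{E}_x$ denote probability and expectation for the process started at $x$. For an open set $D\subseteq\mathbb{R}$, $\tau_D=\inf\{t\ge0: X_t\notin D\}$ is the first exit time, and $P^D_tf(x)=\mathbf{E}_x\left(f(X_t);\,t<\tau_D\right)$ is the transition semigroup of the process killed on exiting $D$. *)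

theory Defs
  imports "HOL-Probability.Probability"
begin

definition cadlag :: "(real \<Rightarrow> real) \<Rightarrow> bool" where
  "cadlag w \<longleftrightarrow>
     (\<forall>t\<ge>0. continuous (at_right t) w) \<and>
     (\<forall>t>0. \<exists>l. (w \<longlongrightarrow> l) (at_left t))"

definition cauchy_kernel :: "real \<Rightarrow> real \<Rightarrow> real" where
  "cauchy_kernel t x = (1 / pi) * (t / (t\<^sup>2 + x\<^sup>2))"

(* Only the times t \<ge> 0 are constrained; values of the process at negative times
   are irrelevant. *)
locale cauchy_process_from = prob_space M
  for M :: "'a measure" and X :: "real \<Rightarrow> 'a \<Rightarrow> real" and x :: real +
  assumes measurable_X: "\<And>t. 0 \<le> t \<Longrightarrow> random_variable borel (X t)"
    and start: "AE \<omega> in M. X 0 \<omega> = x"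
    and indep_increments:
      "\<And>(n::nat) (\<tau> :: nat \<Rightarrow> real). 0 \<le> \<tau> 0 \<Longrightarrow> strict_mono_on {..n} \<tau> \<Longrightarrow>
         indep_vars (\<lambda>_. borel) (\<lambda>i \<omega>. X (\<tau> (Suc i)) \<omega> - X (\<tau> i) \<omega>) {..<n}"
    and increments_distributed:
      "\<And>s t. 0 \<le> s \<Longrightarrow> s < t \<Longrightarrow>
         distributed M lborel (\<lambda>\<omega>. X t \<omega> - X s \<omega>) (\<lambda>y. ennreal (cauchy_kernel (t - s) y))"
    and cadlag_paths: "AE \<omega> in M. cadlag (\<lambda>t. X t \<omega>)"

definition cauchy_process :: "(real \<Rightarrow> 'a measure) \<Rightarrow> (real \<Rightarrow> 'a \<Rightarrow> real) \<Rightarrow> bool" where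
  "cauchy_process P X \<longleftrightarrow> (\<forall>x. cauchy_process_from (P x) X x)"

(* Extended-real valued: the infimum of the empty set is \<infinity>. *)
definition exit_time :: "(real \<Rightarrow> 'a \<Rightarrow> real) \<Rightarrow> real set \<Rightarrow> 'a \<Rightarrow> ereal" where
  "exit_time X D \<omega> = Inf (ereal ` {t. 0 \<le> t \<and> X t \<omega> \<notin> D})"

definition survival :: "(real \<Rightarrow> 'a \<Rightarrow> real) \<Rightarrow> real set \<Rightarrow> real \<Rightarrow> 'a set" where
  "survival X D t = {\<omega>. ereal t < exit_time X D \<omega>}"

(* The exit time involves uncountably many times, so the event {t < exit_time} is in
   general measurable only after adding the null sets; hence the expectation is taken
   with respect to the completion of P x. *)
definition killed_integrable ::
    "(real \<Rightarrow> 'a measure) \<Rightarrow> (real \<Rightarrow> 'a \<Rightarrow> real) \<Rightarrow> real set \<Rightarrow> real \<Rightarrow> (real \<Rightarrow> real) \<Rightarrow> real \<Rightarrow> bool"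
  where
  "killed_integrable P X D t f x \<longleftrightarrow>
     set_integrable (completion (P x)) (survival X D t) (\<lambda>\<omega>. f (X t \<omega>))"

definition killed_semigroup ::
    "(real \<Rightarrow> 'a measure) \<Rightarrow> (real \<Rightarrow> 'a \<Rightarrow> real) \<Rightarrow> real set \<Rightarrow> real \<Rightarrow> (real \<Rightarrow> real) \<Rightarrow> real \<Rightarrow> real"
  where
  "killed_semigroup P X D t f x =
     (LINT \<omega>:survival X D t|completion (P x). f (X t \<omega>))"

definition r_fun :: "real \<Rightarrow> real" where
  "r_fun x = sqrt 2 / (2 * pi) *
     (LINT t:{0<..}|lborel.
        t / (1 + t\<^sup>2) *
        exp (- (1 / pi) * (LINT s:{0<..}|lborel. ln (t + s) / (1 + s\<^sup>2))) *
        exp (- t * x))"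

definition psi :: "real \<Rightarrow> real \<Rightarrow> real" where
  "psi \<mu> x = sin (\<mu> * x + pi / 8) - r_fun (\<mu> * x)"

end

theory Submission
  imports Defs "HOL-Complex_Analysis.Complex_Analysis"
begin

text \<open>By scaling it is enough to look at \<open>\<psi> = psi 1\<close>, extended by \<open>0\<close> to the closed left
half-line (\<open>psi_ext\<close>). The argument has an analytic and a probabilistic half.

\<^bold>\<open>The free semigroup almost multiplies \<psi> by \<open>exp (- h)\<close>.\<close> The Cauchy kernel is the Poisson
kernel of the upper half-plane, so \<open>P\<^sub>h \<psi>\<close> is a bounded harmonic extension of \<open>\<psi>\<close>, and for
\<open>x > 0\<close> it has the closed form (lemma \<open>poisson_psi_ext\<close>)
\<open>P\<^sub>h \<psi> (x) = exp (- h) sin (x + \<pi>/8) - \<integral> \<rho> t exp (- t x) (cos (t h) - sin (t h) / t) dt\<close>,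
where \<open>\<rho>\<close> is the density with \<open>r x = \<integral> \<rho> t exp (- t x) dt\<close>. Consequently the defect
\<open>P\<^sub>h \<psi> - exp (- h) \<psi>\<close> is, on the positive half-line, a Laplace integral of \<open>\<rho>\<close> against a factor
which is both \<open>O(h\<^sup>2 (1 + t\<^sup>2))\<close> and \<open>O(h (1 + t))\<close>. So the defect is \<open>O(h\<^sup>2)\<close> uniformly away from
\<open>0\<close> (\<open>defect_far\<close>), and its \<open>L\<^sup>1\<close> norm is \<open>o(h)\<close> (\<open>defect_L1\<close>, \<open>defect_mass_small\<close>). The
second fact reflects that \<open>\<psi>\<close> vanishes at \<open>0\<close>: a jump there would make the norm of exact order \<open>h\<close>.

\<^bold>\<open>Where the closed form comes from.\<close> Let \<open>\<eta> t = (1/\<pi>) \<integral> ln (t + s) / (1 + s\<^sup>2) ds\<close>. Its analytic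
continuation to the slit plane has an elementary derivative, from which one reads off the two
facts that carry the proof: \<open>A = exp \<circ> \<eta>\<close> satisfies the Wiener-Hopf factorisation
\<open>A z * A (- z) = 1 - \<i> z\<close> in the upper half-plane (\<open>wh_factor_prod\<close>), and
\<open>A \<i> = sqrt 2 * exp (\<i> \<pi>/8)\<close> (\<open>exp_wh_log_ii\<close>), which is where the phase \<open>\<pi>/8\<close> comes from.
The Laplace transform of \<open>r\<close> is
\<open>R z = (cos (\<pi>/8) + z sin (\<pi>/8) - A z / sqrt 2) / (1 + z\<^sup>2)\<close>, and the value of \<open>A \<i>\<close> says that the
singularity at \<open>\<i>\<close> is removable. Rather than verifying this formula, the proof takes \<open>R\<close> as given by it and analyses
\<open>F w = \<integral> exp (\<i> s w) R (\<i> s) ds\<close> over \<open>s > 0\<close>. As a superposition of exponentials \<open>F\<close>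
satisfies the Poisson semigroup property (\<open>fourier_ext_semigroup\<close>), and its boundary values are
found by rotating the ray of integration. Rotation to the positive half-axis, where \<open>R\<close> is real,
shows that \<open>Re F\<close> vanishes on the negative half-line; rotation to the negative half-axis, where by
the factorisation the imaginary part of \<open>R\<close> is \<open>- \<pi> \<rho>\<close>, shows that \<open>Re F = \<pi> r\<close> on the positive
half-line. Hence \<open>Re F / \<pi>\<close> is the Poisson integral of \<open>r\<close> restricted to the positive half-line
(\<open>poisson_r\<close>), and the second rotation also gives its closed form.

\<^bold>\<open>From small steps to the killed process.\<close> Divide \<open>[0, T]\<close> into \<open>2\<^sup>n\<close> steps of length \<open>h\<close> and kill the
process if it is not positive at one of the grid times. By the Markov property, each step
multiplies the expectation of \<open>\<psi>\<close> by \<open>exp (- h)\<close>, up to the expected defect at the current position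
(\<open>markov_step\<close>, \<open>discrete_eigen\<close>). Near \<open>0\<close> the density of that position is bounded uniformly in
time, since the process starts at \<open>x > 0\<close>; so the two estimates on the defect make the sum of all
\<open>2\<^sup>n\<close> errors tend to \<open>0\<close>. It remains to see that killing at all dyadic grid times is the same as
killing at the exit time (\<open>survival_AE_dyadic\<close>). A path for which the two differ touches \<open>0\<close> from
above: for some \<open>m\<close> its values at the dyadic times in \<open>[T/2\<^sup>m, T]\<close> are positive with infimum \<open>0\<close>. This has
probability \<open>0\<close>, because the first increment, over \<open>[0, T/2\<^sup>m]\<close>, has a bounded density and is
independent of all later increments (\<open>rare_near_zero\<close>).\<close>

section \<open>Lebesgue integration over the positive half-line\<close>

text \<open>A measure of its own, rather than \<open>set_lebesgue_integral\<close> over \<open>{0<..}\<close>, makes the Fubini and dominated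
convergence theorems apply without indicator functions.\<close>
definition lborel_pos :: "real measure" where
  "lborel_pos = restrict_space lborel {0<..}"

lemma space_lborel_pos [simp]: "space lborel_pos = {0<..}"
  by (simp add: lborel_pos_def space_restrict_space)

lemma sets_lborel_pos: "sets lborel_pos = sets (restrict_space borel {0<..})"
  by (simp add: lborel_pos_def sets_restrict_space)

lemma ident_lborel_pos [measurable (raw)]: "(\<lambda>x. x) \<in> borel_measurable lborel_pos"
  unfolding lborel_pos_def by (simp add: measurable_restrict_space1)

lemma fst_lborel_pos [measurable]: "fst \<in> borel_measurable (lborel_pos \<Otimes>\<^sub>M N)"
  by (rule measurable_compose[OF measurable_fst ident_lborel_pos])

lemma snd_lborel_pos [measurable]: "snd \<in> borel_measurable (N \<Otimes>\<^sub>M lborel_pos)"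
  by (rule measurable_compose[OF measurable_snd ident_lborel_pos])

lemma borel_measurable_lborel_pos: "f \<in> borel_measurable borel \<Longrightarrow> f \<in> borel_measurable lborel_pos"
  using measurable_compose[OF ident_lborel_pos] by simp

lemma continuous_on_measurable_lborel_pos:
  "continuous_on {0<..} f \<Longrightarrow> f \<in> borel_measurable lborel_pos"
  for f :: "real \<Rightarrow> 'b::topological_space"
  by (subst measurable_cong_sets[OF sets_lborel_pos refl]) (rule borel_measurable_continuous_on_restrict)

interpretation lborel_pos: sigma_finite_measure lborel_pos
  unfolding lborel_pos_def by (rule sigma_finite_measure_restrict_space) (auto intro: lborel.sigma_finite_measure_axioms)

interpretation pos_pos: pair_sigma_finite lborel_pos lborel_pos ..
interpretation pos_line: pair_sigma_finite lborel_pos lborel ..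

lemma integral_lborel_pos:
  "integral\<^sup>L lborel_pos f = (LINT x:{0<..}|lborel. f x)"
  for f :: "real \<Rightarrow> 'b::{banach, second_countable_topology}"
  unfolding lborel_pos_def set_lebesgue_integral_def by (subst integral_restrict_space) auto

lemma integrable_lborel_pos:
  "integrable lborel_pos f \<longleftrightarrow> set_integrable lborel {0<..} f"
  for f :: "real \<Rightarrow> 'b::{banach, second_countable_topology}"
  unfolding lborel_pos_def set_integrable_def by (subst integrable_restrict_space) auto

lemma nn_integral_lborel_pos: "(\<integral>\<^sup>+x. f x \<partial>lborel_pos) = (\<integral>\<^sup>+x. f x * indicator {0<..} x \<partial>lborel)"
  unfolding lborel_pos_def by (subst nn_integral_restrict_space) auto

lemma einterval_0_inf: "einterval 0 \<infinity> = {0<..}"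
  by (auto simp: einterval_def)

lemma lborel_pos_FTC_nonneg:
  fixes f F :: "real \<Rightarrow> real"
  assumes F: "\<And>x. x > 0 \<Longrightarrow> (F has_real_derivative f x) (at x)"
    and c: "\<And>x. x > 0 \<Longrightarrow> isCont f x"
    and nn: "\<And>x. x > 0 \<Longrightarrow> 0 \<le> f x"
    and A: "(F \<longlongrightarrow> A) (at_right 0)" and B: "(F \<longlongrightarrow> B) at_top"
  shows "integrable lborel_pos f" "integral\<^sup>L lborel_pos f = B - A"
proof -
  have A': "((F \<circ> real_of_ereal) \<longlongrightarrow> A) (at_right 0)"
    using A by (simp add: zero_ereal_def ereal_tendsto_simps)
  have B': "((F \<circ> real_of_ereal) \<longlongrightarrow> B) (at_left \<infinity>)"
    using B by (simp add: ereal_tendsto_simps)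
  have *: "set_integrable lborel (einterval 0 \<infinity>) f" "(LBINT x=0..\<infinity>. f x) = B - A"
    by (rule interval_integral_FTC_nonneg[where F=F]; use F c nn A' B' in \<open>auto intro!: AE_I2\<close>)+
  show "integrable lborel_pos f" using *(1) by (simp add: integrable_lborel_pos einterval_0_inf)
  show "integral\<^sup>L lborel_pos f = B - A" 
    using *(2) by (simp add: integral_lborel_pos interval_lebesgue_integral_def einterval_0_inf)
qed

lemma lborel_pos_FTC:
  fixes f F :: "real \<Rightarrow> 'a::euclidean_space"
  assumes F: "\<And>x. x > 0 \<Longrightarrow> (F has_vector_derivative f x) (at x)"
    and c: "\<And>x. x > 0 \<Longrightarrow> isCont f x"
    and i: "integrable lborel_pos f"
    and A: "(F \<longlongrightarrow> A) (at_right 0)" and B: "(F \<longlongrightarrow> B) at_top"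
  shows "integral\<^sup>L lborel_pos f = B - A"
proof -
  have A': "((F \<circ> real_of_ereal) \<longlongrightarrow> A) (at_right 0)"
    using A by (simp add: zero_ereal_def ereal_tendsto_simps)
  have B': "((F \<circ> real_of_ereal) \<longlongrightarrow> B) (at_left \<infinity>)"
    using B by (simp add: ereal_tendsto_simps)
  have *: "(LBINT x=0..\<infinity>. f x) = B - A"
    by (rule interval_integral_FTC_integrable[where F=F]; use F c i A' B' in \<open>auto simp: integrable_lborel_pos einterval_0_inf\<close>)
  show "integral\<^sup>L lborel_pos f = B - A" 
    using * by (simp add: integral_lborel_pos interval_lebesgue_integral_def einterval_0_inf)
qed

lemma recip_1_sq_lborel_pos: "integrable lborel_pos (\<lambda>s. 1 / (1 + s\<^sup>2))" "integral\<^sup>L lborel_pos (\<lambda>s. 1 / (1 + s\<^sup>2)) = pi/2"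
proof -
  have a: "(arctan \<longlongrightarrow> 0) (at_right 0)"
    by (rule tendsto_eq_intros tendsto_mono[OF _ tendsto_ident_at] | simp)+
  have d: "(arctan has_real_derivative 1 / (1 + x\<^sup>2)) (at x)" for x
    by (auto intro!: derivative_eq_intros simp: inverse_eq_divide)
  have c: "isCont (\<lambda>s. 1 / (1 + s\<^sup>2)) x" for x :: real
    by (intro continuous_intros) (auto simp: add_nonneg_eq_0_iff)
  note * = lborel_pos_FTC_nonneg[OF d c _ a tendsto_arctan_at_top]
  show "integrable lborel_pos (\<lambda>s. 1 / (1 + s\<^sup>2))" by (rule *(1)) auto
  show "integral\<^sup>L lborel_pos (\<lambda>s. 1 / (1 + s\<^sup>2)) = pi/2" by (subst *(2)) auto
qed

lemma lborel_pos_integrable_bound: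
  fixes f :: "real \<Rightarrow> 'a::{banach, second_countable_topology}" and g :: "real \<Rightarrow> real"
  assumes "integrable lborel_pos g" "f \<in> borel_measurable lborel_pos" "\<And>x. x > 0 \<Longrightarrow> norm (f x) \<le> g x"
  shows "integrable lborel_pos f"
  by (rule Bochner_Integration.integrable_bound[OF assms(1,2)]) (use assms(3) in \<open>auto intro!: AE_I2 order_trans[OF assms(3)]\<close>)

text \<open>The majorant for everything that has a square root singularity at \<open>0\<close> and decays like \<open>s powr (- 3/2)\<close>;
a primitive is \<open>2 * arctan (sqrt s)\<close>.\<close>
lemma integrable_recip_sqrt: "integrable lborel_pos (\<lambda>s. 1 / (sqrt s * (1 + s)))"
proof (rule lborel_pos_FTC_nonneg(1)[where F="\<lambda>s. 2 * arctan (sqrt s)" and A = 0 and B = pi])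
  show "((\<lambda>s. 2 * arctan (sqrt s)) has_real_derivative 1 / (sqrt x * (1 + x))) (at x)" if "x > 0" for x
    using that by (auto intro!: derivative_eq_intros simp: divide_simps)
  show "((\<lambda>s. 2 * arctan (sqrt s)) \<longlongrightarrow> 0) (at_right 0)"
    by (rule tendsto_eq_intros tendsto_mono[OF _ tendsto_ident_at] | simp)+
  have "((\<lambda>s. 2 * arctan (sqrt s)) \<longlongrightarrow> 2 * (pi/2)) at_top"
    by (intro tendsto_intros filterlim_compose[OF tendsto_arctan_at_top sqrt_at_top])
  then show "((\<lambda>s. 2 * arctan (sqrt s)) \<longlongrightarrow> pi) at_top" by simp
qed (auto intro!: continuous_intros)

lemma exp_lborel_pos: "a > 0 \<Longrightarrow> integrable lborel_pos (\<lambda>s. exp (- a * s))" 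
  "a > 0 \<Longrightarrow> integral\<^sup>L lborel_pos (\<lambda>s. exp (- a * s)) = 1 / a"
proof -
  assume a: "a > 0"
  have 1: "((\<lambda>s. - exp (-a * s)/a) \<longlongrightarrow> - exp (- a * 0)/a) (at_right 0)"
    by (intro tendsto_intros) (use a in auto)
  have 2: "((\<lambda>s. - exp (-a * s)/a) \<longlongrightarrow> 0) at_top" using a by real_asymp
  note * = lborel_pos_FTC_nonneg[of "\<lambda>s. - exp (-a * s)/a" "\<lambda>s. exp (- a * s)", OF _ _ _ 1 2]
  show "integrable lborel_pos (\<lambda>s. exp (- a * s))" 
    by (rule *(1)) (use a in \<open>auto intro!: derivative_eq_intros\<close>)
  show "integral\<^sup>L lborel_pos (\<lambda>s. exp (- a * s)) = 1 / a" 
    by (subst *(2)) (use a in \<open>auto intro!: derivative_eq_intros\<close>)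
qed

lemma cexp_lborel_pos:
  fixes a :: complex assumes a: "Re a > 0"
  shows "integrable lborel_pos (\<lambda>s. exp (- a * of_real s))" "integral\<^sup>L lborel_pos (\<lambda>s. exp (- a * of_real s)) = 1 / a"
proof -
  show i: "integrable lborel_pos (\<lambda>s. exp (- a * of_real s))"
    by (rule lborel_pos_integrable_bound[OF exp_lborel_pos(1)[OF a]]) (auto simp: norm_exp_eq_Re)
  have a0: "a \<noteq> 0" using a by auto
  have 1: "((\<lambda>s. - exp (-a * of_real s)/a) \<longlongrightarrow> - exp (- a * of_real 0)/a) (at_right (0::real))"
    by (intro tendsto_intros) (use a0 in auto)
  have 2: "((\<lambda>s. - exp (-a * of_real s)/a) \<longlongrightarrow> 0) at_top"
  proof (rule tendsto_norm_zero_cancel)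
    have "((\<lambda>s. exp (-Re a * s) / norm a) \<longlongrightarrow> 0) at_top" using a a0 by real_asymp
    then show "((\<lambda>s. norm (- exp (-a * of_real s)/a)) \<longlongrightarrow> 0) at_top" by (simp add: norm_divide norm_exp_eq_Re)
  qed
  have "integral\<^sup>L lborel_pos (\<lambda>s. exp (- a * of_real s)) = 0 - (- exp (- a * of_real 0)/a)"
  proof (rule lborel_pos_FTC[OF _ _ i 1 2])
    fix x :: real
    have "((\<lambda>z. - exp (-a * z)/a) has_field_derivative exp (-a * of_real x)) (at (of_real x))"
      using a0 by (auto intro!: derivative_eq_intros)
    then show "((\<lambda>s. - exp (-a * of_real s)/a) has_vector_derivative exp (- a * of_real x)) (at x)"
      by (rule has_vector_derivative_real_field)
  qed (intro continuous_intros)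
  then show "integral\<^sup>L lborel_pos (\<lambda>s. exp (- a * of_real s)) = 1 / a" by simp
qed

section \<open>The function eta\<close>

definition eta :: "real \<Rightarrow> real" where
  "eta t = (1 / pi) * (\<integral>s. ln (t + s) / (1 + s\<^sup>2) \<partial>lborel_pos)"

lemma abs_ln_le_sqrt:
  fixes u :: real assumes "u > 0"
  shows "\<bar>ln u\<bar> \<le> 2 * sqrt u + 2 / sqrt u"
proof -
  have "ln (sqrt u) \<le> sqrt u" "ln (1 / sqrt u) \<le> 1 / sqrt u"
    using ln_le_minus_one[of "sqrt u"] ln_le_minus_one[of "1 / sqrt u"] assms by simp_all
  then show ?thesis using assms by (auto simp: ln_sqrt ln_div abs_le_iff intro: order_trans[of _ "2 * sqrt u"] order_trans[of _ "2 / sqrt u"])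
qed

definition eta_bound :: "real \<Rightarrow> real \<Rightarrow> real" where
  "eta_bound t s = 2 * sqrt t * (1 / (1 + s\<^sup>2)) + 8 * (1 / (sqrt s * (1 + s)))"

lemma integrable_eta_bound: "integrable lborel_pos (eta_bound t)"
  unfolding eta_bound_def
  by (intro Bochner_Integration.integrable_add integrable_mult_right recip_1_sq_lborel_pos(1) integrable_recip_sqrt)

text \<open>From \<open>\<bar>ln u\<bar> \<le> 2 * sqrt u + 2 / sqrt u\<close>. The majorant is monotone in \<open>t\<close>, so it also serves as a
common one for all small \<open>t\<close>.\<close>
lemma eta_integrand_bound:
  fixes s t :: real assumes t: "0 \<le> t" and s: "0 < s"
  shows "norm (ln (t + s) / (1 + s\<^sup>2)) \<le> eta_bound t s"
proof -
  have s2: "1 + s\<^sup>2 > 0" by (smt (verit) zero_le_power2)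
  have "\<bar>ln (t + s)\<bar> \<le> 2 * sqrt (t + s) + 2 / sqrt (t + s)"
    using abs_ln_le_sqrt[of "t + s"] assms by simp
  also have "\<dots> \<le> 2 * (sqrt t + sqrt s) + 2 / sqrt s"
    using sqrt_add_le_add_sqrt[of t s] assms by (intro add_mono mult_left_mono divide_left_mono) auto
  finally have 1: "norm (ln (t + s) / (1 + s\<^sup>2)) \<le> (2 * (sqrt t + sqrt s) + 2 / sqrt s) / (1 + s\<^sup>2)"
    using s2 by (simp add: divide_right_mono)
  have a: "sqrt s / (1 + s\<^sup>2) \<le> 2 * (1 / (sqrt s * (1 + s)))"
  proof -
    have "s + s\<^sup>2 \<le> 2 * (1 + s\<^sup>2)" using sum_power2_ge_zero[of "s - 1" 0] by (simp add: power2_eq_square algebra_simps; sos)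
    then have "sqrt s * (sqrt s * (1 + s)) \<le> 2 * (1 + s\<^sup>2)" using s by (simp add: algebra_simps power2_eq_square)
    then show ?thesis using s s2 by (simp add: divide_simps split: if_splits) 
  qed
  have b: "1 / sqrt s / (1 + s\<^sup>2) \<le> 2 * (1 / (sqrt s * (1 + s)))"
  proof -
    have "1 + s \<le> 2 * (1 + s\<^sup>2)" by sos
    then have "1 / (1 + s\<^sup>2) \<le> 2 / (1 + s)" using s s2 by (simp add: field_simps)
    from mult_left_mono[OF this, of "1 / sqrt s"] show ?thesis using s by simp
  qed
  have "(2 * (sqrt t + sqrt s) + 2 / sqrt s) / (1 + s\<^sup>2) = 2 * sqrt t * (1 / (1 + s\<^sup>2)) + 2 * (sqrt s / (1 + s\<^sup>2)) + 2 * (1 / sqrt s / (1 + s\<^sup>2))"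
    by (simp add: add_divide_distrib algebra_simps)
  then show ?thesis using 1 a b unfolding eta_bound_def by simp
qed

lemma integrable_eta:
  assumes "0 \<le> t" shows "integrable lborel_pos (\<lambda>s. ln (t + s) / (1 + s\<^sup>2))"
  by (rule lborel_pos_integrable_bound[OF integrable_eta_bound[of t]]) (use eta_integrand_bound[OF assms] in auto)

lemma measurable_eta [measurable]: "eta \<in> borel_measurable borel"
  unfolding eta_def by measurable

text \<open>The substitution \<open>s \<mapsto> 1/s\<close> changes the sign of the integrand. On \<open>[1/n, n]\<close> this is expressed by a
primitive \<open>F\<close>: the derivative of \<open>F x - F (1/x)\<close> vanishes.\<close>
lemma integral_ln_over_1_sq: "(\<integral>s. ln s / (1 + s\<^sup>2) \<partial>lborel_pos) = 0"
proof -
  define f :: "real \<Rightarrow> real" where "f = (\<lambda>s. ln s / (1 + s\<^sup>2))"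
  have s2: "1 + s\<^sup>2 \<noteq> 0" for s :: real by (smt (verit) zero_le_power2)
  have fm [measurable]: "f \<in> borel_measurable borel" unfolding f_def by measurable
  have fi: "integrable lborel_pos f" using integrable_eta[of 0] by (simp add: f_def)
  have z: "(\<integral>x. f x * indicator {1/n..n} x \<partial>lborel) = 0" if n: "n > 1" for n :: real
  proof -
    define a where "a = 1 / (n + 1)"
    have a: "0 < a" "a < 1/n" "1/n < 1" "n < n + 1" using n by (auto simp: a_def divide_simps)
    define F where "F x = integral {a..x} f" for x
    have Fd: "(F has_real_derivative f x) (at x)" if "a < x" "x < n + 1" for x
    proof -
      have "continuous_on {a..n+1} f" unfolding f_def using a by (intro continuous_intros) (auto simp: s2)
      then have "(F has_real_derivative f x) (at x within {a..n+1})" 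
        unfolding F_def using that by (intro integral_has_real_derivative) auto
      then show ?thesis using that by (simp add: at_within_Icc_at)
    qed
    have D: "((\<lambda>x. F x - F (1/x)) has_real_derivative 0) (at x)" if "1 \<le> x" "x \<le> n" for x
    proof -
      have x: "a < 1/x" "1/x < n+1" "a < x" "x < n+1"
      proof -
        have "1 * (n + 1) \<le> x * (n + 1)" using that n by (intro mult_right_mono) auto
        moreover have "1 < 1 * (n + 1)" using n by simp
        ultimately have "1 < x * (n + 1)" by (rule less_le_trans[rotated])
        moreover have "0 < x" "0 < n + 1" using that n by auto
        ultimately show "a < 1/x" "1/x < n+1" unfolding a_def 
          using that by (simp_all add: pos_divide_less_eq pos_less_divide_eq mult.commute[of x])
        show "a < x" "x < n+1" using that a by linarith+
      qed
      have "((\<lambda>x. F x - F (1/x)) has_real_derivative f x - f (1/x) * (-1/x\<^sup>2)) (at x)"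
      proof (rule DERIV_diff[OF Fd DERIV_chain2[OF Fd]])
        show "((\<lambda>x. 1 / x) has_real_derivative - 1 / x\<^sup>2) (at x)"
          using that by (auto intro!: derivative_eq_intros simp: power2_eq_square)
      qed (use x in auto)
      also have "f x - f (1/x) * (-1/x\<^sup>2) = 0"
        using that s2[of x] unfolding f_def by (simp add: ln_div divide_simps power2_eq_square)
      finally show ?thesis .
    qed
    have "F n - F (1/n) = F 1 - F (1/1)"
    proof -
      have c: "continuous_on {1..n} (\<lambda>x. F x - F (1/x))"
        by (rule DERIV_continuous_on[where D="\<lambda>_. 0"], rule has_field_derivative_at_within, rule D) auto
      show ?thesis
        by (rule DERIV_isconst2[OF _ c D]) (use n in auto)
    qed
    then have *: "F n = F (1/n)" by simp
    have "(\<integral>x. f x * indicator {1/n..n} x \<partial>lborel) = F n - F (1/n)"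
    proof (rule integral_FTC_Icc_real)
      show "1 / n \<le> n" using a(3) n by linarith
      fix x assume x: "1 / n \<le> x" "x \<le> n"
      then have "a < x" "x < n + 1" using a by linarith+
      then show "(F has_real_derivative f x) (at x)" by (rule Fd)
      have "x > 0" using a x by linarith
      then show "isCont f x" unfolding f_def using s2[of x] by (intro continuous_intros) auto
    qed
    then show ?thesis using * by simp
  qed
  have "(\<lambda>i. \<integral>x. f x * indicator {1/(real i + 2)..real i + 2} x \<partial>lborel_pos) \<longlonglongrightarrow> (\<integral>x. f x \<partial>lborel_pos)"
  proof (rule integral_dominated_convergence[where w="\<lambda>x. \<bar>f x\<bar>"])
    show "AE x in lborel_pos. (\<lambda>i. f x * indicator {1/(real i + 2)..real i + 2} x) \<longlonglongrightarrow> f x"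
    proof (rule AE_I2)
      fix x assume "x \<in> space lborel_pos" then have x: "x > 0" by simp
      have "\<forall>\<^sub>F i in sequentially. 1/(real i + 2) < x" "\<forall>\<^sub>F i in sequentially. x < real i + 2"
        using x by real_asymp+
      then have "\<forall>\<^sub>F i in sequentially. f x * indicator {1/(real i + 2)..real i + 2} x = f x"
        by eventually_elim (auto simp: indicator_def)
      then show "(\<lambda>i. f x * indicator {1/(real i + 2)..real i + 2} x) \<longlonglongrightarrow> f x"
        by (rule tendsto_eventually)
    qed
    show "AE x in lborel_pos. norm (f x * indicator {1/(real i + 2)..real i + 2} x) \<le> \<bar>f x\<bar>" for i
      by (auto simp: indicator_def)
  qed (use fi in \<open>auto intro!: borel_measurable_lborel_pos\<close>)
  moreover have "(\<integral>x. f x * indicator {1/(real i + 2)..real i + 2} x \<partial>lborel_pos) = 0" for i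
  proof -
    have pos: "0 < 1 / (real i + 2)" by simp
    then have "(\<integral>x. f x * indicator {1/(real i + 2)..real i + 2} x \<partial>lborel_pos) = (\<integral>x. f x * indicator {1/(real i + 2)..real i + 2} x \<partial>lborel)"
      unfolding integral_lborel_pos set_lebesgue_integral_def
      by (intro Bochner_Integration.integral_cong) (auto simp: indicator_def dest: less_le_trans[OF pos])
    then show ?thesis using z[of "real i + 2"] by simp
  qed
  ultimately show ?thesis unfolding f_def by (simp add: LIMSEQ_const_iff)
qed

text \<open>The integral \<open>(1/\<pi>) \<integral> 1 / ((u + s) (1 + s\<^sup>2)) ds\<close>, which is the derivative of \<open>eta\<close>, in closed form.\<close>
definition eta_deriv :: "real \<Rightarrow> real" where
  "eta_deriv u = (u / 2 - ln u / pi) / (1 + u\<^sup>2)"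

lemma eta_deriv_integral:
  assumes u: "u > 0"
  shows "(\<integral>\<^sup>+s. ennreal (1 / ((u + s) * (1 + s\<^sup>2))) \<partial>lborel_pos) = ennreal (pi * eta_deriv u)" "eta_deriv u \<ge> 0"
proof -
  have p: "1 + x\<^sup>2 > 0" for x :: real by (smt (verit) zero_le_power2)
  \<comment> \<open>the primitive found by partial fractions\<close>
  define F where "F = (\<lambda>s. (ln (u + s) - ln (1 + s\<^sup>2) / 2 + u * arctan s) / (1 + u\<^sup>2))"
  have d: "(F has_real_derivative 1 / ((u + x) * (1 + x\<^sup>2))) (at x)" if "x > 0" for x
  proof -
    have "(F has_real_derivative (1/(u+x) - (2*x/(1+x\<^sup>2))/2 + u * (1/(1+x\<^sup>2))) / (1+u\<^sup>2)) (at x)"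
      unfolding F_def using u that p[of x] p[of u]
      by (auto intro!: derivative_eq_intros simp: inverse_eq_divide power2_eq_square divide_simps) (simp add: algebra_simps)
    also have "(1/(u+x) - (2*x/(1+x\<^sup>2))/2 + u * (1/(1+x\<^sup>2))) / (1+u\<^sup>2) = 1 / ((u + x) * (1 + x\<^sup>2))"
    proof -
      have "(1/(u+x) - (2*x/(1+x\<^sup>2))/2 + u * (1/(1+x\<^sup>2))) = (1 + u\<^sup>2) / ((u+x)*(1+x\<^sup>2))"
        using u that p[of x] by (simp add: divide_simps) (simp add: algebra_simps power2_eq_square)
      then show ?thesis using p[of u] by simp
    qed
    finally show ?thesis .
  qed
  have 0: "(F \<longlongrightarrow> ln u / (1 + u\<^sup>2)) (at_right 0)"
    unfolding F_def using u p[of u] by (auto intro!: tendsto_eq_intros)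
  have i: "(F \<longlongrightarrow> (u * (pi/2)) / (1 + u\<^sup>2)) at_top"
  proof -
    have "((\<lambda>s. ln (u + s) - ln (1 + s\<^sup>2) / 2) \<longlongrightarrow> 0) at_top" using u by real_asymp
    then have "((\<lambda>s. (ln (u + s) - ln (1 + s\<^sup>2) / 2) + u * arctan s) \<longlongrightarrow> 0 + u * (pi/2)) at_top"
      by (intro tendsto_intros tendsto_arctan_at_top)
    from tendsto_divide[OF this tendsto_const, of "1 + u\<^sup>2"] show ?thesis unfolding F_def using p[of u] by simp
  qed
  have c: "isCont (\<lambda>s. 1 / ((u + s) * (1 + s\<^sup>2))) x" if "x > 0" for x
    using u that p[of x] by (intro continuous_intros) auto
  have nn: "0 \<le> 1 / ((u + x) * (1 + x\<^sup>2))" if "x > 0" for x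
    using u that p[of x] by auto
  have eq: "(u * (pi/2)) / (1 + u\<^sup>2) - ln u / (1 + u\<^sup>2) = pi * eta_deriv u"
  proof -
    have "pi * (u / 2 - ln u / pi) = u * (pi / 2) - ln u" by (simp add: algebra_simps)
    then show ?thesis unfolding eta_deriv_def times_divide_eq_right by (simp only: diff_divide_distrib)
  qed
  note * = lborel_pos_FTC_nonneg[OF d c nn 0 i]
  have **: "integral\<^sup>L lborel_pos (\<lambda>s. 1 / ((u + s) * (1 + s\<^sup>2))) = pi * eta_deriv u" using *(2) eq by simp
  show "(\<integral>\<^sup>+s. ennreal (1 / ((u + s) * (1 + s\<^sup>2))) \<partial>lborel_pos) = ennreal (pi * eta_deriv u)"
    by (subst nn_integral_eq_integral[OF *(1)]) (use nn ** in auto)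
  have "0 \<le> pi * eta_deriv u" unfolding **[symmetric] by (rule Bochner_Integration.integral_nonneg) (use nn in auto)
  then show "eta_deriv u \<ge> 0" using pi_gt_zero by (simp only: zero_le_mult_iff) auto
qed

text \<open>Instead of differentiating under the integral sign, integrate \<open>1 / ((u + s) (1 + s\<^sup>2))\<close> over
\<open>t1 \<le> u \<le> t2\<close> and \<open>s > 0\<close> in both orders. Any primitive \<open>G\<close> may be used; the one needed below is the
restriction of an analytic function.\<close>
lemma eta_diff:
  assumes G: "\<And>u. u > 0 \<Longrightarrow> (G has_real_derivative eta_deriv u) (at u)" and t: "0 < t1" "t1 \<le> t2"
  shows "eta t2 - eta t1 = G t2 - G t1"
proof -
  have p: "1 + x\<^sup>2 > 0" for x :: real by (smt (verit) zero_le_power2)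
  let ?h = "\<lambda>s u. ennreal (1 / ((u + s) * (1 + s\<^sup>2))) * indicator {t1..t2} u"
  have q [measurable]: "eta_deriv \<in> borel_measurable borel" unfolding eta_deriv_def by measurable
  have "(\<integral>\<^sup>+s. (\<integral>\<^sup>+u. ?h s u \<partial>lborel) \<partial>lborel_pos) = (\<integral>\<^sup>+u. (\<integral>\<^sup>+s. ?h s u \<partial>lborel_pos) \<partial>lborel)"
    by (rule pos_line.Fubini'[symmetric]) measurable
  also have "\<dots> = (\<integral>\<^sup>+u. ennreal (pi * eta_deriv u) * indicator {t1..t2} u \<partial>lborel)"
  proof (rule nn_integral_cong)
    fix u
    show "(\<integral>\<^sup>+s. ?h s u \<partial>lborel_pos) = ennreal (pi * eta_deriv u) * indicator {t1..t2} u"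
    proof (cases "u \<in> {t1..t2}")
      case True
      then show ?thesis using eta_deriv_integral[of u] t by simp
    qed simp
  qed
  also have "\<dots> = ennreal (pi * G t2 - pi * G t1)"
    by (rule nn_integral_FTC_Icc) (use t G eta_deriv_integral in \<open>auto intro!: derivative_eq_intros\<close>)
  finally have 1: "(\<integral>\<^sup>+s. (\<integral>\<^sup>+u. ?h s u \<partial>lborel) \<partial>lborel_pos) = ennreal (pi * G t2 - pi * G t1)" .
  have 2: "(\<integral>\<^sup>+u. ?h s u \<partial>lborel) = ennreal (ln (t2 + s) / (1 + s\<^sup>2) - ln (t1 + s) / (1 + s\<^sup>2))" if "s > 0" for s
    by (rule nn_integral_FTC_Icc[where F = "\<lambda>u. ln (u + s) / (1 + s\<^sup>2)"])
       (use t that p[of s] in \<open>auto intro!: derivative_eq_intros simp: divide_simps\<close>)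
  have i: "integrable lborel_pos (\<lambda>s. ln (t2 + s) / (1 + s\<^sup>2) - ln (t1 + s) / (1 + s\<^sup>2))"
    using t by (intro Bochner_Integration.integrable_diff integrable_eta) auto
  have nn: "0 \<le> ln (t2 + s) / (1 + s\<^sup>2) - ln (t1 + s) / (1 + s\<^sup>2)" if "s > 0" for s
    using t that p[of s] by (auto simp: divide_right_mono)
  have "(\<integral>\<^sup>+s. (\<integral>\<^sup>+u. ?h s u \<partial>lborel) \<partial>lborel_pos) = (\<integral>\<^sup>+s. ennreal (ln (t2 + s) / (1 + s\<^sup>2) - ln (t1 + s) / (1 + s\<^sup>2)) \<partial>lborel_pos)"
    by (rule nn_integral_cong) (use 2 in auto)
  also have "\<dots> = ennreal (\<integral>s. (ln (t2 + s) / (1 + s\<^sup>2) - ln (t1 + s) / (1 + s\<^sup>2)) \<partial>lborel_pos)"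
    by (rule nn_integral_eq_integral[OF i]) (use nn in auto)
  also have "(\<integral>s. (ln (t2 + s) / (1 + s\<^sup>2) - ln (t1 + s) / (1 + s\<^sup>2)) \<partial>lborel_pos) = pi * eta t2 - pi * eta t1"
    unfolding eta_def using t by (subst Bochner_Integration.integral_diff) (auto intro!: integrable_eta)
  finally have "ennreal (pi * eta t2 - pi * eta t1) = ennreal (pi * G t2 - pi * G t1)" using 1 by simp
  moreover have "pi * eta t2 - pi * eta t1 \<ge> 0"
  proof -
    have "(\<integral>s. (ln (t2 + s) / (1 + s\<^sup>2) - ln (t1 + s) / (1 + s\<^sup>2)) \<partial>lborel_pos) \<ge> 0"
      by (rule Bochner_Integration.integral_nonneg) (use nn in auto)
    also have "(\<integral>s. (ln (t2 + s) / (1 + s\<^sup>2) - ln (t1 + s) / (1 + s\<^sup>2)) \<partial>lborel_pos) = pi * eta t2 - pi * eta t1"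
      unfolding eta_def using t by (subst Bochner_Integration.integral_diff) (auto intro!: integrable_eta)
    finally show ?thesis .
  qed
  moreover have "pi * G t2 - pi * G t1 \<ge> 0"
  proof -
    have "G t1 \<le> G t2"
      by (rule DERIV_nonneg_imp_nondecreasing[OF t(2)]) (use t G eta_deriv_integral(2) in \<open>meson less_le_trans\<close>)
    then show ?thesis by simp
  qed
  ultimately have "pi * (eta t2 - eta t1) = pi * (G t2 - G t1)" by (simp add: algebra_simps)
  then show ?thesis by simp
qed

lemma eta_tendsto_0: "(eta \<longlongrightarrow> 0) (at_right 0)"
proof -
  have "((\<lambda>x. \<integral>s. ln (inverse x + s) / (1 + s\<^sup>2) \<partial>lborel_pos) \<longlongrightarrow> (\<integral>s. ln s / (1 + s\<^sup>2) \<partial>lborel_pos)) at_top"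
  proof (rule integral_dominated_convergence_at_top[where w="eta_bound 1"])
    show "\<forall>\<^sub>F i in at_top. AE x in lborel_pos. norm (ln (inverse i + x) / (1 + x\<^sup>2)) \<le> eta_bound 1 x"
      using eventually_ge_at_top[of 1]
    proof eventually_elim
      fix i :: real assume i: "1 \<le> i"
      show "AE x in lborel_pos. norm (ln (inverse i + x) / (1 + x\<^sup>2)) \<le> eta_bound 1 x"
      proof (rule AE_I2)
        fix x assume "x \<in> space lborel_pos" then have x: "x > 0" by simp
        have "norm (ln (inverse i + x) / (1 + x\<^sup>2)) \<le> eta_bound (inverse i) x"
          using i x by (intro eta_integrand_bound) auto
        also have "\<dots> \<le> eta_bound 1 x" unfolding eta_bound_def
          using i by (intro add_mono mult_right_mono order_refl) (auto simp: field_simps real_sqrt_le_1_iff)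
        finally show "norm (ln (inverse i + x) / (1 + x\<^sup>2)) \<le> eta_bound 1 x" .
      qed
    qed
    show "AE x in lborel_pos. ((\<lambda>i. ln (inverse i + x) / (1 + x\<^sup>2)) \<longlongrightarrow> ln x / (1 + x\<^sup>2)) at_top"
    proof (rule AE_I2)
      fix x assume "x \<in> space lborel_pos" then have x: "x > 0" by simp
      have "1 + x\<^sup>2 \<noteq> 0" by (smt (verit) zero_le_power2)
      moreover have "((\<lambda>i. inverse i + x) \<longlongrightarrow> 0 + x) at_top"
        by (intro tendsto_intros tendsto_inverse_0_at_top filterlim_ident)
      ultimately show "((\<lambda>i. ln (inverse i + x) / (1 + x\<^sup>2)) \<longlongrightarrow> ln x / (1 + x\<^sup>2)) at_top"
        using x by (intro tendsto_intros) auto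
    qed
  qed (auto intro: integrable_eta_bound)
  then have "((\<lambda>x. eta (inverse x)) \<longlongrightarrow> (1/pi) * 0) at_top"
    unfolding eta_def integral_ln_over_1_sq by (intro tendsto_intros)
  then show ?thesis by (simp add: filterlim_at_right_to_top)
qed

lemma eta_nonneg: assumes "t > 0" shows "eta t \<ge> 0"
proof -
  have "(\<integral>s. ln s / (1 + s\<^sup>2) \<partial>lborel_pos) \<le> (\<integral>s. ln (t + s) / (1 + s\<^sup>2) \<partial>lborel_pos)"
  proof (rule integral_mono)
    show "integrable lborel_pos (\<lambda>s. ln s / (1 + s\<^sup>2))" using integrable_eta[of 0] by simp
    show "integrable lborel_pos (\<lambda>s. ln (t + s) / (1 + s\<^sup>2))" using integrable_eta[of t] assms by simp
    show "ln s / (1 + s\<^sup>2) \<le> ln (t + s) / (1 + s\<^sup>2)" if "s \<in> space lborel_pos" for s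
      using that assms by (intro divide_right_mono) auto
  qed
  then show ?thesis using integral_ln_over_1_sq unfolding eta_def by simp
qed

lemma eta_ge_half_ln: assumes "t > 0" shows "eta t \<ge> ln t / 2"
proof -
  have "(\<integral>s. ln t * (1 / (1 + s\<^sup>2)) \<partial>lborel_pos) \<le> (\<integral>s. ln (t + s) / (1 + s\<^sup>2) \<partial>lborel_pos)"
  proof (rule integral_mono)
    show "integrable lborel_pos (\<lambda>s. ln t * (1 / (1 + s\<^sup>2)))" by (intro integrable_mult_right recip_1_sq_lborel_pos)
    show "integrable lborel_pos (\<lambda>s. ln (t + s) / (1 + s\<^sup>2))" using integrable_eta[of t] assms by simp
    show "ln t * (1 / (1 + s\<^sup>2)) \<le> ln (t + s) / (1 + s\<^sup>2)" if "s \<in> space lborel_pos" for s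
      using that assms divide_right_mono[of "ln t" "ln (t + s)" "1 + s\<^sup>2"] by auto
  qed
  also have "(\<integral>s. ln t * (1 / (1 + s\<^sup>2)) \<partial>lborel_pos) = ln t * (pi / 2)"
    by (subst Bochner_Integration.integral_mult_right_zero) (simp only: recip_1_sq_lborel_pos(2))
  finally show ?thesis unfolding eta_def by (simp add: field_simps)
qed

section \<open>The Wiener-Hopf factor\<close>

definition slit_plane :: "complex set" where "slit_plane = - \<real>\<^sub>\<le>\<^sub>0"

lemma slit_plane_iff: "z \<in> slit_plane \<longleftrightarrow> Re z > 0 \<or> Im z \<noteq> 0"
  unfolding slit_plane_def by (auto simp: complex_nonpos_Reals_iff not_le)

lemma open_slit_plane [simp]: "open slit_plane"
  unfolding slit_plane_def by (simp add: open_Compl)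

lemma starlike_slit_plane: "starlike slit_plane"
proof -
  have eq: "slit_plane = -(complex_of_real ` {..0})"
    unfolding slit_plane_def nonpos_Reals_def by auto
  show ?thesis unfolding eq by (rule starlike_slotted_complex_plane_left)
qed

lemma connected_slit_plane: "connected slit_plane"
  by (rule starlike_imp_connected[OF starlike_slit_plane])

lemma Ln_holo_slit_plane: "Ln holomorphic_on slit_plane"
  by (rule holomorphic_on_Ln) (auto simp: slit_plane_def)

lemma Ln_deriv_slit_plane: "z \<in> slit_plane \<Longrightarrow> (Ln has_field_derivative inverse z) (at z)"
  by (rule has_field_derivative_Ln) (auto simp: slit_plane_def)

definition wh_log_deriv_num :: "complex \<Rightarrow> complex" where
  "wh_log_deriv_num z = z / 2 - Ln z / pi"

definition wh_log_deriv_aux :: "complex \<Rightarrow> complex" where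
  "wh_log_deriv_aux z = (if z = \<i> then deriv wh_log_deriv_num \<i> else (wh_log_deriv_num z - wh_log_deriv_num \<i>) / (z - \<i>))"

text \<open>The analytic function \<open>(z/2 - Ln z / \<pi>) / (1 + z\<^sup>2)\<close>, which extends \<open>eta_deriv\<close>. The numerator vanishes
at \<open>\<i>\<close> and at \<open>- \<i>\<close>, and both singularities are removed one after the other by difference quotients.\<close>
definition wh_log_deriv :: "complex \<Rightarrow> complex" where
  "wh_log_deriv z = (if z = - \<i> then deriv wh_log_deriv_aux (-\<i>) else (wh_log_deriv_aux z - wh_log_deriv_aux (-\<i>)) / (z - (-\<i>)))"

lemma wh_log_deriv_eq:
  assumes "z \<noteq> \<i>" "z \<noteq> - \<i>" shows "wh_log_deriv z = wh_log_deriv_num z / (1 + z\<^sup>2)"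
proof -
  have i: "wh_log_deriv_num \<i> = 0" "wh_log_deriv_num (-\<i>) = 0" by (auto simp: wh_log_deriv_num_def)
  have "wh_log_deriv_aux (-\<i>) = 0" by (simp add: wh_log_deriv_aux_def i)
  then have "wh_log_deriv z = wh_log_deriv_num z / (z - \<i>) / (z + \<i>)" using assms by (simp add: wh_log_deriv_def wh_log_deriv_aux_def i)
  also have "\<dots> = wh_log_deriv_num z / (1 + z\<^sup>2)" by (simp add: algebra_simps power2_eq_square)
  finally show ?thesis .
qed

lemma wh_log_deriv_holo: "wh_log_deriv holomorphic_on slit_plane"
proof -
  have 1: "wh_log_deriv_num holomorphic_on slit_plane" unfolding wh_log_deriv_num_def
    by (intro holomorphic_intros Ln_holo_slit_plane) auto
  have 2: "wh_log_deriv_aux holomorphic_on slit_plane" unfolding wh_log_deriv_aux_def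
    by (rule pole_lemma_open[OF 1 open_slit_plane])
  show ?thesis unfolding wh_log_deriv_def by (rule pole_lemma_open[OF 2 open_slit_plane])
qed

lemma one_plus_sq_nonzero: "1 + z\<^sup>2 \<noteq> 0" if "z \<noteq> \<i>" "z \<noteq> - \<i>" for z :: complex
proof
  assume "1 + z\<^sup>2 = 0"
  then have "(z - \<i>) * (z + \<i>) = 0" by (simp add: algebra_simps power2_eq_square)
  then show False using that by (simp add: eq_neg_iff_add_eq_0)
qed

lemma wh_log_deriv_of_real: "t > 0 \<Longrightarrow> wh_log_deriv (of_real t) = of_real (eta_deriv t)"
  by (subst wh_log_deriv_eq) (auto simp: wh_log_deriv_num_def eta_deriv_def Ln_of_real complex_eq_iff)

text \<open>The analytic continuation of \<open>eta\<close>, obtained as a primitive on the (starlike) slit plane. It is the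
logarithm of the Wiener-Hopf factor.\<close>
definition wh_log :: "complex \<Rightarrow> complex" where
  "wh_log = (SOME g. (\<forall>z\<in>slit_plane. (g has_field_derivative wh_log_deriv z) (at z)) \<and> g 1 = of_real (eta 1))"

lemma wh_log_props: "(\<forall>z\<in>slit_plane. (wh_log has_field_derivative wh_log_deriv z) (at z)) \<and> wh_log 1 = of_real (eta 1)"
proof -
  have "\<exists>g. \<forall>z\<in>slit_plane. (g has_field_derivative wh_log_deriv z) (at z)"
  proof (rule holomorphic_starlike_primitive[where k="{}"])
    show "continuous_on slit_plane wh_log_deriv" by (rule holomorphic_on_imp_continuous_on[OF wh_log_deriv_holo])
    show "\<And>x. x \<in> slit_plane - {} \<Longrightarrow> wh_log_deriv field_differentiable at x"
      using wh_log_deriv_holo holomorphic_on_imp_differentiable_at open_slit_plane by auto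
  qed (use starlike_slit_plane in auto)
  then obtain g where g: "\<forall>z\<in>slit_plane. (g has_field_derivative wh_log_deriv z) (at z)" by blast
  show ?thesis unfolding wh_log_def
    by (rule someI[where x="\<lambda>z. g z - g 1 + of_real (eta 1)"])
       (use g in \<open>auto intro!: derivative_eq_intros\<close>)
qed

lemma wh_log_has_derivative: "z \<in> slit_plane \<Longrightarrow> (wh_log has_field_derivative wh_log_deriv z) (at z)"
  using wh_log_props by auto

lemma wh_log_holo: "wh_log holomorphic_on slit_plane"
  using wh_log_has_derivative by (meson holomorphic_on_open open_slit_plane)

lemma wh_log_cont: "continuous_on slit_plane wh_log"
  by (rule holomorphic_on_imp_continuous_on[OF wh_log_holo])

lemma wh_log_real:
  assumes "t > 0" shows "wh_log (of_real t) = of_real (eta t)"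
proof -
  have d: "((\<lambda>t. wh_log (of_real t)) has_vector_derivative of_real (eta_deriv t)) (at t)" if "t > 0" for t
    using has_vector_derivative_real_field[OF wh_log_has_derivative[of "of_real t"]] that by (simp add: slit_plane_iff wh_log_deriv_of_real)
  have r: "((\<lambda>t. Re (wh_log (of_real t))) has_real_derivative eta_deriv t) (at t)" if "t > 0" for t
    using has_field_derivative_Re[OF d[OF that]] by simp
  have i: "((\<lambda>t. Im (wh_log (of_real t))) has_real_derivative 0) (at t)" if "t > 0" for t
    using has_field_derivative_Im[OF d[OF that]] by simp
  have "Im (wh_log (of_real t)) = Im (wh_log (of_real 1))"
  proof -
    have "\<exists>c. \<forall>x\<in>{0<..}. Im (wh_log (of_real x)) = c"
      by (rule has_field_derivative_zero_constant[OF convex_real_interval(3)])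
         (use i in \<open>auto intro: has_field_derivative_at_within\<close>)
    then obtain c where "\<And>x. x > 0 \<Longrightarrow> Im (wh_log (complex_of_real x)) = c" by auto
    from this[of t] this[of 1] assms show ?thesis by simp
  qed
  moreover have "Re (wh_log (of_real t)) - Re (wh_log (of_real 1)) = eta t - eta 1"
  proof (cases "t \<le> 1")
    case True
    from eta_diff[OF r assms True] show ?thesis by simp
  next
    case False
    from eta_diff[OF r, of 1 t] False show ?thesis by simp
  qed
  ultimately show ?thesis using wh_log_props by (auto simp: complex_eq_iff)
qed

text \<open>All functional equations of \<open>wh_log\<close> are proved by differentiation; the finite set \<open>K\<close> allows to leave
out the points \<open>\<plusminus>\<i>\<close>, where the closed form of the derivative is not available.\<close>
lemma slit_plane_constant:
  assumes "finite K" "continuous_on slit_plane f" "\<And>z. z \<in> slit_plane - K \<Longrightarrow> (f has_field_derivative 0) (at z)" "z \<in> slit_plane"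
  shows "f z = f 1"
proof -
  obtain c where "\<And>x. x \<in> slit_plane \<Longrightarrow> f x = c"
    using DERIV_zero_connected_constant[OF connected_slit_plane open_slit_plane assms(1,2)] assms(3) by blast
  then show ?thesis using assms(4) by (auto simp: slit_plane_iff)
qed

lemma cnj_slit_plane: "z \<in> slit_plane \<Longrightarrow> cnj z \<in> slit_plane" by (auto simp: slit_plane_iff)

lemma wh_log_cnj: assumes "z \<in> slit_plane" shows "wh_log (cnj z) = cnj (wh_log z)"
proof -
  let ?f = "\<lambda>z. cnj (wh_log (cnj z)) - wh_log z"
  have "?f z = ?f 1"
  proof (rule slit_plane_constant[where K="{\<i>, -\<i>}"])
    have "continuous_on slit_plane (\<lambda>z. wh_log (cnj z))"
      by (rule continuous_on_compose2[OF wh_log_cont]) (auto intro!: continuous_intros cnj_slit_plane)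
    then show "continuous_on slit_plane ?f" by (intro continuous_intros wh_log_cont)
  next
    fix z assume z: "z \<in> slit_plane - {\<i>, - \<i>}"
    have "((cnj \<circ> wh_log \<circ> cnj) has_field_derivative cnj (wh_log_deriv (cnj z))) (at z)"
      using wh_log_has_derivative[OF cnj_slit_plane] z by (intro has_field_derivative_cnj_cnj) auto
    moreover have "cnj (wh_log_deriv (cnj z)) = wh_log_deriv z"
    proof -
      have "cnj z \<noteq> \<i>" "cnj z \<noteq> -\<i>" using z by (auto simp: complex_eq_iff)
      moreover have "cnj (wh_log_deriv_num (cnj z)) = wh_log_deriv_num z"
        using arg_cong[OF cnj_Ln[of z], of cnj] z by (simp add: wh_log_deriv_num_def slit_plane_def)
      ultimately show ?thesis using z by (subst (1 2) wh_log_deriv_eq) auto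
    qed
    ultimately have "((\<lambda>z. cnj (wh_log (cnj z))) has_field_derivative wh_log_deriv z) (at z)" by (simp add: comp_def)
    from DERIV_diff[OF this wh_log_has_derivative[of z]] z
    show "(?f has_field_derivative 0) (at z)" by simp
  qed (use assms in auto)
  then have "cnj (wh_log (cnj z)) = wh_log z" using wh_log_props by simp
  then show ?thesis by (metis complex_cnj_cnj)
qed

lemma inverse_slit_plane: "z \<in> slit_plane \<Longrightarrow> inverse z \<in> slit_plane"
  unfolding slit_plane_def by (metis Compl_iff inverse_inverse_eq nonpos_Reals_inverse_iff)

text \<open>This equation moves the behaviour of \<open>wh_log\<close> at infinity to its behaviour at \<open>0\<close>.\<close>
lemma wh_log_inv: assumes "z \<in> slit_plane" shows "wh_log (inverse z) = wh_log z - Ln z / 2"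
proof -
  let ?f = "\<lambda>z. wh_log (inverse z) - wh_log z + Ln z / 2"
  have "?f z = ?f 1"
  proof (rule slit_plane_constant[where K="{\<i>, -\<i>}"])
    have "continuous_on slit_plane (\<lambda>z. wh_log (inverse z))"
      by (rule continuous_on_compose2[OF wh_log_cont]) (auto intro!: continuous_intros inverse_slit_plane simp: slit_plane_def)
    then show "continuous_on slit_plane ?f" 
      by (intro continuous_intros wh_log_cont holomorphic_on_imp_continuous_on[OF Ln_holo_slit_plane]) auto
  next
    fix z assume z: "z \<in> slit_plane - {\<i>, - \<i>}"
    have z0: "z \<noteq> 0" using z by (auto simp: slit_plane_def)
    have n: "inverse z \<noteq> \<i>" "inverse z \<noteq> -\<i>" using z
      by (metis Diff_iff insertI1 inverse_inverse_eq inverse_i insertI2 minus_minus inverse_minus_eq)+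
    have "((\<lambda>z. wh_log (inverse z)) has_field_derivative wh_log_deriv (inverse z) * (- (inverse z)\<^sup>2)) (at z)"
      using z z0 by (intro DERIV_chain2[where f=wh_log and g=inverse] wh_log_has_derivative inverse_slit_plane) (auto intro!: derivative_eq_intros simp: power2_eq_square)
    from DERIV_add[OF DERIV_diff[OF this wh_log_has_derivative[of z]] DERIV_cdivide[OF Ln_deriv_slit_plane, of z 2]] z
    have "(?f has_field_derivative (wh_log_deriv (inverse z) * (- (inverse z)\<^sup>2) - wh_log_deriv z + inverse z / 2)) (at z)"
      by simp
    also have "wh_log_deriv (inverse z) * (- (inverse z)\<^sup>2) - wh_log_deriv z + inverse z / 2 = 0"
    proof -
      have L: "Ln (inverse z) = - Ln z" using z by (intro Ln_inverse) (auto simp: slit_plane_def)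
      have nz: "1 + z\<^sup>2 \<noteq> 0" using one_plus_sq_nonzero z by auto
      have "wh_log_deriv (inverse z) * (inverse z)\<^sup>2 = (inverse z / 2 + Ln z / pi) / (1 + (inverse z)\<^sup>2) * (inverse z)\<^sup>2"
        using n by (simp add: wh_log_deriv_eq wh_log_deriv_num_def L)
      also have "\<dots> = (inverse z / 2 + Ln z / pi) / (1 + z\<^sup>2)"
      proof -
        have "1 + (inverse z)\<^sup>2 = (1 + z\<^sup>2) * (inverse z)\<^sup>2" using z0 by (simp add: field_simps)
        then show ?thesis using z0 by simp
      qed
      finally have 1: "wh_log_deriv (inverse z) * (inverse z)\<^sup>2 = (inverse z / 2 + Ln z / pi) / (1 + z\<^sup>2)" .
      have 2: "wh_log_deriv z = (z / 2 - Ln z / pi) / (1 + z\<^sup>2)" using z by (simp add: wh_log_deriv_eq wh_log_deriv_num_def)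
      have "wh_log_deriv (inverse z) * (inverse z)\<^sup>2 + wh_log_deriv z = (inverse z / 2 + z / 2) / (1 + z\<^sup>2)"
        unfolding 1 2 by (simp add: add_divide_distrib[symmetric])
      also have "\<dots> = inverse z / 2 * (1 + z\<^sup>2) / (1 + z\<^sup>2)"
        using z0 by (simp add: field_simps power2_eq_square)
      also have "\<dots> = inverse z / 2" by (simp only: nonzero_mult_div_cancel_right[OF nz])
      finally show ?thesis by (simp add: algebra_simps)
    qed
    finally show "(?f has_field_derivative 0) (at z)" .
  qed (use assms in auto)
  then show ?thesis by (simp add: algebra_simps)
qed

lemma filterlim_at_withinI:
  assumes "(f \<longlongrightarrow> c) F" "eventually (\<lambda>x. f x \<in> S \<and> f x \<noteq> c) F"
  shows "filterlim f (at c within S) F"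
  using assms by (auto simp: filterlim_at)

text \<open>The segment from \<open>z\<close> to the positive real number of the same modulus does not come close to \<open>0\<close>, so
\<open>wh_log z\<close> can be compared with \<open>eta (norm z)\<close> by the mean value inequality.\<close>
lemma segment_norm_ge:
  assumes z: "Re z \<ge> 0" and w: "w \<in> closed_segment z (of_real (norm z))"
  shows "Re w \<ge> 0" "norm z / 2 \<le> norm w" "norm w \<le> norm z"
proof -
  obtain u where u: "0 \<le> u" "u \<le> 1" "w = (1 - u) *\<^sub>R z + u *\<^sub>R of_real (norm z)"
    using w by (auto simp: closed_segment_def)
  show "Re w \<ge> 0" using u z by simp
  have "norm w \<le> (1-u) * norm z + u * norm z"
    using norm_triangle_ineq[of "(1-u) *\<^sub>R z" "u *\<^sub>R complex_of_real (norm z)"] u by simp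
  then show "norm w \<le> norm z" by (simp add: algebra_simps)
  show "norm z / 2 \<le> norm w"
  proof (cases "u \<ge> 1/2")
    case True
    have "norm z / 2 \<le> u * norm z" using True mult_right_mono[of "1/2" u "norm z"] by simp
    also have "\<dots> \<le> Re w" using u z by simp
    also have "\<dots> \<le> norm w" by (rule complex_Re_le_cmod)
    finally show ?thesis .
  next
    case False
    have "norm ((1-u) *\<^sub>R z) \<le> norm w"
      unfolding cmod_def
    proof (intro real_sqrt_le_mono add_mono)
      show "(Re ((1 - u) *\<^sub>R z))\<^sup>2 \<le> (Re w)\<^sup>2"
        using u z by (intro power_mono) auto
      show "(Im ((1 - u) *\<^sub>R z))\<^sup>2 \<le> (Im w)\<^sup>2" using u by simp
    qed
    moreover have "norm z / 2 \<le> norm ((1-u) *\<^sub>R z)"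
      using False u mult_right_mono[of "1/2" "1 - u" "norm z"] by simp
    ultimately show ?thesis by simp
  qed
qed

lemma wh_log_tendsto_0: "(wh_log \<longlongrightarrow> 0) (at 0 within {z. Re z \<ge> 0})"
proof (rule Lim_null_comparison)
  let ?b = "\<lambda>z. 8/3 * norm z * (2 - ln (norm z / 2)) + \<bar>eta (norm z)\<bar>"
  have lim: "((\<lambda>r::real. 8/3 * r * (2 - ln (r / 2)) + \<bar>eta r\<bar>) \<longlongrightarrow> 0 + \<bar>0\<bar>) (at_right 0)"
  proof (intro tendsto_add tendsto_rabs eta_tendsto_0)
    show "((\<lambda>r::real. 8/3 * r * (2 - ln (r / 2))) \<longlongrightarrow> 0) (at_right 0)" by real_asymp
  qed
  have n: "filterlim norm (at_right 0) (at (0::complex) within {z. Re z \<ge> 0})"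
    by (rule filterlim_at_withinI) (auto intro!: tendsto_eq_intros simp: eventually_at_filter)
  show "((\<lambda>z. ?b z) \<longlongrightarrow> 0) (at 0 within {z. Re z \<ge> 0})"
    using filterlim_compose[OF lim n] by simp
  show "\<forall>\<^sub>F z in at 0 within {z. Re z \<ge> 0}. norm (wh_log z) \<le> ?b z"
    unfolding eventually_at
  proof (intro exI[of _ "1/2"] conjI ballI impI)
    fix z :: complex assume "z \<in> {z. Re z \<ge> 0}" "z \<noteq> 0 \<and> dist z 0 < 1/2"
    then have z: "Re z \<ge> 0" "z \<noteq> 0" "norm z < 1/2" by auto
    let ?S = "closed_segment z (of_real (norm z))"
    have "norm (wh_log z - wh_log (of_real (norm z))) \<le> (4/3 * (2 - ln (norm z / 2))) * norm (z - of_real (norm z))"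
    proof (rule field_differentiable_bound[where S = ?S and f' = wh_log_deriv])
      fix w assume w: "w \<in> ?S"
      note sw = segment_norm_ge[OF z(1) w]
      have w0: "norm w > 0" using sw z by (smt (verit) zero_less_norm_iff field_sum_of_halves)
      have "w \<in> slit_plane" using sw(1) w0 by (auto simp: slit_plane_iff complex_eq_iff)
      then show "(wh_log has_field_derivative wh_log_deriv w) (at w within ?S)"
        using wh_log_has_derivative has_field_derivative_at_within by blast
      have wi: "w \<noteq> \<i>" "w \<noteq> -\<i>" using sw z by auto
      have "norm (wh_log_deriv_num w) \<le> norm w / 2 + norm (Ln w) / pi"
        unfolding wh_log_deriv_num_def by (rule order_trans[OF norm_triangle_ineq4]) (simp add: norm_divide)
      also have "norm (Ln w) \<le> \<bar>ln (norm w)\<bar> + pi"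
      proof -
        have "norm (Ln w) \<le> \<bar>Re (Ln w)\<bar> + \<bar>Im (Ln w)\<bar>" by (rule cmod_le)
        moreover have "\<bar>Im (Ln w)\<bar> \<le> pi" using w0 Im_Ln_le_pi[of w] mpi_less_Im_Ln[of w] by (simp add: abs_le_iff)
        ultimately show ?thesis using w0 by simp
      qed
      also have "\<bar>ln (norm w)\<bar> = - ln (norm w)" using sw z w0 by simp
      also have "- ln (norm w) \<le> - ln (norm z / 2)" using sw z w0 by simp
      finally have "norm (wh_log_deriv_num w) \<le> norm w / 2 + (- ln (norm z / 2) + pi) / pi"
        by (simp add: divide_right_mono)
      also have "\<dots> \<le> 2 - ln (norm z / 2)"
      proof -
        have "ln (norm z / 2) \<le> 0" using z by simp
        then have "- ln (norm z / 2) / pi \<le> - ln (norm z / 2) / 1"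
          using pi_gt3 by (intro divide_left_mono) auto
        moreover have "norm w / 2 \<le> 1" using sw z by simp
        ultimately show ?thesis by (simp add: add_divide_distrib diff_divide_distrib)
      qed
      finally have 1: "norm (wh_log_deriv_num w) \<le> 2 - ln (norm z / 2)" .
      have 2: "norm (1 + w\<^sup>2) \<ge> 3/4"
      proof -
        have "norm w \<le> 1/2" using sw z by simp
        then have "norm (w\<^sup>2) \<le> 1/4" using power_mono[of "norm w" "1/2" 2] by (simp add: norm_mult power2_eq_square)
        then show ?thesis using norm_triangle_ineq4[of "1 + w\<^sup>2" "w\<^sup>2"] by simp
      qed
      have "norm (wh_log_deriv w) = norm (wh_log_deriv_num w) / norm (1 + w\<^sup>2)" using wi by (simp add: wh_log_deriv_eq norm_divide)
      also have "\<dots> \<le> (2 - ln (norm z / 2)) / (3/4)"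
        using 1 2 order_trans[OF norm_ge_zero 1] by (intro frac_le) auto
      finally show "norm (wh_log_deriv w) \<le> 4/3 * (2 - ln (norm z / 2))" by simp
    qed auto
    also have "\<dots> \<le> (4/3 * (2 - ln (norm z / 2))) * (2 * norm z)"
    proof (rule mult_left_mono)
      show "norm (z - of_real (norm z)) \<le> 2 * norm z" using norm_triangle_ineq4[of z "of_real (norm z)"] by simp
      have "ln (norm z / 2) \<le> 0" using z by simp
      then show "0 \<le> 4/3 * (2 - ln (norm z / 2))" by simp
    qed
    finally have 1: "norm (wh_log z - wh_log (of_real (norm z))) \<le> 8/3 * norm z * (2 - ln (norm z / 2))" 
      by (simp add: algebra_simps)
    have "norm (wh_log z) \<le> norm (wh_log z - wh_log (of_real (norm z))) + norm (wh_log (of_real (norm z)))"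
      using norm_triangle_ineq[of "wh_log z - wh_log (of_real (norm z))" "wh_log (of_real (norm z))"] by simp
    then show "norm (wh_log z) \<le> ?b z" using 1 wh_log_real[of "norm z"] z by simp
  qed simp
qed

text \<open>The derivative of the left-hand side is \<open>(z - \<i>) / (1 + z\<^sup>2) = 1 / (z + \<i>)\<close>, since
\<open>Ln z - Ln (- z) = \<i> \<pi>\<close> in the upper half-plane; the constant of integration is found at \<open>0\<close>.\<close>
lemma wh_log_prod: assumes "Im z > 0" shows "wh_log z + wh_log (-z) = Ln (1 - \<i> * z)"
proof -
  let ?U = "{z. Im z > 0}"
  let ?f = "\<lambda>z. wh_log z + wh_log (-z) - Ln (1 - \<i> * z)"
  have us: "z \<in> slit_plane" "-z \<in> slit_plane" "1 - \<i> * z \<in> slit_plane" if "z \<in> ?U" for z using that by (auto simp: slit_plane_iff)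
  have U: "open ?U" "connected ?U" by (auto simp: open_halfspace_Im_gt convex_halfspace_Im_gt convex_connected)
  have cont: "continuous_on ?U ?f"
  proof (intro continuous_intros)
    show "continuous_on ?U wh_log" by (rule continuous_on_subset[OF wh_log_cont]) (use us in auto)
    show "continuous_on ?U (\<lambda>z. wh_log (-z))" by (rule continuous_on_compose2[OF wh_log_cont]) (use us in \<open>auto intro!: continuous_intros\<close>)
    show "\<And>z. z \<in> ?U \<Longrightarrow> 1 - \<i> * z \<notin> \<real>\<^sub>\<le>\<^sub>0" using us by (auto simp: slit_plane_def)
  qed
  obtain c where c: "\<And>z. z \<in> ?U \<Longrightarrow> ?f z = c"
  proof (rule DERIV_zero_connected_constant[OF U(2,1) _ cont, of "{\<i>}"])
    show "\<forall>z\<in>?U - {\<i>}. (?f has_field_derivative 0) (at z)"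
    proof
      fix z assume z: "z \<in> ?U - {\<i>}"
      then have s: "z \<in> slit_plane" "-z \<in> slit_plane" "1 - \<i> * z \<in> slit_plane" and zi: "z \<noteq> \<i>" "z \<noteq> -\<i>" using us by auto
      have "(?f has_field_derivative (wh_log_deriv z + wh_log_deriv (-z) * (-1) - inverse (1 - \<i> * z) * (- \<i>))) (at z)"
        by (intro derivative_intros DERIV_chain2[where f=wh_log and g=uminus] DERIV_chain2[where f=Ln and g="\<lambda>z. 1 - \<i> * z"] wh_log_has_derivative Ln_deriv_slit_plane s)
           (auto intro!: derivative_eq_intros)
      also have "wh_log_deriv z + wh_log_deriv (-z) * (-1) - inverse (1 - \<i> * z) * (- \<i>) = 0"
      proof -
        have nz: "1 + z\<^sup>2 \<noteq> 0" using one_plus_sq_nonzero zi by auto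
        have f: "1 + z\<^sup>2 = (z + \<i>) * (z - \<i>)" by (simp add: algebra_simps power2_eq_square)
        have L: "Ln (-z) = Ln z - \<i> * pi" using z by (subst Ln_minus) auto
        have "wh_log_deriv_num z - wh_log_deriv_num (-z) = z - \<i>" unfolding wh_log_deriv_num_def L by (simp add: field_simps)
        moreover have "-z \<noteq> \<i>" "-z \<noteq> -\<i>" using zi by (auto simp: minus_equation_iff)
        ultimately have "wh_log_deriv z - wh_log_deriv (-z) = (z - \<i>) / (1 + z\<^sup>2)"
          using zi by (simp add: wh_log_deriv_eq diff_divide_distrib[symmetric])
        also have "\<dots> = 1 / (z + \<i>)" using nz unfolding f by simp
        also have "\<dots> = inverse (1 - \<i> * z) * (- \<i>)"
        proof -
          have "1 - \<i> * z = - \<i> * (z + \<i>)" by (simp add: algebra_simps)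
          then have "inverse (1 - \<i> * z) = \<i> * inverse (z + \<i>)" by (simp only: inverse_mult_distrib) simp
          then show ?thesis by (simp add: divide_inverse algebra_simps)
        qed
        finally show ?thesis by simp
      qed
      finally show "(?f has_field_derivative 0) (at z)" .
    qed
  qed auto
  have "((\<lambda>s. ?f (\<i> * of_real s)) \<longlongrightarrow> 0 + 0 - Ln (1 - \<i> * (\<i> * of_real 0))) (at_right 0)"
  proof (intro tendsto_intros)
    have a: "filterlim (\<lambda>s. \<i> * complex_of_real s) (at 0 within {z. Re z \<ge> 0}) (at_right 0)"
      by (rule filterlim_at_withinI) (auto intro!: tendsto_eq_intros simp: eventually_at_filter)
    show "((\<lambda>s. wh_log (\<i> * of_real s)) \<longlongrightarrow> 0) (at_right 0)"
      by (rule filterlim_compose[OF wh_log_tendsto_0 a])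
    have b: "filterlim (\<lambda>s. - (\<i> * complex_of_real s)) (at 0 within {z. Re z \<ge> 0}) (at_right 0)"
      by (rule filterlim_at_withinI) (auto intro!: tendsto_eq_intros simp: eventually_at_filter)
    show "((\<lambda>s. wh_log (-(\<i> * of_real s))) \<longlongrightarrow> 0) (at_right 0)"
      by (rule filterlim_compose[OF wh_log_tendsto_0 b])
  qed auto
  moreover have "((\<lambda>s. ?f (\<i> * of_real s)) \<longlongrightarrow> c) (at_right 0)"
  proof (rule tendsto_eventually)
    show "\<forall>\<^sub>F s in at_right 0. ?f (\<i> * of_real s) = c"
      using eventually_at_right_less[of "0::real"] by eventually_elim (rule c, auto)
  qed
  ultimately have "c = 0" using tendsto_unique[of "at_right (0::real)"] by fastforce
  then show ?thesis using c[of z] assms by simp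
qed

text \<open>Along the unit circle the imaginary part grows at the constant rate \<open>1/4\<close>, because there
\<open>1 + z\<^sup>2 = 2 z cos t\<close> and the numerator has real part \<open>cos t / 2\<close>. The endpoint \<open>t = \<pi>/2\<close> is reached by continuity.\<close>
lemma Im_wh_log_ii: "Im (wh_log \<i>) = pi / 8"
proof -
  let ?f = "\<lambda>t. Im (wh_log (cis t)) - t / 4"
  have s: "cis t \<in> slit_plane" if "0 \<le> t" "t \<le> pi/2" for t
  proof (cases "t < pi / 2")
    case True then show ?thesis using that cos_gt_zero_pi[of t] by (auto simp: slit_plane_iff)
  next
    case False then have "t = pi / 2" using that by simp
    then show ?thesis by (simp only: slit_plane_iff cis_pi_half) simp
  qed
  have "?f (pi/2) = ?f 0"
  proof (rule DERIV_isconst_end[where f="?f"])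
    show "continuous_on {0..pi/2} ?f"
    proof -
      have "continuous_on {0..pi/2} cis"
        unfolding cis_conv_exp[abs_def] by (intro continuous_intros)
      then have "continuous_on {0..pi/2} (\<lambda>t. wh_log (cis t))"
        by (rule continuous_on_compose2[OF wh_log_cont]) (use s in auto)
      then show ?thesis by (intro continuous_intros) auto
    qed
    fix t :: real assume t: "0 < t" "t < pi/2"
    have c0: "cos t > 0" using t by (intro cos_gt_zero_pi) auto
    have st: "cis t \<in> slit_plane" using s t by auto
    have "(cis has_vector_derivative \<i> * cis t) (at t)"
      by (auto intro!: derivative_eq_intros simp: has_vector_derivative_complex_iff)
    then have "((\<lambda>t. wh_log (cis t)) has_vector_derivative (\<i> * cis t) * wh_log_deriv (cis t)) (at t)"
      using field_vector_diff_chain_at[of cis "\<i> * cis t" t wh_log "wh_log_deriv (cis t)"] wh_log_has_derivative[OF st] by (simp add: comp_def)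
    from DERIV_diff[OF has_field_derivative_Im[OF this] DERIV_cdivide[OF DERIV_ident, of 4]]
    have "(?f has_real_derivative Im ((\<i> * cis t) * wh_log_deriv (cis t)) - 1/4) (at t)" .
    also have "Im ((\<i> * cis t) * wh_log_deriv (cis t)) = 1/4"
    proof -
      have ne: "cis t \<noteq> \<i>" "cis t \<noteq> -\<i>" using c0 by (auto simp: complex_eq_iff)
      have L: "Ln (cis t) = t * \<i>" using t by (intro Ln_cis) auto
      have sq: "1 + (cis t)\<^sup>2 = cis t * (2 * of_real (cos t))"
      proof -
        have "1 + (cis t)\<^sup>2 = cis t * (cis (-t) + cis t)" by (simp add: cis_mult power2_eq_square algebra_simps)
        also have "cis (-t) + cis t = 2 * of_real (cos t)" by (simp add: complex_eq_iff)
        finally show ?thesis .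
      qed
      have "(\<i> * cis t) * wh_log_deriv (cis t) = \<i> * (wh_log_deriv_num (cis t) / of_real (2 * cos t))"
        using ne c0 by (simp add: wh_log_deriv_eq sq)
      also have "Im \<dots> = Re (wh_log_deriv_num (cis t)) / (2 * cos t)"
        by (simp add: Re_divide_of_real)
      also have "Re (wh_log_deriv_num (cis t)) = cos t / 2" by (simp add: wh_log_deriv_num_def L)
      finally show ?thesis using c0 by simp
    qed
    finally show "(?f has_real_derivative 0) (at t)" by simp
  qed auto
  moreover have "Im (wh_log (cis 0)) = 0" using wh_log_props by simp
  ultimately show ?thesis by simp
qed

text \<open>The modulus comes from the product formula at \<open>z = \<i>\<close> and conjugation symmetry, the argument from the
preceding lemma.\<close>
lemma exp_wh_log_ii: "exp (wh_log \<i>) = of_real (sqrt 2) * cis (pi/8)" "exp (wh_log (-\<i>)) = of_real (sqrt 2) * cis (-pi/8)"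
proof -
  have c: "wh_log (-\<i>) = cnj (wh_log \<i>)" using wh_log_cnj[of \<i>] by (simp add: slit_plane_iff)
  have "wh_log \<i> + wh_log (-\<i>) = Ln 2" using wh_log_prod[of \<i>] by simp
  moreover have "Ln 2 = of_real (ln 2)" using Ln_of_real[of 2] by simp
  ultimately have "Re (wh_log \<i>) = ln 2 / 2" using c by (auto simp: complex_eq_iff)
  then have r: "exp (Re (wh_log \<i>)) = sqrt 2" by (simp add: powr_half_sqrt[symmetric] powr_def)
  show "exp (wh_log \<i>) = of_real (sqrt 2) * cis (pi/8)"
    by (simp add: exp_eq_polar r Im_wh_log_ii)
  show "exp (wh_log (-\<i>)) = of_real (sqrt 2) * cis (-pi/8)"
    by (simp add: exp_eq_polar r Im_wh_log_ii c)
qed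

text \<open>The value at \<open>0\<close> is the limit within the closed right half-plane, which makes the function continuous there.\<close>
definition wh_factor :: "complex \<Rightarrow> complex" where
  "wh_factor z = (if z = 0 then 1 else exp (wh_log z))"

lemma wh_factor_nonzero [simp]: "wh_factor z \<noteq> 0" by (simp add: wh_factor_def)

lemma right_half_in_slit_plane: "Re z \<ge> 0 \<Longrightarrow> z \<noteq> 0 \<Longrightarrow> z \<in> slit_plane"
  by (auto simp: slit_plane_iff complex_eq_iff)

lemma wh_factor_holo: "wh_factor holomorphic_on slit_plane"
proof -
  have "(\<lambda>z. exp (wh_log z)) holomorphic_on slit_plane" by (intro holomorphic_intros wh_log_holo)
  then show ?thesis by (rule holomorphic_transform) (auto simp: wh_factor_def slit_plane_iff)
qed

lemma wh_factor_cont: "continuous_on {z. Re z \<ge> 0} wh_factor"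
  unfolding continuous_on_def
proof
  fix z :: complex assume z: "z \<in> {z. Re z \<ge> 0}"
  show "(wh_factor \<longlongrightarrow> wh_factor z) (at z within {z. Re z \<ge> 0})"
  proof (cases "z = 0")
    case True
    have "((\<lambda>z. exp (wh_log z)) \<longlongrightarrow> exp 0) (at 0 within {z. Re z \<ge> 0})"
      by (intro tendsto_intros wh_log_tendsto_0)
    then have "(wh_factor \<longlongrightarrow> exp 0) (at 0 within {z. Re z \<ge> 0})"
      by (rule Lim_transform_eventually) (auto simp: eventually_at_filter wh_factor_def)
    then show ?thesis using True by (simp add: wh_factor_def)
  next
    case False
    then have "z \<in> slit_plane" using z right_half_in_slit_plane by auto
    then have "isCont wh_factor z" using wh_factor_holo holomorphic_on_imp_continuous_on continuous_on_interior interior_open open_slit_plane by metis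
    then show ?thesis by (meson continuous_at_imp_continuous_within continuous_within)
  qed
qed

lemma wh_factor_prod: "Im z > 0 \<Longrightarrow> wh_factor z * wh_factor (-z) = 1 - \<i> * z"
proof -
  assume z: "Im z > 0"
  then have "wh_factor z * wh_factor (-z) = exp (wh_log z + wh_log (-z))" by (auto simp: wh_factor_def exp_add)
  also have "\<dots> = 1 - \<i> * z" unfolding wh_log_prod[OF z] using z by (intro exp_Ln) (auto simp: complex_eq_iff)
  finally show ?thesis .
qed

lemma wh_factor_real: "t > 0 \<Longrightarrow> wh_factor (of_real t) = of_real (exp (eta t))"
  by (simp add: wh_factor_def wh_log_real exp_of_real)

text \<open>Since \<open>wh_factor z = sqrt z * wh_factor (1/z)\<close> and \<open>wh_factor\<close> tends to \<open>1\<close> at \<open>0\<close>, the factor grows like \<open>sqrt z\<close>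
at infinity. The cruder bounds stated here suffice.\<close>
lemma wh_factor_bounds: obtains R where "R \<ge> 2" 
  "\<And>z. Re z \<ge> 0 \<Longrightarrow> norm z \<ge> R \<Longrightarrow> norm (wh_factor z) \<le> exp 1 * norm z \<and> norm (1 / wh_factor z) \<le> exp 1"
proof -
  obtain d where d: "d > 0" "\<And>z. Re z \<ge> 0 \<Longrightarrow> z \<noteq> 0 \<Longrightarrow> norm z < d \<Longrightarrow> norm (wh_log z) < 1"
    using tendstoD[OF wh_log_tendsto_0, of 1] by (auto simp: eventually_at)
  show thesis
  proof (rule that[of "max 2 (2 / d)"])
    fix z :: complex assume z: "Re z \<ge> 0" "norm z \<ge> max 2 (2 / d)"
    have z0: "z \<noteq> 0" using z by auto
    then have zs: "z \<in> slit_plane" using right_half_in_slit_plane z by auto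
    have "norm z > 1 / d" using z d by (smt (verit) divide_strict_right_mono)
    then have "norm (inverse z) < d" using z0 d unfolding norm_inverse by (simp add: inverse_eq_divide divide_simps mult.commute)
    moreover have "Re (inverse z) \<ge> 0" using z by simp
    ultimately have g: "norm (wh_log (inverse z)) < 1" using d z0 by auto
    have e: "wh_log z = wh_log (inverse z) + Ln z / 2" using wh_log_inv[OF zs] by simp
    have n: "norm (wh_factor z) = exp (Re (wh_log (inverse z))) * sqrt (norm z)"
    proof -
      have "norm (wh_factor z) = exp (Re (wh_log (inverse z)) + ln (norm z) / 2)" using z0 by (simp add: wh_factor_def e norm_exp_eq_Re)
      also have "\<dots> = exp (Re (wh_log (inverse z))) * sqrt (norm z)"
        using z0 by (simp add: exp_add powr_half_sqrt[symmetric] powr_def)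
      finally show ?thesis .
    qed
    have b: "-1 \<le> Re (wh_log (inverse z))" "Re (wh_log (inverse z)) \<le> 1"
      using g abs_Re_le_cmod[of "wh_log (inverse z)"] by (auto simp: abs_le_iff)
    have s: "1 \<le> sqrt (norm z)" "sqrt (norm z) \<le> norm z"
      using z mult_mono[of 1 "norm z" "norm z" "norm z"] by (auto intro!: real_le_lsqrt simp: power2_eq_square)
    have "norm (wh_factor z) \<le> exp 1 * norm z" unfolding n using b s by (intro mult_mono) auto
    moreover have "exp (-1) * 1 \<le> norm (wh_factor z)" unfolding n using b s by (intro mult_mono) auto
    then have "norm (1 / wh_factor z) \<le> exp 1" by (simp add: norm_divide exp_minus field_simps)
    ultimately show "norm (wh_factor z) \<le> exp 1 * norm z \<and> norm (1 / wh_factor z) \<le> exp 1" by simp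
  qed simp
qed

section \<open>Rotation of rays in a quadrant\<close>

definition quadrant :: "complex set" where "quadrant = {z. Re z \<ge> 0 \<and> Im z \<ge> 0}"

lemma lborel_pos_truncation_limit:
  fixes f :: "real \<Rightarrow> 'a::{banach, second_countable_topology}"
  assumes f: "integrable lborel_pos f"
  shows "(\<lambda>n. \<integral>s. indicator {0..real n} s *\<^sub>R f s \<partial>lborel_pos) \<longlonglongrightarrow> integral\<^sup>L lborel_pos f"
proof (rule integral_dominated_convergence[where w="\<lambda>s. norm (f s)"])
  note f' = borel_measurable_integrable[OF f]
  have ind: "(\<lambda>s. indicator {0..real n} s) \<in> borel_measurable lborel_pos" for n
    by (rule borel_measurable_lborel_pos) auto
  show "(\<lambda>s. indicator {0..real n} s *\<^sub>R f s) \<in> borel_measurable lborel_pos" for n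
    using f' ind by (intro borel_measurable_scaleR)
  show "f \<in> borel_measurable lborel_pos" by (fact f')
  show "AE x in lborel_pos. (\<lambda>n. indicator {0..real n} x *\<^sub>R f x) \<longlonglongrightarrow> f x"
  proof (rule AE_I2)
    fix x assume "x \<in> space lborel_pos" then have x: "x > 0" by simp
    have "\<forall>\<^sub>F n in sequentially. x \<le> real n" by real_asymp
    then have "\<forall>\<^sub>F n in sequentially. indicator {0..real n} x *\<^sub>R f x = f x"
      by eventually_elim (use x in auto)
    then show "(\<lambda>n. indicator {0..real n} x *\<^sub>R f x) \<longlonglongrightarrow> f x" by (rule tendsto_eventually)
  qed
qed (use f in \<open>auto simp: indicator_def\<close>)

lemma contour_integral_linepath_lborel_pos:
  fixes f :: "complex \<Rightarrow> complex" and d :: complex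
  assumes R: "R > 0" and c: "continuous_on (closed_segment 0 (of_real R * d)) f"
  shows "contour_integral (linepath 0 (of_real R * d)) f = d * (\<integral>s. indicator {0..R} s *\<^sub>R f (of_real s * d) \<partial>lborel_pos)"
proof -
  have "contour_integral (linepath 0 (of_real R * d)) f = integral {0..1} (\<lambda>u. f (linepath 0 (of_real R * d) u) * (of_real R * d - 0))"
    by (simp add: contour_integral_integral)
  also have "\<dots> = (LINT u:{0..1}|lborel. f (linepath 0 (of_real R * d) u) * (of_real R * d - 0))"
  proof (rule set_borel_integral_eq_integral(2)[symmetric])
    show "set_integrable lborel {0..1} (\<lambda>u. f (linepath 0 (of_real R * d) u) * (of_real R * d - 0))"
      by (intro borel_integrable_atLeastAtMost' continuous_intros continuous_on_compose2[OF c])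
         (auto simp: linepath_in_path[of _ 0 "of_real R * d", unfolded linepath_def, simplified] linepath_def)
  qed
  also have "\<dots> = d * (of_real R * (\<integral>u. indicator {0..1} u *\<^sub>R f (of_real (R * u) * d) \<partial>lborel))"
    unfolding set_lebesgue_integral_def integral_mult_right_zero[symmetric]
    by (intro Bochner_Integration.integral_cong) (auto simp: linepath_def algebra_simps indicator_def scaleR_conv_of_real)
  also have "of_real R * (\<integral>u. indicator {0..1} u *\<^sub>R f (of_real (R * u) * d) \<partial>lborel) = (\<integral>s. indicator {0..R} s *\<^sub>R f (of_real s * d) \<partial>lborel)"
  proof -
    have ind: "indicator {0..R} (R * u) = (indicator {0..1} u :: real)" for u
      using R by (auto simp: indicator_def zero_le_mult_iff)
    have "(\<integral>s. indicator {0..R} s *\<^sub>R f (of_real s * d) \<partial>lborel) = \<bar>R\<bar> *\<^sub>R (\<integral>u. indicator {0..R} (0 + R * u) *\<^sub>R f (of_real (0 + R * u) * d) \<partial>lborel)"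
      by (rule lborel_integral_real_affine) (use R in auto)
    then show ?thesis using R by (simp add: ind scaleR_conv_of_real)
  qed
  also have "(\<integral>s. indicator {0..R} s *\<^sub>R f (of_real s * d) \<partial>lborel) = (\<integral>s. indicator {0..R} s *\<^sub>R f (of_real s * d) \<partial>lborel_pos)"
  proof -
    have "(\<integral>s. indicator {0..R} s *\<^sub>R f (of_real s * d) \<partial>lborel_pos) = (\<integral>s. indicator {0<..R} s *\<^sub>R f (of_real s * d) \<partial>lborel)"
      unfolding integral_lborel_pos set_lebesgue_integral_def 
      by (intro Bochner_Integration.integral_cong) (auto simp: indicator_def)
    also have "\<dots> = (\<integral>s. indicator {0..R} s *\<^sub>R f (of_real s * d) \<partial>lborel)"
    proof (rule integral_cong_AE)
      have "(\<lambda>s. indicator {0..R} s *\<^sub>R f (of_real s * d)) \<in> borel_measurable borel"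
      proof (rule borel_measurable_continuous_on_indicator)
        have "of_real s * d \<in> closed_segment 0 (of_real R * d)" if "0 \<le> s" "s \<le> R" for s
          unfolding closed_segment_def using that R
          by (auto intro!: exI[of _ "s / R"] simp: scaleR_conv_of_real)
        then show "continuous_on {0..R} (\<lambda>s. f (of_real s * d))"
          by (intro continuous_on_compose2[OF c] continuous_intros) auto
      qed auto
      then show m: "(\<lambda>s. indicator {0..R} s *\<^sub>R f (of_real s * d)) \<in> borel_measurable lborel" by simp
      have "(\<lambda>s. indicator {0<..} s *\<^sub>R (indicator {0..R} s *\<^sub>R f (of_real s * d))) \<in> borel_measurable lborel"
        by (intro borel_measurable_scaleR borel_measurable_indicator m) auto
      also have "(\<lambda>s. indicator {0<..} s *\<^sub>R (indicator {0..R} s *\<^sub>R f (of_real s * d))) = (\<lambda>s. indicator {0<..R} s *\<^sub>R f (of_real s * d))"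
        by (rule ext) (auto simp: indicator_def)
      finally show "(\<lambda>s. indicator {0<..R} s *\<^sub>R f (of_real s * d)) \<in> borel_measurable lborel" .
      show "AE s in lborel. indicator {0<..R} s *\<^sub>R f (of_real s * d) = indicator {0..R} s *\<^sub>R f (of_real s * d)"
        using AE_lborel_singleton[of "0::real"] by eventually_elim (auto simp: indicator_def)
    qed
    finally show ?thesis by simp
  qed
  finally show ?thesis .
qed

lemma quadrant_ray: "s > 0 \<Longrightarrow> of_real s \<in> quadrant" "s > 0 \<Longrightarrow> \<i> * of_real s \<in> quadrant" "s > 0 \<Longrightarrow> of_real s * \<i> \<in> quadrant"
  by (auto simp: quadrant_def)

lemma convex_quadrant: "convex quadrant"
proof -
  have e: "quadrant = {z. Re z \<ge> 0} \<inter> {z. Im z \<ge> 0}" by (auto simp: quadrant_def)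
  show ?thesis unfolding e by (intro convex_halfspace_Re_ge convex_halfspace_Im_ge convex_Int)
qed

lemma interior_quadrant: "interior quadrant = {z. Re z > 0 \<and> Im z > 0}"
proof -
  have e: "quadrant = {z. (1::complex) \<bullet> z \<ge> 0} \<inter> {z. \<i> \<bullet> z \<ge> 0}" by (auto simp: quadrant_def inner_complex_def)
  show ?thesis unfolding e interior_Int by (subst (1 2) interior_halfspace_ge) (auto simp: inner_complex_def)
qed

lemma ray_integrable:
  fixes f :: "complex \<Rightarrow> complex"
  assumes c: "continuous_on quadrant f" and b: "\<And>t. t \<in> quadrant \<Longrightarrow> norm (f t) \<le> K / (1 + (norm t)\<^sup>2)"
    and d: "d = 1 \<or> d = \<i>"
  shows "integrable lborel_pos (\<lambda>s. f (of_real s * d))"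
proof (rule lborel_pos_integrable_bound)
  show "integrable lborel_pos (\<lambda>s. K * (1 / (1 + s\<^sup>2)))" by (intro integrable_mult_right recip_1_sq_lborel_pos)
  show "(\<lambda>s. f (of_real s * d)) \<in> borel_measurable lborel_pos"
    by (intro continuous_on_measurable_lborel_pos continuous_on_compose2[OF c] continuous_intros) (use d quadrant_ray in auto)
  fix s :: real assume s: "s > 0"
  have "of_real s * d \<in> quadrant" using d quadrant_ray s by auto
  from b[OF this] show "norm (f (of_real s * d)) \<le> K * (1 / (1 + s\<^sup>2))" using d by (auto simp: norm_mult)
qed

text \<open>Cauchy's theorem for the triangle with vertices \<open>0\<close>, \<open>n\<close>, \<open>\<i> n\<close>: on the hypotenuse
\<open>norm w \<ge> n / sqrt 2\<close>, so its contribution is \<open>O(1/n)\<close>. A triangle replaces the usual circular sector, as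
Cauchy's theorem for triangles asks only for continuity on the boundary, including the corner \<open>0\<close>.\<close>
lemma rotate_quadrant:
  fixes f :: "complex \<Rightarrow> complex"
  assumes c: "continuous_on quadrant f" and h: "f holomorphic_on interior quadrant"
    and b: "\<And>t. t \<in> quadrant \<Longrightarrow> norm (f t) \<le> K / (1 + (norm t)\<^sup>2)"
  shows "(\<integral>s. f (of_real s) \<partial>lborel_pos) = \<i> * (\<integral>s. f (of_real s * \<i>) \<partial>lborel_pos)"
proof -
  define I where "I d n = d * (\<integral>s. indicator {0..real n} s *\<^sub>R f (of_real s * d) \<partial>lborel_pos)" for d n
  have lim: "I d \<longlonglongrightarrow> d * (\<integral>s. f (of_real s * d) \<partial>lborel_pos)" if "d = 1 \<or> d = \<i>" for d
    unfolding I_def by (intro tendsto_intros lborel_pos_truncation_limit ray_integrable[OF c b that])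
  have "norm (f 0) \<le> K" using b[of 0] by (simp add: quadrant_def)
  then have K: "K \<ge> 0" by (rule order_trans[OF norm_ge_zero])
  have diff: "norm (I 1 n - I \<i> n) \<le> 2 * K * real n / (1 + (real n)\<^sup>2 / 2)" if n: "n > 0" for n
  proof -
    define R where "R = complex_of_real (real n)"
    have in_Q: "0 \<in> quadrant" "R \<in> quadrant" "R * \<i> \<in> quadrant" using n by (auto simp: R_def quadrant_def)
    have sub: "convex hull {0, R, R * \<i>} \<subseteq> quadrant" by (rule hull_minimal) (use in_Q convex_quadrant in auto)
    have seg: "closed_segment a b \<subseteq> quadrant" if "a \<in> quadrant" "b \<in> quadrant" for a b
      using that convex_quadrant by (simp add: closed_segment_subset)
    have ci: "f contour_integrable_on linepath a b" if "a \<in> quadrant" "b \<in> quadrant" for a b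
      by (rule contour_integrable_continuous_linepath) (rule continuous_on_subset[OF c seg[OF that]])
    have "(f has_contour_integral 0) (linepath 0 R +++ linepath R (R * \<i>) +++ linepath (R * \<i>) 0)"
    proof (rule Cauchy_theorem_triangle_interior)
      show "continuous_on (convex hull {0, R, R * \<i>}) f" by (rule continuous_on_subset[OF c sub])
      show "f holomorphic_on interior (convex hull {0, R, R * \<i>})"
        by (rule holomorphic_on_subset[OF h interior_mono[OF sub]])
    qed
    from has_chain_integral_chain_integral3[OF this]
    have "contour_integral (linepath 0 R) f + contour_integral (linepath R (R * \<i>)) f + contour_integral (linepath (R * \<i>) 0) f = 0" .
    moreover have "contour_integral (linepath (R * \<i>) 0) f = - contour_integral (linepath 0 (R * \<i>)) f"
      using contour_integral_reversepath[of "linepath 0 (R * \<i>)" f] by simp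
    moreover have "contour_integral (linepath 0 R) f = I 1 n"
      using contour_integral_linepath_lborel_pos[of "real n" 1 f] n continuous_on_subset[OF c seg[OF in_Q(1,2)]] by (simp add: I_def R_def)
    moreover have "contour_integral (linepath 0 (R * \<i>)) f = I \<i> n"
      using contour_integral_linepath_lborel_pos[of "real n" \<i> f] n continuous_on_subset[OF c seg[OF in_Q(1,3)]] by (simp add: I_def R_def)
    ultimately have e: "I 1 n - I \<i> n = - contour_integral (linepath R (R * \<i>)) f" by (simp add: algebra_simps add_eq_0_iff)
    have "norm (contour_integral (linepath R (R * \<i>)) f) \<le> K / (1 + (real n)\<^sup>2 / 2) * norm (R * \<i> - R)"
    proof (rule contour_integral_bound_linepath[OF ci[OF in_Q(2,3)]])
      show "0 \<le> K / (1 + (real n)\<^sup>2 / 2)" using K by (simp add: add_pos_nonneg)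
      fix w assume w: "w \<in> closed_segment R (R * \<i>)"
      then obtain u where u: "0 \<le> u" "u \<le> 1" "w = (1 - u) *\<^sub>R R + u *\<^sub>R (R * \<i>)" by (auto simp: closed_segment_def)
      have "(norm w)\<^sup>2 = ((1-u) * n)\<^sup>2 + (u * n)\<^sup>2" by (simp add: u R_def cmod_power2)
      also have "\<dots> = (real n)\<^sup>2 * ((1-u)\<^sup>2 + u\<^sup>2)" by (simp add: algebra_simps power2_eq_square)
      also have "\<dots> \<ge> (real n)\<^sup>2 * (1/2)"
      proof (rule mult_left_mono)
        have "0 \<le> (2 * u - 1)\<^sup>2" by simp
        then show "1/2 \<le> (1-u)\<^sup>2 + u\<^sup>2" by (simp add: power2_eq_square algebra_simps)
      qed simp
      finally have nw: "(norm w)\<^sup>2 \<ge> (real n)\<^sup>2 / 2" by simp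
      have "norm (f w) \<le> K / (1 + (norm w)\<^sup>2)" using b w seg[OF in_Q(2,3)] by auto
      also have "\<dots> \<le> K / (1 + (real n)\<^sup>2 / 2)" using nw K by (intro divide_left_mono) (auto intro!: add_pos_nonneg mult_pos_pos)
      finally show "norm (f w) \<le> K / (1 + (real n)\<^sup>2 / 2)" .
    qed
    also have "\<dots> \<le> K / (1 + (real n)\<^sup>2 / 2) * (2 * real n)"
    proof (rule mult_left_mono)
      show "norm (R * \<i> - R) \<le> 2 * real n" using norm_triangle_ineq4[of "R * \<i>" R] by (simp add: norm_mult R_def)
      show "0 \<le> K / (1 + (real n)\<^sup>2 / 2)" using K by (simp add: add_pos_nonneg)
    qed
    finally show ?thesis unfolding e by (simp add: mult.commute mult.left_commute)
  qed
  have "(\<lambda>n. I 1 n - I \<i> n) \<longlonglongrightarrow> 0"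
  proof (rule Lim_null_comparison)
    show "\<forall>\<^sub>F n in sequentially. norm (I 1 n - I \<i> n) \<le> 2 * K * real n / (1 + (real n)\<^sup>2 / 2)"
      using eventually_gt_at_top[of 0] by eventually_elim (rule diff)
    show "(\<lambda>n. 2 * K * real n / (1 + (real n)\<^sup>2 / 2)) \<longlonglongrightarrow> 0" by real_asymp
  qed
  from LIMSEQ_unique[OF this tendsto_diff[OF lim[of 1] lim[of \<i>]]] show ?thesis by simp
qed

text \<open>The function \<open>h z / (z\<^sup>2 - p\<^sup>2)\<close> for a function \<open>h\<close> with a zero at \<open>p\<close>, with the singularity at \<open>p\<close> removed.\<close>
definition removable_quotient :: "(complex \<Rightarrow> complex) \<Rightarrow> complex \<Rightarrow> complex \<Rightarrow> complex" where
  "removable_quotient h p z = (if z = p then deriv h p else (h z - h p) / (z - p)) / (z + p)"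

lemma removable_quotient_eq: "h p = 0 \<Longrightarrow> z \<noteq> p \<Longrightarrow> removable_quotient h p z = h z / (z\<^sup>2 - p\<^sup>2)"
  unfolding removable_quotient_def by (simp add: power2_eq_square algebra_simps)

lemma removable_quotient_holo:
  assumes "h holomorphic_on U" "open U" "-p \<notin> U"
  shows "removable_quotient h p holomorphic_on U"
  unfolding removable_quotient_def
  by (intro holomorphic_on_divide pole_lemma_open[OF assms(1,2)] holomorphic_intros) (use assms(3) in \<open>auto simp: add_eq_0_iff2\<close>)

text \<open>Here \<open>p\<close> may lie on the boundary of \<open>Q\<close>, and at other boundary points \<open>h\<close> need only be continuous.\<close>
lemma removable_quotient_cont:
  assumes h: "h holomorphic_on U" "open U" "p \<in> U" "-p \<notin> U" "h p = 0" "continuous_on Q h" "-p \<notin> Q"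
  shows "continuous_on Q (removable_quotient h p)"
  unfolding continuous_on_eq_continuous_within
proof
  fix z assume z: "z \<in> Q"
  show "continuous (at z within Q) (removable_quotient h p)"
  proof (cases "z = p")
    case True
    have "isCont (removable_quotient h p) p"
      using removable_quotient_holo[OF h(1,2,4)] h(2,3) holomorphic_on_imp_continuous_on continuous_on_eq_continuous_at by blast
    then show ?thesis using True by (simp add: continuous_at_imp_continuous_within)
  next
    case False
    have nz: "z\<^sup>2 - p\<^sup>2 \<noteq> 0"
      using False z h(7) by (auto simp: power2_eq_iff)
    have "continuous (at z within Q) h" using h(6) z by (simp add: continuous_on_eq_continuous_within)
    then have "continuous (at z within Q) (\<lambda>z. h z / (z\<^sup>2 - p\<^sup>2))"
      by (intro continuous_intros nz) 
    then show ?thesis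
    proof (rule continuous_transform_within[where \<delta>="dist z p"])
      fix x' assume "x' \<in> Q" "dist x' z < dist z p"
      then have "x' \<noteq> p" by (auto simp: dist_commute)
      then show "h x' / (x'\<^sup>2 - p\<^sup>2) = removable_quotient h p x'" by (simp add: removable_quotient_eq[of h p x'] h(5))
    qed (use False z in auto)
  qed
qed

text \<open>A bound near infinity is enough, as the rest of the quadrant is compact.\<close>
lemma quadrant_bound:
  fixes f :: "complex \<Rightarrow> complex" and w :: "complex \<Rightarrow> real"
  assumes c: "continuous_on quadrant f" and w: "continuous_on UNIV w" "\<And>t. w t > 0"
    and b: "\<And>t. t \<in> quadrant \<Longrightarrow> norm t \<ge> R \<Longrightarrow> norm (f t) \<le> C / w t"
  obtains K where "K \<ge> 0" "\<And>t. t \<in> quadrant \<Longrightarrow> norm (f t) \<le> K / w t"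
proof -
  have cl: "closed quadrant"
  proof -
    have e: "quadrant = {z. Re z \<ge> 0} \<inter> {z. Im z \<ge> 0}" by (auto simp: quadrant_def)
    show ?thesis unfolding e by (intro closed_Int closed_halfspace_Re_ge closed_halfspace_Im_ge)
  qed
  have "compact (quadrant \<inter> cball 0 R)" by (intro closed_Int_compact cl compact_cball)
  moreover have "continuous_on (quadrant \<inter> cball 0 R) (\<lambda>t. norm (f t) * w t)"
    by (intro continuous_intros continuous_on_subset[OF c] continuous_on_subset[OF w(1)]) auto
  ultimately have "bounded ((\<lambda>t. norm (f t) * w t) ` (quadrant \<inter> cball 0 R))"
    using compact_continuous_image compact_imp_bounded by blast
  then obtain B where "\<forall>t\<in>quadrant \<inter> cball 0 R. norm (norm (f t) * w t) \<le> B"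
    by (auto simp: bounded_iff)
  then have B: "\<And>t. t \<in> quadrant \<Longrightarrow> norm t \<le> R \<Longrightarrow> norm (norm (f t) * w t) \<le> B" by auto
  show thesis
  proof (rule that[of "max 0 (max B C)"])
    fix t assume t: "t \<in> quadrant"
    have "norm (f t) * w t \<le> max 0 (max B C)"
    proof (cases "norm t \<le> R")
      case True then show ?thesis using B[OF t True] by auto
    next
      case False
      then show ?thesis using b[OF t] w(2)[of t] by (simp add: pos_le_divide_eq le_max_iff_disj)
    qed
    then show "norm (f t) \<le> max 0 (max B C) / w t" using w(2)[of t] by (simp add: pos_le_divide_eq)
  qed simp
qed

lemma norm_one_pm_sq:
  fixes z p :: complex
  assumes "norm z \<ge> 2" "norm p = 1"
  shows "norm (z\<^sup>2 - p) \<ge> (1 + (norm z)\<^sup>2) * (3/5)"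
proof -
  have "norm (z\<^sup>2 - p) \<ge> (norm z)\<^sup>2 - 1" using norm_triangle_ineq2[of "z\<^sup>2" p] assms by (simp add: norm_power)
  moreover have "(norm z)\<^sup>2 \<ge> 4" using power_mono[OF assms(1), of 2] by simp
  ultimately show ?thesis by simp
qed

lemma one_plus_norm_sq_pos: "1 + (norm (t::complex))\<^sup>2 > 0"
  by (simp add: add_pos_nonneg)

section \<open>Fourier transform of the Cauchy kernel\<close>

lemma AE_lborel_pos_neq: "AE s in lborel_pos. s \<noteq> c"
proof -
  have "AE s in lborel. s \<in> {0<..} \<longrightarrow> s \<noteq> c" using AE_lborel_singleton[of c] by auto
  then show ?thesis unfolding lborel_pos_def by (subst AE_restrict_space_iff) auto
qed

text \<open>Rotate \<open>(exp (\<i> s z) - exp (- s)) / (1 + z\<^sup>2)\<close>, which has no pole at \<open>\<i>\<close>. On the imaginary axis it is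
real, so after multiplication by \<open>\<i>\<close> the rotated integral has real part \<open>0\<close>.\<close>
lemma integral_cos_over_1_sq:
  assumes s: "s \<ge> 0"
  shows "(\<integral>z. cos (s * z) / (1 + z\<^sup>2) \<partial>lborel_pos) = pi / 2 * exp (-s)"
proof -
  define h where "h z = exp (\<i> * of_real s * z) - of_real (exp (-s))" for z
  have "\<i> * of_real s * \<i> = complex_of_real (-s)" by (simp add: complex_eq_iff)
  then have hi: "h \<i> = 0" unfolding h_def by (simp only: exp_of_real diff_self)
  have hh: "h holomorphic_on UNIV" unfolding h_def by (intro holomorphic_intros)
  define U where "U = - {-\<i>}"
  have U: "open U" "\<i> \<in> U" "-\<i> \<notin> U" "h holomorphic_on U" 
    using hh by (auto simp: U_def complex_eq_iff intro: holomorphic_on_subset)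
  have nQ: "-\<i> \<notin> quadrant" by (simp add: quadrant_def)
  have c: "continuous_on quadrant (removable_quotient h \<i>)"
    by (rule removable_quotient_cont[OF U(4,1,2,3) hi _ nQ]) (auto intro: holomorphic_on_imp_continuous_on holomorphic_on_subset[OF hh])
  have "interior quadrant \<subseteq> U" using interior_subset[of quadrant] nQ by (auto simp: U_def)
  then have ho: "removable_quotient h \<i> holomorphic_on interior quadrant"
    using removable_quotient_holo[OF U(4,1,3)] holomorphic_on_subset by blast
  have n: "norm (h z) \<le> 2" if "z \<in> quadrant" for z
  proof -
    have "norm (h z) \<le> exp (- s * Im z) + exp (-s)" unfolding h_def
      by (rule order_trans[OF norm_triangle_ineq4]) (simp add: norm_exp_eq_Re)
    moreover have "s * Im z \<ge> 0" using that s by (simp add: quadrant_def)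
    ultimately show ?thesis using s by (smt (verit) exp_le_one_iff mult_minus_left)
  qed
  obtain K where K: "K \<ge> 0" "\<And>t. t \<in> quadrant \<Longrightarrow> norm (removable_quotient h \<i> t) \<le> K / (1 + (norm t)\<^sup>2)"
  proof (rule quadrant_bound[OF c, where R=2 and C="10/3" and w="\<lambda>t. 1 + (norm t)\<^sup>2"])
    fix t assume t: "t \<in> quadrant" "norm t \<ge> 2"
    have "t \<noteq> \<i>" using t by auto
    then have "norm (removable_quotient h \<i> t) = norm (h t) / norm (t\<^sup>2 - (-1))" by (simp add: removable_quotient_eq[of h "\<i>", OF hi] norm_divide)
    also have "\<dots> \<le> 2 / ((1 + (norm t)\<^sup>2) * (3/5))"
      using norm_one_pm_sq[OF t(2), of "-1"] n[OF t(1)] one_plus_norm_sq_pos[of t] by (intro frac_le) auto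
    finally show "norm (removable_quotient h \<i> t) \<le> (10/3) / (1 + (norm t)\<^sup>2)" by (simp add: mult.commute)
  qed (auto intro!: continuous_intros one_plus_norm_sq_pos)
  have rot: "(\<integral>u. removable_quotient h \<i> (of_real u) \<partial>lborel_pos) = \<i> * (\<integral>u. removable_quotient h \<i> (of_real u * \<i>) \<partial>lborel_pos)"
    by (rule rotate_quadrant[OF c ho K(2)])
  have im0: "Im (\<integral>u. removable_quotient h \<i> (of_real u * \<i>) \<partial>lborel_pos) = 0"
  proof -
    have int: "integrable lborel_pos (\<lambda>u. removable_quotient h \<i> (of_real u * \<i>))" by (rule ray_integrable[OF c K(2)]) auto
    have "Im (\<integral>u. removable_quotient h \<i> (of_real u * \<i>) \<partial>lborel_pos) = (\<integral>u. Im (removable_quotient h \<i> (of_real u * \<i>)) \<partial>lborel_pos)"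
      using integral_Im[OF int] by simp
    also have "\<dots> = (\<integral>u. 0 \<partial>lborel_pos)"
    proof (rule integral_cong_AE)
      show "AE u in lborel_pos. Im (removable_quotient h \<i> (of_real u * \<i>)) = 0"
        using AE_lborel_pos_neq[of 1]
      proof eventually_elim
        fix u :: real assume "u \<noteq> 1"
        then have "of_real u * \<i> \<noteq> \<i>" by (simp add: complex_eq_iff)
        then have "removable_quotient h \<i> (of_real u * \<i>) = h (of_real u * \<i>) / of_real (1 - u\<^sup>2)"
          by (simp add: removable_quotient_eq[of h "\<i>", OF hi] power_mult_distrib)
        moreover have "h (of_real u * \<i>) = of_real (exp (-(s * u)) - exp (-s))"
        proof -
          have "\<i> * of_real s * (of_real u * \<i>) = complex_of_real (-(s * u))" by (simp add: complex_eq_iff)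
          then show ?thesis unfolding h_def by (simp only: exp_of_real of_real_diff)
        qed
        ultimately show "Im (removable_quotient h \<i> (of_real u * \<i>)) = 0" by (simp only: Im_complex_of_real of_real_divide[symmetric])
      qed
    qed (use borel_measurable_integrable[OF int] in auto)
    finally show ?thesis by simp
  qed
  have int: "integrable lborel_pos (\<lambda>u. removable_quotient h \<i> (of_real u * 1))" by (rule ray_integrable[OF c K(2)]) auto
  have "(\<integral>u. Re (removable_quotient h \<i> (of_real u)) \<partial>lborel_pos) = Re (\<integral>u. removable_quotient h \<i> (of_real u) \<partial>lborel_pos)"
    using integral_Re[OF int] by simp
  also have "\<dots> = 0" unfolding rot using im0 by simp
  also have "(\<integral>u. Re (removable_quotient h \<i> (of_real u)) \<partial>lborel_pos) = (\<integral>u. cos (s * u) / (1 + u\<^sup>2) - exp (-s) * (1 / (1 + u\<^sup>2)) \<partial>lborel_pos)"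
  proof (rule Bochner_Integration.integral_cong[OF refl])
    fix u
    have "complex_of_real u \<noteq> \<i>" by (simp add: complex_eq_iff)
    then have "removable_quotient h \<i> (of_real u) = h (of_real u) / of_real (1 + u\<^sup>2)"
      by (simp add: removable_quotient_eq[of h "\<i>", OF hi] add.commute)
    moreover have "Re (h (of_real u)) = cos (s * u) - exp (-s)"
      by (simp add: h_def Re_exp)
    ultimately show "Re (removable_quotient h \<i> (of_real u)) = cos (s * u) / (1 + u\<^sup>2) - exp (-s) * (1 / (1 + u\<^sup>2))"
      by (simp only: Re_divide_of_real) (simp add: diff_divide_distrib)
  qed
  also have "\<dots> = (\<integral>u. cos (s * u) / (1 + u\<^sup>2) \<partial>lborel_pos) - exp (-s) * (pi / 2)"
  proof (subst Bochner_Integration.integral_diff)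
    show "integrable lborel_pos (\<lambda>u. cos (s * u) / (1 + u\<^sup>2))"
    proof (rule lborel_pos_integrable_bound[OF recip_1_sq_lborel_pos(1)])
      fix x :: real
      have "1 + x\<^sup>2 > 0" by (simp add: add_pos_nonneg)
      then show "norm (cos (s * x) / (1 + x\<^sup>2)) \<le> 1 / (1 + x\<^sup>2)"
        by (simp add: abs_divide divide_right_mono)
    qed measurable
    show "integrable lborel_pos (\<lambda>u. exp (-s) * (1 / (1 + u\<^sup>2)))"
      by (rule integrable_mult_right[OF recip_1_sq_lborel_pos(1)])
  qed (simp only: Bochner_Integration.integral_mult_right_zero recip_1_sq_lborel_pos(2))
  finally show ?thesis by simp
qed

lemma lborel_split:
  fixes f :: "real \<Rightarrow> 'a::{banach, second_countable_topology}"
  assumes f[measurable]: "f \<in> borel_measurable borel"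
  shows "integrable lborel f \<longleftrightarrow> integrable lborel_pos f \<and> integrable lborel_pos (\<lambda>x. f (- x))"
    and "integrable lborel f \<Longrightarrow> integral\<^sup>L lborel f = integral\<^sup>L lborel_pos f + integral\<^sup>L lborel_pos (\<lambda>x. f (- x))"
proof -
  have e: "(\<lambda>x. indicator {0<..} (0 + (-1) * x) *\<^sub>R f (0 + (-1) * (0 + (-1) * x))) = (\<lambda>x. indicator {..<0} x *\<^sub>R f x)" 
    by (auto simp: indicator_def)
  have neg: "integrable lborel_pos (\<lambda>x. f (- x)) \<longleftrightarrow> set_integrable lborel {..<0} f"
    unfolding integrable_lborel_pos set_integrable_def
    by (subst lborel_integrable_real_affine_iff[where c="-1" and t=0, symmetric]) (auto simp: indicator_def cong: if_cong)
  have negi: "integral\<^sup>L lborel_pos (\<lambda>x. f (- x)) = (LINT x:{..<0}|lborel. f x)"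
    unfolding integral_lborel_pos set_lebesgue_integral_def
    by (subst lborel_integral_real_affine[where c="-1" and t=0]) (auto simp: indicator_def cong: if_cong)
  have ae: "AE x in lborel. f x = indicator {0<..} x *\<^sub>R f x + indicator {..<0} x *\<^sub>R f x"
    using AE_lborel_singleton[of "0::real"] by eventually_elim (auto simp: indicator_def)
  show "integrable lborel f \<longleftrightarrow> integrable lborel_pos f \<and> integrable lborel_pos (\<lambda>x. f (- x))"
  proof
    assume "integrable lborel f"
    then show "integrable lborel_pos f \<and> integrable lborel_pos (\<lambda>x. f (- x))"
      unfolding neg unfolding integrable_lborel_pos set_integrable_def by (auto intro!: integrable_mult_indicator)
  next
    assume "integrable lborel_pos f \<and> integrable lborel_pos (\<lambda>x. f (- x))"
    then have "integrable lborel (\<lambda>x. indicator {0<..} x *\<^sub>R f x + indicator {..<0} x *\<^sub>R f x)"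
      unfolding neg unfolding integrable_lborel_pos set_integrable_def by (intro Bochner_Integration.integrable_add) auto
    then show "integrable lborel f"
      by (rule integrable_cong_AE_imp) (use ae in auto)
  qed
  assume f: "integrable lborel f"
  have "integral\<^sup>L lborel f = (\<integral>x. indicator {0<..} x *\<^sub>R f x + indicator {..<0} x *\<^sub>R f x \<partial>lborel)"
    by (rule integral_cong_AE[OF _ _ ae]) auto
  also have "\<dots> = integral\<^sup>L lborel_pos f + integral\<^sup>L lborel_pos (\<lambda>x. f (- x))"
    unfolding negi unfolding integral_lborel_pos set_lebesgue_integral_def
    by (rule Bochner_Integration.integral_add) (use f in \<open>auto intro!: integrable_mult_indicator\<close>)
  finally show "integral\<^sup>L lborel f = integral\<^sup>L lborel_pos f + integral\<^sup>L lborel_pos (\<lambda>x. f (- x))" .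
qed

lemma cauchy_kernel_pos: "y > 0 \<Longrightarrow> cauchy_kernel y x > 0"
  unfolding cauchy_kernel_def by (simp add: add_pos_nonneg)

lemma cauchy_kernel_measurable [measurable]: "cauchy_kernel y \<in> borel_measurable borel"
  unfolding cauchy_kernel_def by measurable

lemma integrable_lborel_recip: "integrable lborel (\<lambda>u::real. 1 / (1 + u\<^sup>2))"
  using lborel_split(1)[of "\<lambda>u. 1 / (1 + u\<^sup>2)"] recip_1_sq_lborel_pos by simp

lemma cauchy_kernel_scaled: "y > 0 \<Longrightarrow> y * cauchy_kernel y (y * u) = (1/pi) * (1 / (1 + u\<^sup>2))"
  unfolding cauchy_kernel_def
proof -
  assume y: "y > 0"
  have "y\<^sup>2 + (y * u)\<^sup>2 = y * y * (1 + u\<^sup>2)" by (simp add: algebra_simps power2_eq_square)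
  then show "y * (1 / pi * (y / (y\<^sup>2 + (y * u)\<^sup>2))) = 1 / pi * (1 / (1 + u\<^sup>2))" using y by simp
qed

lemma cauchy_kernel_integrable: "y > 0 \<Longrightarrow> integrable lborel (\<lambda>z. cauchy_kernel y (z - x))"
proof -
  assume y: "y > 0"
  have "integrable lborel (\<lambda>u. y * cauchy_kernel y (x + y * u - x))"
    using integrable_mult_right[OF integrable_lborel_recip, of "1/pi"] by (simp only: cauchy_kernel_scaled[OF y] add_diff_cancel_left')
  then have "integrable lborel (\<lambda>u. cauchy_kernel y (x + y * u - x))" using y integrable_mult_right[where c="1/y" and f="\<lambda>u. y * cauchy_kernel y (x + y * u - x)" and M=lborel] by simp
  then show ?thesis using lborel_integrable_real_affine_iff[of y "\<lambda>z. cauchy_kernel y (z - x)" x] y by simp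
qed

lemma cauchy_charfn:
  assumes y: "y > 0" and s: "s \<ge> 0"
  shows "(\<integral>z. of_real (cauchy_kernel y (z - x)) * exp (\<i> * of_real (s * z)) \<partial>lborel) = exp (\<i> * of_real (s * x) - of_real (s * y))"
proof -
  let ?g = "\<lambda>u. of_real (1 / (1 + u\<^sup>2)) * exp (\<i> * of_real (s * y * u))"
  have "(\<integral>z. of_real (cauchy_kernel y (z - x)) * exp (\<i> * of_real (s * z)) \<partial>lborel) 
      = \<bar>y\<bar> *\<^sub>R (\<integral>u. of_real (cauchy_kernel y (x + y * u - x)) * exp (\<i> * of_real (s * (x + y * u))) \<partial>lborel)"
    by (rule lborel_integral_real_affine) (use y in auto)
  also have "\<dots> = (\<integral>u. of_real y * (of_real (cauchy_kernel y (x + y * u - x)) * exp (\<i> * of_real (s * (x + y * u)))) \<partial>lborel)"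
    using y by (simp add: scaleR_conv_of_real)
  also have "\<dots> = (\<integral>u. (of_real (1/pi) * exp (\<i> * of_real (s * x))) * ?g u \<partial>lborel)"
  proof (rule Bochner_Integration.integral_cong[OF refl])
    fix u
    have "of_real y * (of_real (cauchy_kernel y (x + y * u - x)) * exp (\<i> * of_real (s * (x + y * u)))) 
        = complex_of_real (y * cauchy_kernel y (y * u)) * exp (\<i> * of_real (s * (x + y * u)))" by simp
    also have "\<dots> = (of_real (1/pi) * exp (\<i> * of_real (s * x))) * ?g u"
      unfolding cauchy_kernel_scaled[OF y] by (simp add: exp_add algebra_simps)
    finally show "of_real y * (of_real (cauchy_kernel y (x + y * u - x)) * exp (\<i> * of_real (s * (x + y * u)))) = (of_real (1/pi) * exp (\<i> * of_real (s * x))) * ?g u" .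
  qed
  also have "\<dots> = (of_real (1/pi) * exp (\<i> * of_real (s * x))) * (\<integral>u. ?g u \<partial>lborel)"
    by (rule Bochner_Integration.integral_mult_right_zero)
  also have "(\<integral>u. ?g u \<partial>lborel) = of_real (pi * exp (- (s * y)))"
  proof -
    have int: "integrable lborel ?g"
    proof (rule Bochner_Integration.integrable_bound[OF integrable_lborel_recip])
      have "norm (?g u) \<le> norm (1 / (1 + u\<^sup>2))" for u
        unfolding norm_mult norm_of_real norm_exp_eq_Re by simp
      then show "AE u in lborel. norm (?g u) \<le> norm (1 / (1 + u\<^sup>2))" by simp
    qed measurable
    have HLint: "integrable lborel_pos ?g" "integrable lborel_pos (\<lambda>u. ?g (-u))" using lborel_split(1)[of ?g] int by auto
    have "(\<integral>u. ?g u \<partial>lborel) = (\<integral>u. ?g u \<partial>lborel_pos) + (\<integral>u. ?g (-u) \<partial>lborel_pos)"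
      by (rule lborel_split(2)[OF _ int]) measurable
    also have "\<dots> = (\<integral>u. ?g u + ?g (-u) \<partial>lborel_pos)"
      by (rule Bochner_Integration.integral_add[OF HLint, symmetric])
    also have "\<dots> = (\<integral>u. complex_of_real (2 * (cos (s * y * u) / (1 + u\<^sup>2))) \<partial>lborel_pos)"
      by (intro Bochner_Integration.integral_cong refl) (simp add: complex_eq_iff Re_exp Im_exp)
    also have "\<dots> = of_real (\<integral>u. 2 * (cos (s * y * u) / (1 + u\<^sup>2)) \<partial>lborel_pos)"
      by (rule integral_complex_of_real)
    also have "(\<integral>u. 2 * (cos (s * y * u) / (1 + u\<^sup>2)) \<partial>lborel_pos) = pi * exp (- (s * y))"
      unfolding Bochner_Integration.integral_mult_right_zero using integral_cos_over_1_sq[of "s * y"] y s by simp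
    finally show ?thesis .
  qed
  also have "(of_real (1/pi) * exp (\<i> * of_real (s * x))) * of_real (pi * exp (- (s * y))) = exp (\<i> * of_real (s * x) - of_real (s * y))"
    by (simp add: exp_diff exp_minus exp_of_real[symmetric] field_simps)
  finally show ?thesis .
qed

section \<open>The Laplace transform of r on two quadrants\<close>

text \<open>The density for which \<open>r_fun\<close> is a Laplace transform, see \<open>r_fun_eq\<close>.\<close>
definition rho :: "real \<Rightarrow> real" where
  "rho t = sqrt 2 / (2 * pi) * (t / (1 + t\<^sup>2)) * exp (- eta t)"

text \<open>The numerator of the Laplace transform of \<open>r\<close>; the denominator is \<open>1 + z\<^sup>2\<close>.\<close>
definition symbol1_num :: "complex \<Rightarrow> complex" where
  "symbol1_num z = of_real (cos (pi/8)) + z * of_real (sin (pi/8)) - of_real (sqrt 2 / 2) * wh_factor z"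

text \<open>The same numerator at the point \<open>\<i> z\<close>, for \<open>z\<close> in the first quadrant. There \<open>wh_factor (\<i> z)\<close> is replaced by
\<open>(1 + z) / wh_factor (- \<i> z)\<close> according to the product formula, so that the function extends continuously
to the negative half-axis, which is the cut of \<open>wh_factor\<close>.\<close>
definition symbol2_num :: "complex \<Rightarrow> complex" where
  "symbol2_num z = of_real (cos (pi/8)) + \<i> * z * of_real (sin (pi/8)) - of_real (sqrt 2 / 2) * (1 + z) / wh_factor (- \<i> * z)"

text \<open>The Laplace transform of \<open>r\<close> on the first quadrant.\<close>
definition symbol1 :: "complex \<Rightarrow> complex" where "symbol1 z = removable_quotient symbol1_num \<i> z"
text \<open>The Laplace transform of \<open>r\<close> on the second quadrant, as a function of \<open>z\<close> in the first quadrant through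
the argument \<open>\<i> z\<close>. Thus \<open>symbol2 (\<i> s)\<close> is its boundary value at \<open>- s\<close> from above.\<close>
definition symbol2 :: "complex \<Rightarrow> complex" where "symbol2 z = - removable_quotient symbol2_num 1 z"

text \<open>This zero, which removes the pole at \<open>\<i>\<close>, is the reason for the phase \<open>\<pi>/8\<close>.\<close>
lemma symbol1_num_i: "symbol1_num \<i> = 0"
proof -
  have "wh_factor \<i> = of_real (sqrt 2) * cis (pi/8)" by (simp add: wh_factor_def exp_wh_log_ii)
  then have "of_real (sqrt 2 / 2) * wh_factor \<i> = of_real (sqrt 2 / 2 * sqrt 2) * cis (pi/8)" by (simp only: of_real_mult mult.assoc)
  also have "sqrt 2 / 2 * sqrt 2 = (1::real)" by simp
  finally have "of_real (sqrt 2 / 2) * wh_factor \<i> = cis (pi/8)" by simp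
  then show ?thesis unfolding symbol1_num_def by (simp only:) (simp add: complex_eq_iff)
qed

lemma symbol2_num_1: "symbol2_num 1 = 0"
proof -
  have a: "wh_factor (-\<i>) = of_real (sqrt 2) * cis (-pi/8)" by (simp add: wh_factor_def exp_wh_log_ii)
  have "of_real (sqrt 2 / 2) * (1 + 1) / wh_factor (- \<i> * 1) = of_real (sqrt 2) / (of_real (sqrt 2) * cis (-pi/8))"
    by (simp add: a)
  also have "\<dots> = 1 / cis (-pi/8)" by simp
  also have "\<dots> = cis (pi/8)" by (simp add: cis_divide[of 0, simplified])
  finally show ?thesis unfolding symbol2_num_def by (simp only:) (simp add: complex_eq_iff)
qed

lemma symbol1_regular: "continuous_on quadrant symbol1" "symbol1 holomorphic_on interior quadrant"
proof -
  define U where "U = slit_plane - {-\<i>}"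
  have U: "open U" "\<i> \<in> U" "-\<i> \<notin> U" by (auto simp: U_def slit_plane_iff complex_eq_iff)
  have h: "symbol1_num holomorphic_on U" unfolding symbol1_num_def U_def
    by (intro holomorphic_intros holomorphic_on_subset[OF wh_factor_holo]) auto
  have c: "continuous_on quadrant symbol1_num" unfolding symbol1_num_def
    by (intro continuous_intros continuous_on_subset[OF wh_factor_cont]) (auto simp: quadrant_def)
  show "continuous_on quadrant symbol1" unfolding symbol1_def
    by (rule removable_quotient_cont[OF h U symbol1_num_i c]) (auto simp: quadrant_def)
  show "symbol1 holomorphic_on interior quadrant" unfolding symbol1_def
    by (rule holomorphic_on_subset[OF removable_quotient_holo[OF h U(1,3)]]) (auto simp: interior_quadrant U_def slit_plane_iff)
qed

lemma symbol2_regular: "continuous_on quadrant symbol2" "symbol2 holomorphic_on interior quadrant"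
proof -
  define U where "U = (\<lambda>z. - \<i> * z) -` slit_plane - {-1}"
  have U: "open U" "1 \<in> U" "-1 \<notin> U" 
    unfolding U_def by (auto simp: slit_plane_iff intro!: open_Diff open_vimage continuous_intros)
  have "(wh_factor \<circ> (\<lambda>z. - \<i> * z)) holomorphic_on U"
    by (rule holomorphic_on_compose_gen[OF _ wh_factor_holo]) (auto simp: U_def intro!: holomorphic_intros)
  then have "(\<lambda>z. wh_factor (- \<i> * z)) holomorphic_on U" by (simp add: comp_def)
  then have h: "symbol2_num holomorphic_on U" unfolding symbol2_num_def
    by (intro holomorphic_intros) auto
  have "continuous_on quadrant (\<lambda>z. wh_factor (- \<i> * z))"
    by (rule continuous_on_compose2[OF wh_factor_cont]) (auto simp: quadrant_def intro!: continuous_intros)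
  then have c: "continuous_on quadrant symbol2_num" unfolding symbol2_num_def
    by (intro continuous_intros) auto
  show "continuous_on quadrant symbol2" unfolding symbol2_def
    by (intro continuous_intros removable_quotient_cont[OF h U symbol2_num_1 c]) (auto simp: quadrant_def)
  show "symbol2 holomorphic_on interior quadrant" unfolding symbol2_def
    by (intro holomorphic_intros holomorphic_on_subset[OF removable_quotient_holo[OF h U(1,3)]]) (auto simp: interior_quadrant U_def slit_plane_iff complex_eq_iff)
qed

lemma sqrt2_half_le_1: "sqrt 2 / 2 \<le> 1" using real_sqrt_le_mono[of 2 4] by simp

lemma symbol_quotient_bound:
  fixes t n :: complex
  assumes t: "norm t \<ge> 2" and n: "norm n \<le> C * (1 + norm t)" and p: "norm p = 1" and C: "C \<ge> 0"
  shows "norm (n / (t\<^sup>2 - p)) \<le> (C * 10 / 3) / (1 + norm t)"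
proof -
  let ?r = "norm t"
  have "(1 + ?r)\<^sup>2 \<le> 2 * (1 + ?r\<^sup>2)" using zero_le_power2[of "1 - ?r"] by (simp add: power2_eq_square algebra_simps)
  then have "(3/10) * (1 + ?r)\<^sup>2 \<le> norm (t\<^sup>2 - p)" using norm_one_pm_sq[OF t p] by simp
  then have "norm (n / (t\<^sup>2 - p)) \<le> (C * (1 + ?r)) / ((3/10) * (1 + ?r)\<^sup>2)"
    unfolding norm_divide using n t C by (intro frac_le) auto
  also have "\<dots> = (C * 10 / 3) / (1 + ?r)" 
    using t by (simp add: power2_eq_square field_simps add_nonneg_eq_0_iff)
  finally show ?thesis .
qed

lemma symbol_decay: obtains K where "K \<ge> 0" "\<And>t. t \<in> quadrant \<Longrightarrow> norm (symbol1 t) \<le> K / (1 + norm t)" "\<And>t. t \<in> quadrant \<Longrightarrow> norm (symbol2 t) \<le> K / (1 + norm t)"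
proof -
  obtain R where R: "R \<ge> 2" "\<And>z. Re z \<ge> 0 \<Longrightarrow> norm z \<ge> R \<Longrightarrow> norm (wh_factor z) \<le> exp 1 * norm z \<and> norm (1 / wh_factor z) \<le> exp 1"
    using wh_factor_bounds by blast
  have p: "1 + norm t > 0" for t :: complex by (simp add: add_pos_nonneg)
  obtain K1 where K1: "K1 \<ge> 0" "\<And>t. t \<in> quadrant \<Longrightarrow> norm (symbol1 t) \<le> K1 / (1 + norm t)"
  proof (rule quadrant_bound[OF symbol1_regular(1), where R=R and w="\<lambda>t. 1 + norm t" and C="(1 + exp 1) * 10 / 3"])
    fix t assume t: "t \<in> quadrant" "norm t \<ge> R"
    then have t2: "norm t \<ge> 2" and ti: "t \<noteq> \<i>" using R(1) by auto
    have "norm (symbol1_num t) \<le> norm (of_real (cos (pi/8)) :: complex) + norm (t * of_real (sin (pi/8))) + norm (of_real (sqrt 2 / 2) * wh_factor t)"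
      unfolding symbol1_num_def by (meson norm_triangle_ineq norm_triangle_ineq4 order_trans add_right_mono)
    also have "norm (of_real (cos (pi/8)) :: complex) \<le> 1" by simp
    also have "norm (t * of_real (sin (pi/8))) \<le> norm t" by (simp add: norm_mult mult_left_le)
    also have "norm (of_real (sqrt 2 / 2) * wh_factor t) \<le> 1 * (exp 1 * norm t)"
      unfolding norm_mult using R(2)[of t] t sqrt2_half_le_1 by (intro mult_mono) (auto simp: quadrant_def)
    also have "1 + norm t + 1 * (exp 1 * norm t) \<le> (1 + exp 1) * (1 + norm t)" by (simp add: algebra_simps)
    finally have "norm (symbol1_num t) \<le> (1 + exp 1) * (1 + norm t)" by simp
    from symbol_quotient_bound[OF t2 this, of "-1"]
    show "norm (symbol1 t) \<le> (1 + exp 1) * 10 / 3 / (1 + norm t)"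
      using ti unfolding symbol1_def by (simp add: removable_quotient_eq[of symbol1_num \<i>, OF symbol1_num_i])
  qed (auto intro!: continuous_intros p)
  obtain K2 where K2: "K2 \<ge> 0" "\<And>t. t \<in> quadrant \<Longrightarrow> norm (symbol2 t) \<le> K2 / (1 + norm t)"
  proof (rule quadrant_bound[OF symbol2_regular(1), where R=R and w="\<lambda>t. 1 + norm t" and C="(1 + exp 1) * 10 / 3"])
    fix t assume t: "t \<in> quadrant" "norm t \<ge> R"
    then have t2: "norm t \<ge> 2" and ti: "t \<noteq> 1" using R(1) by auto
    have "norm (symbol2_num t) \<le> norm (of_real (cos (pi/8)) :: complex) + norm (\<i> * t * of_real (sin (pi/8))) + norm (of_real (sqrt 2 / 2) * (1 + t) / wh_factor (-\<i> * t))"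
      unfolding symbol2_num_def by (meson norm_triangle_ineq norm_triangle_ineq4 order_trans add_right_mono)
    also have "norm (of_real (cos (pi/8)) :: complex) \<le> 1" by simp
    also have "norm (\<i> * t * of_real (sin (pi/8))) \<le> norm t" by (simp add: norm_mult mult_left_le)
    also have "norm (of_real (sqrt 2 / 2) * (1 + t) / wh_factor (-\<i> * t)) = norm (complex_of_real (sqrt 2 / 2)) * norm (1 + t) * norm (1 / wh_factor (-\<i> * t))"
      by (simp only: norm_mult norm_divide) simp
    also have "\<dots> \<le> 1 * (1 + norm t) * exp 1"
    proof (intro mult_mono)
      show "norm (1 / wh_factor (- \<i> * t)) \<le> exp 1" using R(2)[of "-\<i> * t"] t by (auto simp: quadrant_def norm_mult)
      show "norm (1 + t) \<le> 1 + norm t" using norm_triangle_ineq[of 1 t] by simp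
    qed (use sqrt2_half_le_1 in auto)
    also have "1 + norm t + 1 * (1 + norm t) * exp 1 \<le> (1 + exp 1) * (1 + norm t)" by (simp add: algebra_simps)
    finally have "norm (symbol2_num t) \<le> (1 + exp 1) * (1 + norm t)" by simp
    from symbol_quotient_bound[OF t2 this, of 1]
    show "norm (symbol2 t) \<le> (1 + exp 1) * 10 / 3 / (1 + norm t)"
      using ti unfolding symbol2_def by (simp add: removable_quotient_eq[of symbol2_num 1, OF symbol2_num_1])
  qed (auto intro!: continuous_intros p)
  show thesis
  proof (rule that[of "max K1 K2"])
    fix t assume t: "t \<in> quadrant"
    have "K1 / (1 + norm t) \<le> max K1 K2 / (1 + norm t)" "K2 / (1 + norm t) \<le> max K1 K2 / (1 + norm t)"
      using p[of t] by (auto intro!: divide_right_mono)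
    then show "norm (symbol1 t) \<le> max K1 K2 / (1 + norm t)" "norm (symbol2 t) \<le> max K1 K2 / (1 + norm t)"
      using K1(2)[OF t] K2(2)[OF t] by linarith+
  qed (use K1 in auto)
qed

definition symbol_const :: real where
  "symbol_const = (SOME K. K \<ge> 0 \<and> (\<forall>t\<in>quadrant. norm (symbol1 t) \<le> K / (1 + norm t)) \<and> (\<forall>t\<in>quadrant. norm (symbol2 t) \<le> K / (1 + norm t)))"

lemma symbol_const_bound: "symbol_const \<ge> 0" "t \<in> quadrant \<Longrightarrow> norm (symbol1 t) \<le> symbol_const / (1 + norm t)" "t \<in> quadrant \<Longrightarrow> norm (symbol2 t) \<le> symbol_const / (1 + norm t)"
proof -
  have "symbol_const \<ge> 0 \<and> (\<forall>t\<in>quadrant. norm (symbol1 t) \<le> symbol_const / (1 + norm t)) \<and> (\<forall>t\<in>quadrant. norm (symbol2 t) \<le> symbol_const / (1 + norm t))"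
    unfolding symbol_const_def by (rule someI_ex) (meson symbol_decay)
  then show "symbol_const \<ge> 0" "t \<in> quadrant \<Longrightarrow> norm (symbol1 t) \<le> symbol_const / (1 + norm t)" "t \<in> quadrant \<Longrightarrow> norm (symbol2 t) \<le> symbol_const / (1 + norm t)" by auto
qed

lemma symbol1_real: "s > 0 \<Longrightarrow> Im (symbol1 (of_real s)) = 0"
proof -
  assume s: "s > 0"
  have "of_real s \<noteq> \<i>" by (simp add: complex_eq_iff)
  then have "symbol1 (of_real s) = symbol1_num (of_real s) / of_real (s\<^sup>2 + 1)"
    unfolding symbol1_def by (simp add: removable_quotient_eq[of symbol1_num \<i>, OF symbol1_num_i])
  moreover have "symbol1_num (of_real s) = of_real (cos (pi/8) + s * sin (pi/8) - sqrt 2 / 2 * exp (eta s))"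
    unfolding symbol1_num_def wh_factor_real[OF s] by simp
  ultimately show "Im (symbol1 (of_real s)) = 0" by (simp only: of_real_divide[symmetric] Im_complex_of_real)
qed

text \<open>On the cut, the product formula turns the factor into \<open>(1 + \<i> s) exp (- eta s)\<close>: its imaginary part
produces \<open>rho\<close>, its real part \<open>rho s / s\<close>.\<close>
lemma symbol2_imag:
  assumes s: "s > 0"
  shows "Im (symbol2 (of_real s * \<i>)) = - pi * rho s"
    and "Re (symbol2 (of_real s * \<i>)) = (cos (pi/8) - s * sin (pi/8)) / (1 + s\<^sup>2) - pi * rho s / s"
proof -
  have ne: "of_real s * \<i> \<noteq> 1" by (simp add: complex_eq_iff)
  have a: "wh_factor (- \<i> * (of_real s * \<i>)) = of_real (exp (eta s))"
  proof -
    have "- \<i> * (of_real s * \<i>) = of_real s" by (simp add: complex_eq_iff)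
    then show ?thesis using wh_factor_real[OF s] by simp
  qed
  have "symbol2 (of_real s * \<i>) = - (symbol2_num (of_real s * \<i>) / ((of_real s * \<i>)\<^sup>2 - 1\<^sup>2))"
    unfolding symbol2_def using ne by (simp add: removable_quotient_eq[of symbol2_num 1, OF symbol2_num_1])
  also have "(of_real s * \<i>)\<^sup>2 - 1\<^sup>2 = - complex_of_real (1 + s\<^sup>2)" by (simp add: power_mult_distrib)
  finally have e: "symbol2 (of_real s * \<i>) = symbol2_num (of_real s * \<i>) / of_real (1 + s\<^sup>2)"
    by (simp only: minus_divide_right minus_minus)
  have "symbol2_num (of_real s * \<i>) = of_real (cos (pi/8) - s * sin (pi/8)) - of_real (sqrt 2 / 2 * exp (- eta s)) * (1 + of_real s * \<i>)"
    unfolding symbol2_num_def a by (simp add: complex_eq_iff exp_minus field_simps)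
  then have "Re (symbol2_num (of_real s * \<i>)) = cos (pi/8) - s * sin (pi/8) - sqrt 2 / 2 * exp (- eta s)"
     "Im (symbol2_num (of_real s * \<i>)) = - (sqrt 2 / 2 * exp (- eta s)) * s" by auto
  then show "Im (symbol2 (of_real s * \<i>)) = - pi * rho s" 
    "Re (symbol2 (of_real s * \<i>)) = (cos (pi/8) - s * sin (pi/8)) / (1 + s\<^sup>2) - pi * rho s / s"
    unfolding e Re_divide_of_real Im_divide_of_real rho_def using s by (simp_all add: diff_divide_distrib)
qed

text \<open>Both functions describe the transform on the positive imaginary axis. The point \<open>s = 1\<close>, where it is
defined by a limit, is a null set and can be left out.\<close>
lemma symbols_agree:
  assumes s: "s > 0" "s \<noteq> 1" shows "symbol1 (of_real s * \<i>) = symbol2 (of_real s)"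
proof -
  have ne: "of_real s * \<i> \<noteq> \<i>" "complex_of_real s \<noteq> 1" using s by (auto simp: complex_eq_iff)
  have "wh_factor (of_real s * \<i>) * wh_factor (- (of_real s * \<i>)) = of_real (1 + s)"
    by (subst wh_factor_prod) (use s in \<open>auto simp: complex_eq_iff\<close>)
  then have "wh_factor (of_real s * \<i>) = (1 + of_real s) / wh_factor (- (of_real s * \<i>))" by (simp add: field_simps)
  then have "symbol1_num (of_real s * \<i>) = symbol2_num (of_real s)"
    unfolding symbol1_num_def symbol2_num_def by (simp add: mult.commute mult.left_commute)
  moreover have "(of_real s * \<i>)\<^sup>2 - \<i>\<^sup>2 = - ((complex_of_real s)\<^sup>2 - 1\<^sup>2)" by (simp add: power_mult_distrib)
  moreover have "symbol1 (of_real s * \<i>) = symbol1_num (of_real s * \<i>) / ((of_real s * \<i>)\<^sup>2 - \<i>\<^sup>2)"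
    unfolding symbol1_def by (rule removable_quotient_eq[of symbol1_num \<i>, OF symbol1_num_i ne(1)])
  moreover have "symbol2 (of_real s) = - (symbol2_num (of_real s) / ((of_real s)\<^sup>2 - 1\<^sup>2))"
    unfolding symbol2_def by (simp only: removable_quotient_eq[of symbol2_num 1, OF symbol2_num_1 ne(2)])
  ultimately show ?thesis by (simp only: minus_divide_right)
qed

lemma symbol_measurable_rays:
  "(\<lambda>s. symbol2 (of_real s)) \<in> borel_measurable lborel_pos" "(\<lambda>s. symbol2 (of_real s * \<i>)) \<in> borel_measurable lborel_pos"
  "(\<lambda>s. symbol1 (of_real s)) \<in> borel_measurable lborel_pos"
  by (intro continuous_on_measurable_lborel_pos continuous_on_compose2[OF symbol2_regular(1)] continuous_on_compose2[OF symbol1_regular(1)] continuous_intros;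
      use quadrant_ray in auto)+

lemma symbol_decay_rays: 
  assumes "s > 0"
  shows "norm (symbol2 (of_real s)) \<le> symbol_const / (1 + s)" "norm (symbol2 (of_real s * \<i>)) \<le> symbol_const / (1 + s)" "norm (symbol1 (of_real s)) \<le> symbol_const / (1 + s)"
  using symbol_const_bound(2,3)[OF quadrant_ray(1)[OF assms]] symbol_const_bound(3)[OF quadrant_ray(3)[OF assms]] assms by (auto simp: norm_mult)

section \<open>The Fourier integral of the transform and its boundary values\<close>

text \<open>The function \<open>F\<close> of the introduction. The exponent \<open>\<i> s w\<close> is written as \<open>- (s * (- \<i> * w))\<close> so that the lemmas
on Laplace transforms apply.\<close>
definition fourier_ext :: "complex \<Rightarrow> complex" where
  "fourier_ext w = (\<integral>s. exp (- (of_real s * (- \<i> * w))) * symbol2 (of_real s) \<partial>lborel_pos)"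

lemma laplace_tendsto:
  fixes g :: "real \<Rightarrow> complex"
  assumes g: "g \<in> borel_measurable lborel_pos" "\<And>s. s > 0 \<Longrightarrow> norm (g s) \<le> K" and a: "a > 0"
    and w: "w \<longlonglongrightarrow> w0" "\<And>n. Re (w n) \<ge> a"
  shows "(\<lambda>n. \<integral>s. exp (- (of_real s * w n)) * g s \<partial>lborel_pos) \<longlonglongrightarrow> (\<integral>s. exp (- (of_real s * w0)) * g s \<partial>lborel_pos)"
proof (rule integral_dominated_convergence[where w="\<lambda>s. exp (- a * s) * K"])
  show "integrable lborel_pos (\<lambda>s. exp (- a * s) * K)" by (intro integrable_mult_left exp_lborel_pos a)
  show "AE s in lborel_pos. (\<lambda>n. exp (- (of_real s * w n)) * g s) \<longlonglongrightarrow> exp (- (of_real s * w0)) * g s"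
    by (intro AE_I2 tendsto_intros w)
  show "AE s in lborel_pos. norm (exp (- (of_real s * w n)) * g s) \<le> exp (- a * s) * K" for n
  proof (rule AE_I2)
    fix s assume "s \<in> space lborel_pos" then have s: "s > 0" by simp
    have "norm (exp (- (of_real s * w n))) \<le> exp (- a * s)"
      using mult_left_mono[OF w(2)[of n], of s] s by (simp add: norm_exp_eq_Re mult.commute)
    then show "norm (exp (- (of_real s * w n)) * g s) \<le> exp (- a * s) * K"
      unfolding norm_mult using g(2)[OF s] by (intro mult_mono) auto
  qed
  note [measurable] = g(1)
  show "(\<lambda>s. exp (- (of_real s * w n)) * g s) \<in> borel_measurable lborel_pos" for n by measurable
  show "(\<lambda>s. exp (- (of_real s * w0)) * g s) \<in> borel_measurable lborel_pos" by measurable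
qed

lemma laplace_integrable:
  fixes g :: "real \<Rightarrow> complex"
  assumes g: "g \<in> borel_measurable lborel_pos" "\<And>s. s > 0 \<Longrightarrow> norm (g s) \<le> K" and w: "Re w > 0"
  shows "integrable lborel_pos (\<lambda>s. exp (- (of_real s * w)) * g s)"
proof (rule lborel_pos_integrable_bound[where g="\<lambda>s. exp (- Re w * s) * K"])
  show "integrable lborel_pos (\<lambda>s. exp (- Re w * s) * K)" by (intro integrable_mult_left exp_lborel_pos w)
  note [measurable] = g(1)
  show "(\<lambda>s. exp (- (of_real s * w)) * g s) \<in> borel_measurable lborel_pos" by measurable
  show "norm (exp (- (of_real s * w)) * g s) \<le> exp (- Re w * s) * K" if "s > 0" for s
    unfolding norm_mult using g(2)[OF that] by (intro mult_mono) (auto simp: norm_exp_eq_Re mult.commute)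
qed

text \<open>For \<open>v\<close> in the open second quadrant, \<open>Re (t v) \<le> - m * norm t\<close> on the whole closed first quadrant, with \<open>m\<close> the smaller
of \<open>- Re v\<close> and \<open>Im v\<close>.\<close>
lemma rotate_exp:
  assumes N: "continuous_on quadrant N" "N holomorphic_on interior quadrant" "\<And>t. t \<in> quadrant \<Longrightarrow> norm (N t) \<le> symbol_const / (1 + norm t)"
    and v: "Re v < 0" "Im v > 0"
  shows "(\<integral>s. exp (of_real s * v) * N (of_real s) \<partial>lborel_pos) = \<i> * (\<integral>s. exp (of_real s * \<i> * v) * N (of_real s * \<i>) \<partial>lborel_pos)"
proof -
  let ?f = "\<lambda>t. exp (t * v) * N t"
  define m where "m = min (- Re v) (Im v)"
  have m: "m > 0" using v by (simp add: m_def)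
  have c: "continuous_on quadrant ?f" by (intro continuous_intros N)
  have h: "?f holomorphic_on interior quadrant" by (intro holomorphic_intros N)
  obtain K where K: "K \<ge> 0" "\<And>t. t \<in> quadrant \<Longrightarrow> norm (?f t) \<le> K / (1 + (norm t)\<^sup>2)"
  proof (rule quadrant_bound[OF c, where R=1 and w="\<lambda>t. 1 + (norm t)\<^sup>2" and C="4 * symbol_const / m\<^sup>2"])
    fix t assume t: "t \<in> quadrant" "norm t \<ge> 1"
    let ?r = "norm t"
    have "norm t \<le> Re t + Im t" using cmod_le[of t] t by (simp add: quadrant_def)
    then have "m * ?r \<le> m * (Re t + Im t)" using m by (simp add: mult_left_mono)
    also have "\<dots> \<le> - Re v * Re t + Im v * Im t"
      unfolding distrib_left using t v by (intro add_mono mult_right_mono) (auto simp: m_def quadrant_def)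
    finally have "Re (t * v) \<le> - (m * ?r)" by (simp add: algebra_simps)
    then have "norm (exp (t * v)) \<le> exp (- (m * ?r))" by (simp add: norm_exp_eq_Re)
    also have "\<dots> \<le> 4 / (m\<^sup>2 * (1 + ?r\<^sup>2))"
    proof -
      have u: "m * ?r \<ge> 0" using m by simp
      have "(m * ?r)\<^sup>2 / 2 \<le> exp (m * ?r)"
        using exp_lower_Taylor_quadratic[OF u] u by simp
      moreover have "1 + ?r\<^sup>2 \<le> 2 * ?r\<^sup>2" using power_mono[OF t(2), of 2] by simp
      then have "m\<^sup>2 * (1 + ?r\<^sup>2) \<le> m\<^sup>2 * (2 * ?r\<^sup>2)" using m by (intro mult_left_mono) auto
      ultimately have "m\<^sup>2 * (1 + ?r\<^sup>2) \<le> 4 * exp (m * ?r)" by (simp add: power_mult_distrib)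
      then have "4 / (4 * exp (m * ?r)) \<le> 4 / (m\<^sup>2 * (1 + ?r\<^sup>2))" 
        using m one_plus_norm_sq_pos[of t] by (intro divide_left_mono) auto
      then show ?thesis by (simp add: exp_minus inverse_eq_divide)
    qed
    finally have 1: "norm (exp (t * v)) \<le> 4 / (m\<^sup>2 * (1 + ?r\<^sup>2))" .
    have "norm (N t) \<le> symbol_const / (1 + ?r)" by (rule N(3)[OF t(1)])
    also have "\<dots> \<le> symbol_const / 1" using symbol_const_bound(1) by (intro divide_left_mono) (auto simp: add_pos_nonneg)
    finally have "norm (?f t) \<le> 4 / (m\<^sup>2 * (1 + ?r\<^sup>2)) * symbol_const" unfolding norm_mult using 1 symbol_const_bound(1)
      by (intro mult_mono) (auto intro: order_trans[OF norm_ge_zero])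
    then show "norm (?f t) \<le> 4 * symbol_const / m\<^sup>2 / (1 + ?r\<^sup>2)" by simp
  qed (auto intro!: continuous_intros one_plus_norm_sq_pos)
  show ?thesis using rotate_quadrant[OF c h K(2)] by simp
qed

text \<open>For \<open>w\<close> in the first quadrant, \<open>exp (t w)\<close> decays along all rays of the second quadrant; rotate from the positive
imaginary to the negative real axis.\<close>
lemma fourier_ext_right:
  assumes "Re w > 0" "Im w > 0"
  shows "fourier_ext w = \<i> * (\<integral>s. exp (- (of_real s * w)) * symbol2 (of_real s * \<i>) \<partial>lborel_pos)"
proof -
  have a: "- (of_real s * (- \<i> * w)) = of_real s * (\<i> * w)" for s by simp
  have b: "of_real s * \<i> * (\<i> * w) = - (of_real s * w)" for s by (simp add: complex_eq_iff)
  show ?thesis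
    using rotate_exp[OF symbol2_regular symbol_const_bound(3), of "\<i> * w"] assms unfolding fourier_ext_def a b by simp
qed

text \<open>For \<open>w\<close> in the second quadrant, \<open>exp (t w)\<close> decays along all rays of the first quadrant; rotate from the positive
imaginary to the positive real axis.\<close>
lemma fourier_ext_left:
  assumes "Re w < 0" "Im w > 0"
  shows "\<i> * fourier_ext w = (\<integral>s. exp (- (of_real s * (-w))) * symbol1 (of_real s) \<partial>lborel_pos)"
proof -
  have "(\<integral>s. exp (of_real s * \<i> * w) * symbol1 (of_real s * \<i>) \<partial>lborel_pos) = fourier_ext w"
    unfolding fourier_ext_def
  proof (rule integral_cong_AE)
    show "(\<lambda>s. exp (of_real s * \<i> * w) * symbol1 (of_real s * \<i>)) \<in> borel_measurable lborel_pos"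
      by (intro continuous_on_measurable_lborel_pos continuous_on_mult continuous_on_compose2[OF symbol1_regular(1)] continuous_intros)
         (use quadrant_ray in auto)
    note [measurable] = symbol_measurable_rays(1)
    show "(\<lambda>s. exp (- (of_real s * (- \<i> * w))) * symbol2 (of_real s)) \<in> borel_measurable lborel_pos" by measurable
    from AE_lborel_pos_neq[of 1] AE_space[of lborel_pos]
    show "AE s in lborel_pos. exp (of_real s * \<i> * w) * symbol1 (of_real s * \<i>) = exp (- (of_real s * (- \<i> * w))) * symbol2 (of_real s)"
      by eventually_elim (simp add: symbols_agree mult.assoc)
  qed
  then show ?thesis using rotate_exp[OF symbol1_regular symbol_const_bound(2), of w] assms by simp
qed

text \<open>With \<open>exp (- u) \<le> 1 / sqrt u\<close> the decay of the density is traded for an integrable singularity in \<open>Re w\<close>.\<close>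
lemma laplace_bound:
  fixes g :: "real \<Rightarrow> complex"
  assumes g: "g \<in> borel_measurable lborel_pos" "\<And>s. s > 0 \<Longrightarrow> norm (g s) \<le> symbol_const / (1 + s)" and w: "Re w > 0"
  shows "norm (\<integral>s. exp (- (of_real s * w)) * g s \<partial>lborel_pos) \<le> symbol_const * (\<integral>s. 1 / (sqrt s * (1 + s)) \<partial>lborel_pos) / sqrt (Re w)"
proof -
  have "norm (\<integral>s. exp (- (of_real s * w)) * g s \<partial>lborel_pos) \<le> (\<integral>s. (symbol_const / sqrt (Re w)) * (1 / (sqrt s * (1 + s))) \<partial>lborel_pos)"
  proof (rule Bochner_Integration.integral_norm_bound_integral)
    have "norm (g s) \<le> symbol_const" if "s > 0" for s
      using g(2)[OF that] divide_left_mono[of 1 "1 + s" symbol_const] symbol_const_bound(1) that by simp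
    then show "integrable lborel_pos (\<lambda>s. exp (- (of_real s * w)) * g s)"
      by (intro laplace_integrable[OF g(1) _ w])
    show "integrable lborel_pos (\<lambda>s. (symbol_const / sqrt (Re w)) * (1 / (sqrt s * (1 + s))))"
      by (intro integrable_mult_right integrable_recip_sqrt)
    fix s assume "s \<in> space lborel_pos" then have s: "s > 0" by simp
    have "norm (exp (- (of_real s * w))) = exp (- (s * Re w))" by (simp add: norm_exp_eq_Re)
    also have "\<dots> \<le> 1 / sqrt (s * Re w)"
    proof -
      have sw: "s * Re w > 0" using s w by simp
      have "sqrt (s * Re w) \<le> exp (s * Re w)"
      proof -
        have "u \<le> (1 + u)\<^sup>2" if "u > 0" for u :: real 
          using that zero_le_power2[of u] by (simp add: power2_sum)
        then have "sqrt (s * Re w) \<le> 1 + s * Re w"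
          using sw by (intro real_le_lsqrt) auto
        also have "\<dots> \<le> exp (s * Re w)" by (rule exp_ge_add_one_self)
        finally show ?thesis .
      qed
      then show ?thesis using sw by (simp add: exp_minus field_simps)
    qed
    finally have "norm (exp (- (of_real s * w)) * g s) \<le> (1 / sqrt (s * Re w)) * (symbol_const / (1 + s))"
      unfolding norm_mult using g(2)[OF s] s w by (intro mult_mono) auto
    also have "\<dots> = (symbol_const / sqrt (Re w)) * (1 / (sqrt s * (1 + s)))" by (simp add: real_sqrt_mult)
    finally show "norm (exp (- (of_real s * w)) * g s) \<le> (symbol_const / sqrt (Re w)) * (1 / (sqrt s * (1 + s)))" .
  qed
  then show ?thesis unfolding Bochner_Integration.integral_mult_right_zero by simp
qed

definition fourier_ext_const :: real where "fourier_ext_const = symbol_const * (\<integral>s. 1 / (sqrt s * (1 + s)) \<partial>lborel_pos)"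

lemma fourier_ext_bound: assumes "Re w \<noteq> 0" "Im w > 0" shows "norm (fourier_ext w) \<le> fourier_ext_const / sqrt \<bar>Re w\<bar>"
proof (cases "Re w > 0")
  case True
  then show ?thesis using laplace_bound[OF symbol_measurable_rays(2) symbol_decay_rays(2) True] fourier_ext_right[OF True assms(2)]
    by (simp add: norm_mult fourier_ext_const_def)
next
  case False
  then have l: "Re w < 0" "Re (-w) > 0" using assms by auto
  have "norm (fourier_ext w) = norm (\<i> * fourier_ext w)" by (simp add: norm_mult)
  then show ?thesis using laplace_bound[OF symbol_measurable_rays(3) symbol_decay_rays(3) l(2)] fourier_ext_left[OF l(1) assms(2)] l
    by (simp add: fourier_ext_const_def)
qed

lemma symbol_le_const:
  assumes s: "s > 0"
  shows "norm (symbol2 (of_real s)) \<le> symbol_const" "norm (symbol2 (of_real s * \<i>)) \<le> symbol_const" "norm (symbol1 (of_real s)) \<le> symbol_const"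
proof -
  have "symbol_const / (1 + s) \<le> symbol_const / 1" using s symbol_const_bound(1) by (intro divide_left_mono) auto
  then have "symbol_const / (1 + s) \<le> symbol_const" by simp
  then show "norm (symbol2 (of_real s)) \<le> symbol_const" "norm (symbol2 (of_real s * \<i>)) \<le> symbol_const" "norm (symbol1 (of_real s)) \<le> symbol_const"
    using symbol_decay_rays[OF s] by linarith+
qed

text \<open>The Poisson semigroup multiplies \<open>exp (\<i> s z)\<close> by \<open>exp (- s y)\<close>, and so does raising the imaginary part of the
argument by \<open>y\<close>.\<close>
lemma fourier_ext_semigroup:
  assumes y: "y > 0" and y0: "y0 > 0"
  shows "integrable lborel (\<lambda>z. of_real (cauchy_kernel y (z - x)) * fourier_ext (of_real z + \<i> * of_real y0))"
    and "(\<integral>z. of_real (cauchy_kernel y (z - x)) * fourier_ext (of_real z + \<i> * of_real y0) \<partial>lborel) = fourier_ext (of_real x + \<i> * of_real (y + y0))"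
proof -
  note [measurable] = symbol_measurable_rays(1)
  let ?F = "\<lambda>s z. of_real (cauchy_kernel y (z - x)) * (exp (- (of_real s * (- \<i> * (of_real z + \<i> * of_real y0)))) * symbol2 (of_real s)) :: complex"
  have nF: "norm (?F s z) = cauchy_kernel y (z - x) * (exp (- (y0 * s)) * norm (symbol2 (of_real s)))" for s z
    using cauchy_kernel_pos[OF y, of "z - x"] by (simp add: norm_mult norm_exp_eq_Re mult.commute)
  have int: "integrable (lborel_pos \<Otimes>\<^sub>M lborel) (case_prod ?F)"
  proof (rule pos_line.Fubini_integrable)
    show "case_prod ?F \<in> borel_measurable (lborel_pos \<Otimes>\<^sub>M lborel)" by measurable
    show "integrable lborel_pos (\<lambda>s. \<integral>z. norm (case_prod ?F (s, z)) \<partial>lborel)"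
    proof -
      have "(\<lambda>s. \<integral>z. norm (case_prod ?F (s, z)) \<partial>lborel) = (\<lambda>s. (\<integral>z. cauchy_kernel y (z - x) \<partial>lborel) * (exp (- (y0 * s)) * norm (symbol2 (of_real s))))"
        by (simp only: case_prod_conv nF Bochner_Integration.integral_mult_left_zero)
      moreover have "integrable lborel_pos (\<lambda>s. exp (- (y0 * s)) * norm (symbol2 (of_real s)))"
      proof (rule lborel_pos_integrable_bound[where g="\<lambda>s. exp (- y0 * s) * symbol_const"])
        show "integrable lborel_pos (\<lambda>s. exp (- y0 * s) * symbol_const)" by (intro integrable_mult_left exp_lborel_pos y0)
      qed (auto intro!: mult_mono symbol_le_const)
      ultimately show ?thesis by simp
    qed
    show "AE s in lborel_pos. integrable lborel (\<lambda>z. case_prod ?F (s, z))"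
    proof (rule AE_I2)
      fix s
      have "integrable lborel (\<lambda>z. cauchy_kernel y (z - x) * (exp (- (y0 * s)) * norm (symbol2 (of_real s))))"
        by (intro integrable_mult_left cauchy_kernel_integrable y)
      then show "integrable lborel (\<lambda>z. case_prod ?F (s, z))"
      proof (rule Bochner_Integration.integrable_bound)
        show "(\<lambda>z. case_prod ?F (s, z)) \<in> borel_measurable lborel"
          unfolding case_prod_conv by measurable
        show "AE z in lborel. norm (case_prod ?F (s, z)) \<le> norm (cauchy_kernel y (z - x) * (exp (- (y0 * s)) * norm (symbol2 (of_real s))))"
          by (rule AE_I2) (simp only: case_prod_conv nF real_norm_def abs_ge_self)
      qed
    qed
  qed
  have e: "(\<lambda>z. \<integral>s. ?F s z \<partial>lborel_pos) = (\<lambda>z. of_real (cauchy_kernel y (z - x)) * fourier_ext (of_real z + \<i> * of_real y0))"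
    unfolding fourier_ext_def Bochner_Integration.integral_mult_right_zero ..
  show "integrable lborel (\<lambda>z. of_real (cauchy_kernel y (z - x)) * fourier_ext (of_real z + \<i> * of_real y0))"
    using pos_line.integrable_snd[OF int] unfolding e .
  have "(\<integral>z. (\<integral>s. ?F s z \<partial>lborel_pos) \<partial>lborel) = (\<integral>s. (\<integral>z. ?F s z \<partial>lborel) \<partial>lborel_pos)"
    by (rule pos_line.Fubini_integral[OF int])
  also have "\<dots> = fourier_ext (of_real x + \<i> * of_real (y + y0))"
    unfolding fourier_ext_def
  proof (rule Bochner_Integration.integral_cong[OF refl])
    fix s assume "s \<in> space lborel_pos" then have s: "s \<ge> 0" by simp
    have ee: "exp (- (of_real s * (- \<i> * (of_real z + \<i> * of_real y0)))) = exp (- of_real (s * y0)) * exp (\<i> * of_real (s * z))" for z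
      unfolding exp_add[symmetric] by (rule arg_cong[where f=exp]) (simp add: complex_eq_iff)
    have "(\<integral>z. ?F s z \<partial>lborel) = (\<integral>z. (exp (- of_real (s * y0)) * symbol2 (of_real s)) * (of_real (cauchy_kernel y (z - x)) * exp (\<i> * of_real (s * z))) \<partial>lborel)"
      unfolding ee by (intro Bochner_Integration.integral_cong refl) (simp only: mult_ac)
    also have "\<dots> = (exp (- of_real (s * y0)) * symbol2 (of_real s)) * exp (\<i> * of_real (s * x) - of_real (s * y))"
      unfolding Bochner_Integration.integral_mult_right_zero cauchy_charfn[OF y s] ..
    also have "\<dots> = (exp (- of_real (s * y0)) * exp (\<i> * of_real (s * x) - of_real (s * y))) * symbol2 (of_real s)" by (simp only: mult_ac)
    also have "exp (- of_real (s * y0)) * exp (\<i> * of_real (s * x) - of_real (s * y)) = exp (- (of_real s * (- \<i> * (of_real x + \<i> * of_real (y + y0)))))"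
      unfolding exp_add[symmetric] by (rule arg_cong[where f=exp]) (simp add: complex_eq_iff algebra_simps)
    finally show "(\<integral>z. ?F s z \<partial>lborel) = exp (- (of_real s * (- \<i> * (of_real x + \<i> * of_real (y + y0))))) * symbol2 (of_real s)" .
  qed
  finally show "(\<integral>z. of_real (cauchy_kernel y (z - x)) * fourier_ext (of_real z + \<i> * of_real y0) \<partial>lborel) = fourier_ext (of_real x + \<i> * of_real (y + y0))"
    unfolding e .
qed

section \<open>The Poisson extension of the eigenfunction\<close>

text \<open>Quantifies that the kernel decays, so that it may be integrated against \<open>1 / sqrt \<bar>z\<bar>\<close>.\<close>
lemma cauchy_kernel_weight:
  assumes y: "y > 0"
  shows "cauchy_kernel y (z - x) * (1 + \<bar>z\<bar>) \<le> (1 + \<bar>x\<bar>) / y + 1"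
proof -
  let ?u = "z - x"
  have d: "y\<^sup>2 + ?u\<^sup>2 > 0" using y by (simp add: add_pos_nonneg)
  have 1: "y / (y\<^sup>2 + ?u\<^sup>2) \<le> 1 / y" using y d by (simp add: divide_simps power2_eq_square)
  have 2: "y / (y\<^sup>2 + ?u\<^sup>2) * \<bar>?u\<bar> \<le> 1"
  proof -
    have "0 \<le> (y - \<bar>?u\<bar>)\<^sup>2" by simp
    then have "2 * (y * \<bar>?u\<bar>) \<le> y\<^sup>2 + ?u\<^sup>2" by (simp add: power2_diff algebra_simps)
    then have "y * \<bar>?u\<bar> \<le> y\<^sup>2 + ?u\<^sup>2" using y by (smt (verit) abs_ge_zero mult_nonneg_nonneg)
    then show ?thesis using d by (simp add: pos_divide_le_eq)
  qed
  have "cauchy_kernel y ?u * (1 + \<bar>z\<bar>) \<le> y / (y\<^sup>2 + ?u\<^sup>2) * (1 + \<bar>z\<bar>)"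
  proof (rule mult_right_mono)
    have "1 / pi * (y / (y\<^sup>2 + ?u\<^sup>2)) \<le> 1 * (y / (y\<^sup>2 + ?u\<^sup>2))"
      using y d pi_gt3 by (intro mult_right_mono) auto
    then show "cauchy_kernel y ?u \<le> y / (y\<^sup>2 + ?u\<^sup>2)" by (simp add: cauchy_kernel_def)
  qed simp
  also have "\<dots> \<le> y / (y\<^sup>2 + ?u\<^sup>2) * ((1 + \<bar>x\<bar>) + \<bar>?u\<bar>)"
    using y d by (intro mult_left_mono) auto
  also have "\<dots> = y / (y\<^sup>2 + ?u\<^sup>2) * (1 + \<bar>x\<bar>) + y / (y\<^sup>2 + ?u\<^sup>2) * \<bar>?u\<bar>" by (rule distrib_left)
  also have "\<dots> \<le> 1 / y * (1 + \<bar>x\<bar>) + 1"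
    using 1 2 by (intro add_mono mult_right_mono) auto
  finally show ?thesis by simp
qed

lemma cauchy_kernel_inv_sqrt_integrable:
  assumes y: "y > 0"
  shows "integrable lborel (\<lambda>z. cauchy_kernel y (z - x) * (1 / sqrt \<bar>z\<bar>))"
proof -
  define C where "C = (1 + \<bar>x\<bar>) / y + 1"
  have *: "norm (cauchy_kernel y (v - x) * (1 / sqrt \<bar>v\<bar>)) \<le> C * (1 / (sqrt z * (1 + z)))" if "z > 0" "\<bar>v\<bar> = z" for v z
  proof -
    have "cauchy_kernel y (v - x) * (1 + z) \<le> C" using cauchy_kernel_weight[OF y, of v x] that by (simp add: C_def)
    then have "cauchy_kernel y (v - x) \<le> C / (1 + z)" using that by (simp add: pos_le_divide_eq)
    then have "cauchy_kernel y (v - x) * (1 / sqrt z) \<le> C / (1 + z) * (1 / sqrt z)"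
      using that by (intro mult_right_mono) auto
    then show ?thesis using that cauchy_kernel_pos[OF y, of "v - x"] by (simp add: abs_mult mult.commute)
  qed
  have g: "integrable lborel_pos (\<lambda>z. C * (1 / (sqrt z * (1 + z))))" by (intro integrable_mult_right integrable_recip_sqrt)
  have "integrable lborel_pos (\<lambda>z. cauchy_kernel y (z - x) * (1 / sqrt \<bar>z\<bar>))"
    by (rule lborel_pos_integrable_bound[OF g]) (use * in auto)
  moreover have "integrable lborel_pos (\<lambda>z. cauchy_kernel y (- z - x) * (1 / sqrt \<bar>- z\<bar>))"
    by (rule lborel_pos_integrable_bound[OF g]) (use *[where v="- _"] in auto)
  ultimately show ?thesis by (subst lborel_split(1)) auto
qed

lemma rho_nonneg: "t \<ge> 0 \<Longrightarrow> rho t \<ge> 0" by (simp add: rho_def)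

lemma rho_measurable [measurable]: "rho \<in> borel_measurable borel"
  unfolding rho_def by measurable

lemma rho_coeff: "sqrt 2 / (2 * pi) \<le> 1" "0 \<le> sqrt 2 / (2 * pi)"
proof -
  have "sqrt 2 \<le> 2" using real_sqrt_le_mono[of 2 4] by simp
  then show "sqrt 2 / (2 * pi) \<le> 1" using pi_gt3 by (simp add: divide_le_eq)
qed simp

text \<open>The third bound uses \<open>eta t \<ge> ln t / 2\<close>; it shows that \<open>rho\<close> decays like \<open>t powr (- 3/2)\<close>.\<close>
lemma rho_bounds:
  assumes t: "t > 0"
  shows "rho t \<le> t / (1 + t\<^sup>2)" "rho t / t \<le> 1 / (1 + t\<^sup>2)" "rho t \<le> 2 * (1 / (sqrt t * (1 + t)))"
proof -
  have p: "1 + t\<^sup>2 > 0" by (simp add: add_pos_nonneg)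
  have "rho t \<le> 1 * (t / (1 + t\<^sup>2)) * 1"
    unfolding rho_def using rho_coeff eta_nonneg[OF t] t p by (intro mult_mono) auto
  then show 1: "rho t \<le> t / (1 + t\<^sup>2)" by simp
  show "rho t / t \<le> 1 / (1 + t\<^sup>2)" using divide_right_mono[OF 1, of t] t by simp
  have "exp (- eta t) \<le> exp (- (ln t / 2))" using eta_ge_half_ln[OF t] by simp
  also have "\<dots> = 1 / sqrt t" using t by (simp add: exp_minus ln_sqrt[symmetric] inverse_eq_divide)
  finally have e: "exp (- eta t) \<le> 1 / sqrt t" .
  have "rho t \<le> 1 * (t / (1 + t\<^sup>2)) * (1 / sqrt t)"
    unfolding rho_def using rho_coeff e t p by (intro mult_mono) auto
  also have "\<dots> = (t / (1 + t\<^sup>2)) * (1 / sqrt t)" by simp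
  also have "\<dots> \<le> (2 / (1 + t)) * (1 / sqrt t)"
  proof (rule mult_right_mono)
    have "t * (1 + t) \<le> 2 * (1 + t\<^sup>2)" using zero_le_power2[of "t - 1"] by (simp add: power2_eq_square algebra_simps; sos)
    then show "t / (1 + t\<^sup>2) \<le> 2 / (1 + t)" using t p by (simp add: divide_simps)
  qed (use t in auto)
  finally show "rho t \<le> 2 * (1 / (sqrt t * (1 + t)))" by (simp add: mult.commute)
qed

lemma integrable_rho: "integrable lborel_pos rho"
proof (rule lborel_pos_integrable_bound[where g="\<lambda>t. 2 * (1 / (sqrt t * (1 + t)))"])
  show "integrable lborel_pos (\<lambda>t. 2 * (1 / (sqrt t * (1 + t))))"
    by (intro integrable_mult_right integrable_recip_sqrt)
qed (use rho_bounds(3) rho_nonneg in \<open>auto intro!: borel_measurable_lborel_pos\<close>)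

lemma r_fun_eq: "r_fun x = (\<integral>t. rho t * exp (- t * x) \<partial>lborel_pos)"
proof -
  have "(\<integral>t. rho t * exp (- t * x) \<partial>lborel_pos) = (\<integral>t. sqrt 2 / (2 * pi) * (t / (1 + t\<^sup>2) * exp (- eta t) * exp (- t * x)) \<partial>lborel_pos)"
    by (intro Bochner_Integration.integral_cong refl) (simp add: rho_def)
  also have "\<dots> = r_fun x"
    unfolding Bochner_Integration.integral_mult_right_zero r_fun_def eta_def integral_lborel_pos by simp
  finally show ?thesis by simp
qed

lemma r_fun_measurable [measurable]: "r_fun \<in> borel_measurable borel"
  unfolding r_fun_eq[abs_def] by measurable

lemma integrable_r_integrand: "x \<ge> 0 \<Longrightarrow> integrable lborel_pos (\<lambda>t. rho t * exp (- t * x))"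
  by (rule lborel_pos_integrable_bound[OF integrable_rho]) (use rho_nonneg in \<open>auto simp: mult_left_le intro!: borel_measurable_lborel_pos\<close>)

lemma r_fun_bounds: "x \<ge> 0 \<Longrightarrow> 0 \<le> r_fun x" "x \<ge> 0 \<Longrightarrow> r_fun x \<le> (\<integral>t. rho t \<partial>lborel_pos)"
proof -
  assume x: "x \<ge> 0"
  show "0 \<le> r_fun x" unfolding r_fun_eq by (rule Bochner_Integration.integral_nonneg) (use rho_nonneg in auto)
  show "r_fun x \<le> (\<integral>t. rho t \<partial>lborel_pos)" unfolding r_fun_eq
    by (rule integral_mono[OF integrable_r_integrand[OF x] integrable_rho]) (use x rho_nonneg in \<open>auto simp: mult_left_le\<close>)
qed

text \<open>Apply the Poisson kernel at height \<open>y\<close> to \<open>Re F\<close> at height \<open>e n\<close> and let \<open>e n\<close> tend to \<open>0\<close>. By the two rotations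
\<open>Re F\<close> converges to \<open>\<pi> r\<close> on the right and to \<open>0\<close> on the left, with the common majorant \<open>C / sqrt \<bar>z\<bar>\<close>.\<close>
lemma poisson_r:
  assumes y: "y > 0"
  shows "(\<integral>z. cauchy_kernel y (z - x) * r_fun z \<partial>lborel_pos) = (1/pi) * Re (fourier_ext (of_real x + \<i> * of_real y))"
proof -
  define e where "e n = inverse (real (Suc n))" for n
  have e0: "e n > 0" for n by (simp add: e_def)
  have elim: "e \<longlonglongrightarrow> 0" unfolding e_def by (rule LIMSEQ_inverse_real_of_nat)
  define g where "g z = (if z > 0 then pi * r_fun z else 0)" for z
  have gm [measurable]: "g \<in> borel_measurable borel" unfolding g_def by measurable
  let ?L = "\<lambda>n z. cauchy_kernel y (z - x) * Re (fourier_ext (of_real z + \<i> * of_real (e n)))"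
  have ReL: "?L n z = Re (of_real (cauchy_kernel y (z - x)) * fourier_ext (of_real z + \<i> * of_real (e n)))" for n z by simp
  have intL: "integrable lborel (?L n)" for n
    unfolding ReL by (intro integrable_Re fourier_ext_semigroup(1) y e0)
  have L: "(\<integral>z. ?L n z \<partial>lborel) = Re (fourier_ext (of_real x + \<i> * of_real (y + e n)))" for n
    unfolding ReL using integral_Re[OF fourier_ext_semigroup(1)[OF y e0[of n], of x]] fourier_ext_semigroup(2)[OF y e0[of n], of x] by simp
  have lim1: "(\<lambda>n. \<integral>z. ?L n z \<partial>lborel) \<longlonglongrightarrow> (\<integral>z. cauchy_kernel y (z - x) * g z \<partial>lborel)"
  proof (rule integral_dominated_convergence[where w="\<lambda>z. fourier_ext_const * (cauchy_kernel y (z - x) * (1 / sqrt \<bar>z\<bar>))"])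
    show "integrable lborel (\<lambda>z. fourier_ext_const * (cauchy_kernel y (z - x) * (1 / sqrt \<bar>z\<bar>)))"
      by (intro integrable_mult_right cauchy_kernel_inv_sqrt_integrable y)
    show "?L n \<in> borel_measurable lborel" for n using intL by (rule borel_measurable_integrable)
    show "AE z in lborel. norm (?L n z) \<le> fourier_ext_const * (cauchy_kernel y (z - x) * (1 / sqrt \<bar>z\<bar>))" for n
      using AE_lborel_singleton[of "0::real"]
    proof eventually_elim
      fix z :: real assume z: "z \<noteq> 0"
      have "\<bar>Re (fourier_ext (of_real z + \<i> * of_real (e n)))\<bar> \<le> fourier_ext_const / sqrt \<bar>z\<bar>"
        using fourier_ext_bound[of "of_real z + \<i> * of_real (e n)"] abs_Re_le_cmod[of "fourier_ext (of_real z + \<i> * of_real (e n))"] z e0[of n] by simp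
      then have "cauchy_kernel y (z - x) * \<bar>Re (fourier_ext (of_real z + \<i> * of_real (e n)))\<bar> \<le> cauchy_kernel y (z - x) * (fourier_ext_const / sqrt \<bar>z\<bar>)"
        using cauchy_kernel_pos[OF y, of "z - x"] by (intro mult_left_mono) auto
      then show "norm (?L n z) \<le> fourier_ext_const * (cauchy_kernel y (z - x) * (1 / sqrt \<bar>z\<bar>))"
        using cauchy_kernel_pos[OF y, of "z - x"] by (simp add: abs_mult mult.commute)
    qed
    show "AE z in lborel. (\<lambda>n. ?L n z) \<longlonglongrightarrow> cauchy_kernel y (z - x) * g z"
      using AE_lborel_singleton[of "0::real"]
    proof eventually_elim
      fix z :: real assume z: "z \<noteq> 0"
      have "(\<lambda>n. Re (fourier_ext (of_real z + \<i> * of_real (e n)))) \<longlonglongrightarrow> g z"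
      proof (cases "z > 0")
        case True
        have "(\<lambda>n. of_real z + \<i> * of_real (e n)) \<longlonglongrightarrow> of_real z + \<i> * of_real 0"
          by (intro tendsto_intros elim)
        then have w: "(\<lambda>n. of_real z + \<i> * of_real (e n)) \<longlonglongrightarrow> of_real z" by simp
        have "(\<lambda>n. \<i> * (\<integral>s. exp (- (of_real s * (of_real z + \<i> * of_real (e n)))) * symbol2 (of_real s * \<i>) \<partial>lborel_pos)) \<longlonglongrightarrow> \<i> * (\<integral>s. exp (- (of_real s * of_real z)) * symbol2 (of_real s * \<i>) \<partial>lborel_pos)"
          by (intro tendsto_mult tendsto_const laplace_tendsto[OF symbol_measurable_rays(2) symbol_le_const(2) True w]) auto
        then have l: "(\<lambda>n. Re (fourier_ext (of_real z + \<i> * of_real (e n)))) \<longlonglongrightarrow> Re (\<i> * (\<integral>s. exp (- (of_real s * of_real z)) * symbol2 (of_real s * \<i>) \<partial>lborel_pos))"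
          using True e0 by (intro tendsto_Re) (simp add: fourier_ext_right)
        have int: "integrable lborel_pos (\<lambda>s. exp (- (of_real s * of_real z)) * symbol2 (of_real s * \<i>))"
          by (rule laplace_integrable[OF symbol_measurable_rays(2) symbol_le_const(2)]) (use True in auto)
        have "Re (\<i> * (\<integral>s. exp (- (of_real s * of_real z)) * symbol2 (of_real s * \<i>) \<partial>lborel_pos)) = - (\<integral>s. Im (exp (- (of_real s * of_real z)) * symbol2 (of_real s * \<i>)) \<partial>lborel_pos)"
          using integral_Im[OF int] by simp
        also have "\<dots> = - (\<integral>s. - pi * (rho s * exp (- s * z)) \<partial>lborel_pos)"
        proof (intro arg_cong[where f=uminus] Bochner_Integration.integral_cong refl)
          fix s assume "s \<in> space lborel_pos" then have s: "s > 0" by simp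
          have "exp (- (of_real s * of_real z)) = complex_of_real (exp (- (s * z)))" by (simp add: exp_of_real[symmetric])
          then show "Im (exp (- (of_real s * of_real z)) * symbol2 (of_real s * \<i>)) = - pi * (rho s * exp (- s * z))"
            using symbol2_imag(1)[OF s] by simp
        qed
        also have "\<dots> = pi * r_fun z" unfolding Bochner_Integration.integral_mult_right_zero r_fun_eq by simp
        finally show ?thesis using l True by (simp add: g_def)
      next
        case False
        then have zn: "- z > 0" using z by simp
        have "(\<lambda>n. - (of_real z + \<i> * of_real (e n))) \<longlonglongrightarrow> - (of_real z + \<i> * of_real 0)"
          by (intro tendsto_intros elim)
        then have w: "(\<lambda>n. - (of_real z + \<i> * of_real (e n))) \<longlonglongrightarrow> of_real (-z)" by simp
        have "(\<lambda>n. - \<i> * (\<integral>s. exp (- (of_real s * (- (of_real z + \<i> * of_real (e n))))) * symbol1 (of_real s) \<partial>lborel_pos)) \<longlonglongrightarrow> - \<i> * (\<integral>s. exp (- (of_real s * of_real (-z))) * symbol1 (of_real s) \<partial>lborel_pos)"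
          by (intro tendsto_mult tendsto_const laplace_tendsto[OF symbol_measurable_rays(3) symbol_le_const(3) zn w]) auto
        note lim = this
        have Jw: "fourier_ext w = - \<i> * (\<integral>s. exp (- (of_real s * (-w))) * symbol1 (of_real s) \<partial>lborel_pos)" if "Re w < 0" "Im w > 0" for w
        proof -
          have "fourier_ext w = - \<i> * (\<i> * fourier_ext w)" by simp
          then show ?thesis unfolding fourier_ext_left[OF that] .
        qed
        have "fourier_ext (of_real z + \<i> * of_real (e n)) = - \<i> * (\<integral>s. exp (- (of_real s * (- (of_real z + \<i> * of_real (e n))))) * symbol1 (of_real s) \<partial>lborel_pos)" for n
          by (rule Jw) (use zn e0 in auto)
        then have l: "(\<lambda>n. Re (fourier_ext (of_real z + \<i> * of_real (e n)))) \<longlonglongrightarrow> Re (- \<i> * (\<integral>s. exp (- (of_real s * of_real (-z))) * symbol1 (of_real s) \<partial>lborel_pos))"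
          using tendsto_Re[OF lim] by (simp only:)
        have int: "integrable lborel_pos (\<lambda>s. exp (- (of_real s * of_real (-z))) * symbol1 (of_real s))"
          by (rule laplace_integrable[OF symbol_measurable_rays(3) symbol_le_const(3)]) (use zn in auto)
        have "Re (- \<i> * (\<integral>s. exp (- (of_real s * of_real (-z))) * symbol1 (of_real s) \<partial>lborel_pos)) = (\<integral>s. Im (exp (- (of_real s * of_real (-z))) * symbol1 (of_real s)) \<partial>lborel_pos)"
          using integral_Im[OF int] by simp
        also have "\<dots> = (\<integral>s. 0 \<partial>lborel_pos)"
        proof (intro Bochner_Integration.integral_cong refl)
          fix s assume "s \<in> space lborel_pos" then have s: "s > 0" by simp
          have "exp (- (of_real s * of_real (-z))) = complex_of_real (exp (s * z))" by (simp add: exp_of_real[symmetric])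
          then show "Im (exp (- (of_real s * of_real (-z))) * symbol1 (of_real s)) = 0"
            using symbol1_real[OF s] by simp
        qed
        finally show ?thesis using l False by (simp add: g_def)
      qed
      then show "(\<lambda>n. ?L n z) \<longlonglongrightarrow> cauchy_kernel y (z - x) * g z" by (intro tendsto_intros)
    qed
  qed (use gm in measurable)
  have lim2: "(\<lambda>n. \<integral>z. ?L n z \<partial>lborel) \<longlonglongrightarrow> Re (fourier_ext (of_real x + \<i> * of_real y))"
    unfolding L
  proof (rule tendsto_Re)
    have "(\<lambda>n. - \<i> * (of_real x + \<i> * of_real (y + e n))) \<longlonglongrightarrow> - \<i> * (of_real x + \<i> * of_real (y + 0))"
      by (intro tendsto_intros elim)
    then have w: "(\<lambda>n. - \<i> * (of_real x + \<i> * of_real (y + e n))) \<longlonglongrightarrow> - \<i> * (of_real x + \<i> * of_real y)" by simp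
    show "(\<lambda>n. fourier_ext (of_real x + \<i> * of_real (y + e n))) \<longlonglongrightarrow> fourier_ext (of_real x + \<i> * of_real y)"
      unfolding fourier_ext_def by (rule laplace_tendsto[OF symbol_measurable_rays(1) symbol_le_const(1) y w]) (use e0 in \<open>auto intro: less_imp_le\<close>)
  qed
  have "Re (fourier_ext (of_real x + \<i> * of_real y)) = (\<integral>z. cauchy_kernel y (z - x) * g z \<partial>lborel)"
    by (rule LIMSEQ_unique[OF lim2 lim1])
  also have "\<dots> = (\<integral>z. pi * (cauchy_kernel y (z - x) * r_fun z) \<partial>lborel_pos)"
    unfolding integral_lborel_pos set_lebesgue_integral_def
    by (intro Bochner_Integration.integral_cong refl) (simp add: g_def)
  also have "\<dots> = pi * (\<integral>z. cauchy_kernel y (z - x) * r_fun z \<partial>lborel_pos)" by (rule Bochner_Integration.integral_mult_right_zero)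
  finally show ?thesis by simp
qed

text \<open>The closed form of \<open>\<pi>\<close> times the Poisson integral of \<open>r\<close>.\<close>
lemma Re_fourier_ext_right:
  assumes x: "x > 0" and y: "y > 0"
  shows "integrable lborel_pos (\<lambda>t. exp (- t * x) * (pi * rho t * cos (t * y) + sin (t * y) * ((cos (pi/8) - t * sin (pi/8)) / (1 + t\<^sup>2) - pi * rho t / t)))"
    and "Re (fourier_ext (of_real x + \<i> * of_real y)) = (\<integral>t. exp (- t * x) * (pi * rho t * cos (t * y) + sin (t * y) * ((cos (pi/8) - t * sin (pi/8)) / (1 + t\<^sup>2) - pi * rho t / t)) \<partial>lborel_pos)"
      (is "_ = (\<integral>t. ?f t \<partial>lborel_pos)")
proof -
  let ?w = "of_real x + \<i> * of_real y"
  let ?g = "\<lambda>s. exp (- (of_real s * ?w)) * symbol2 (of_real s * \<i>)"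
  have int: "integrable lborel_pos ?g"
    by (rule laplace_integrable[OF symbol_measurable_rays(2) symbol_le_const(2)]) (use x in auto)
  have eq: "- Im (?g s) = ?f s" if "s \<in> space lborel_pos" for s
  proof -
    have s: "s > 0" using that by simp
    have "exp (- (of_real s * ?w)) = of_real (exp (- s * x)) * cis (- (s * y))"
      by (simp add: exp_eq_polar)
    then have "Im (?g s) = exp (- s * x) * (cos (s * y) * Im (symbol2 (of_real s * \<i>)) - sin (s * y) * Re (symbol2 (of_real s * \<i>)))"
      by (simp add: algebra_simps)
    then show ?thesis unfolding symbol2_imag[OF s] by (simp add: algebra_simps)
  qed
  have "integrable lborel_pos (\<lambda>s. - Im (?g s))" by (intro Bochner_Integration.integrable_minus integrable_Im int)
  then show "integrable lborel_pos ?f" by (subst Bochner_Integration.integrable_cong[OF refl eq[symmetric]])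
  have "Re (fourier_ext ?w) = - Im (\<integral>s. ?g s \<partial>lborel_pos)" using fourier_ext_right[of ?w] x y by simp
  also have "\<dots> = (\<integral>s. - Im (?g s) \<partial>lborel_pos)"
    unfolding Bochner_Integration.integral_minus integral_Im[OF int] ..
  also have "\<dots> = (\<integral>t. ?f t \<partial>lborel_pos)" by (rule Bochner_Integration.integral_cong[OF refl eq])
  finally show "Re (fourier_ext ?w) = (\<integral>t. ?f t \<partial>lborel_pos)" .
qed

text \<open>On the right half-line the Poisson kernel is a Laplace transform; this is what allows to express the
contribution of the missing negative half of the sine by integrals of the same type as for \<open>r\<close>.\<close>
lemma cauchy_kernel_laplace:
  assumes "a > 0"
  shows "integrable lborel_pos (\<lambda>t. exp (- (a * t)) * sin (t * y))"
    and "cauchy_kernel y a = (1/pi) * (\<integral>t. exp (- (a * t)) * sin (t * y) \<partial>lborel_pos)"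
proof -
  let ?a = "Complex a (- y)"
  have i: "integrable lborel_pos (\<lambda>s. exp (- ?a * of_real s))" "integral\<^sup>L lborel_pos (\<lambda>s. exp (- ?a * of_real s)) = 1 / ?a"
    by (rule cexp_lborel_pos; use assms in simp)+
  have im: "Im (exp (- ?a * of_real s)) = exp (- (a * s)) * sin (s * y)" for s
    by (simp add: Im_exp mult.commute)
  show "integrable lborel_pos (\<lambda>t. exp (- (a * t)) * sin (t * y))"
    using integrable_Im[OF i(1)] unfolding im .
  have "(\<integral>t. exp (- (a * t)) * sin (t * y) \<partial>lborel_pos) = Im (1 / ?a)"
    using integral_Im[OF i(1)] unfolding im i(2) .
  also have "\<dots> = y / (y\<^sup>2 + a\<^sup>2)" by (simp add: Im_divide power2_eq_square add.commute)
  finally show "cauchy_kernel y a = (1/pi) * (\<integral>t. exp (- (a * t)) * sin (t * y) \<partial>lborel_pos)"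
    by (simp add: cauchy_kernel_def)
qed

lemma laplace_sin:
  assumes "t > 0"
  shows "(\<integral>z. exp (- (t * z)) * sin (c - z) \<partial>lborel_pos) = (t * sin c - cos c) / (1 + t\<^sup>2)"
proof -
  let ?a = "Complex t 1"
  have i: "integrable lborel_pos (\<lambda>s. exp (- ?a * of_real s))" "integral\<^sup>L lborel_pos (\<lambda>s. exp (- ?a * of_real s)) = 1 / ?a"
    by (rule cexp_lborel_pos; use assms in simp)+
  have i': "integrable lborel_pos (\<lambda>s. cis c * exp (- ?a * of_real s))" using i(1) by (rule integrable_mult_right)
  have im: "Im (cis c * exp (- ?a * of_real s)) = exp (- (t * s)) * sin (c - s)" for s
    by (simp add: Im_exp Re_exp sin_diff algebra_simps)
  have "(\<integral>z. exp (- (t * z)) * sin (c - z) \<partial>lborel_pos) = Im (\<integral>s. cis c * exp (- ?a * of_real s) \<partial>lborel_pos)"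
    using integral_Im[OF i'] unfolding im .
  also have "\<dots> = Im (cis c * (1 / ?a))" unfolding Bochner_Integration.integral_mult_right_zero i(2) ..
  also have "\<dots> = (t * sin c - cos c) / (1 + t\<^sup>2)"
    by (simp add: Im_divide power2_eq_square add.commute mult.commute)
  finally show ?thesis .
qed

lemma poisson_sin_negative:
  assumes x: "x > 0" and y: "y > 0"
  shows "integrable lborel_pos (\<lambda>t. exp (- t * x) * sin (t * y) * ((t * sin c - cos c) / (1 + t\<^sup>2)))"
    and "(\<integral>z. cauchy_kernel y (x + z) * sin (c - z) \<partial>lborel_pos) = (1/pi) * (\<integral>t. exp (- t * x) * sin (t * y) * ((t * sin c - cos c) / (1 + t\<^sup>2)) \<partial>lborel_pos)"
proof -
  let ?F = "\<lambda>t z. exp (- ((x + z) * t)) * sin (t * y) * sin (c - z)"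
  have inner: "(\<integral>z. ?F t z \<partial>lborel_pos) = exp (- t * x) * sin (t * y) * ((t * sin c - cos c) / (1 + t\<^sup>2))" if t: "t > 0" for t
  proof -
    have "(\<integral>z. ?F t z \<partial>lborel_pos) = (\<integral>z. (exp (- t * x) * sin (t * y)) * (exp (- (t * z)) * sin (c - z)) \<partial>lborel_pos)"
      by (intro Bochner_Integration.integral_cong refl) (simp add: algebra_simps exp_diff exp_minus exp_add field_simps)
    then show ?thesis unfolding Bochner_Integration.integral_mult_right_zero laplace_sin[OF t] .
  qed
  have bd: "norm (?F t z) \<le> (exp (- x * t) * (t * y)) * exp (- t * z)" if "t > 0" for t z
  proof -
    have "\<bar>sin (t * y)\<bar> \<le> t * y" using abs_sin_x_le_abs_x[of "t * y"] that y by simp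
    then have "norm (?F t z) \<le> exp (- ((x + z) * t)) * (t * y) * 1"
      unfolding norm_mult using that y by (intro mult_mono) auto
    then show ?thesis by (simp add: algebra_simps exp_add[symmetric] exp_diff)
  qed
  have intz: "integrable lborel_pos (\<lambda>z. ?F t z)" if t: "t > 0" for t
  proof (rule lborel_pos_integrable_bound[where g="\<lambda>z. (exp (- x * t) * (t * y)) * exp (- t * z)"])
    show "integrable lborel_pos (\<lambda>z. (exp (- x * t) * (t * y)) * exp (- t * z))"
      by (intro integrable_mult_right exp_lborel_pos t)
  qed (use bd[OF t] in auto)
  have int: "integrable (lborel_pos \<Otimes>\<^sub>M lborel_pos) (case_prod ?F)"
  proof (rule pos_pos.Fubini_integrable)
    show "case_prod ?F \<in> borel_measurable (lborel_pos \<Otimes>\<^sub>M lborel_pos)" by measurable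
    show "AE t in lborel_pos. integrable lborel_pos (\<lambda>z. case_prod ?F (t, z))"
      by (rule AE_I2) (use intz in simp)
    show "integrable lborel_pos (\<lambda>t. \<integral>z. norm (case_prod ?F (t, z)) \<partial>lborel_pos)"
    proof (rule lborel_pos_integrable_bound[where g="\<lambda>t. y * exp (- x * t)"])
      show "integrable lborel_pos (\<lambda>t. y * exp (- x * t))" by (intro integrable_mult_right exp_lborel_pos x)
      show "(\<lambda>t. \<integral>z. norm (case_prod ?F (t, z)) \<partial>lborel_pos) \<in> borel_measurable lborel_pos" by measurable
      fix t :: real assume t: "t > 0"
      have "(\<integral>z. norm (?F t z) \<partial>lborel_pos) \<le> (\<integral>z. (exp (- x * t) * (t * y)) * exp (- t * z) \<partial>lborel_pos)"
      proof (rule integral_mono)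
        show "integrable lborel_pos (\<lambda>z. norm (?F t z))" using intz[OF t] by (rule integrable_norm)
        show "integrable lborel_pos (\<lambda>z. (exp (- x * t) * (t * y)) * exp (- t * z))"
          by (intro integrable_mult_right exp_lborel_pos t)
      qed (rule bd[OF t])
      also have "\<dots> = (exp (- x * t) * (t * y)) * (1 / t)"
        unfolding Bochner_Integration.integral_mult_right_zero exp_lborel_pos(2)[OF t] ..
      also have "\<dots> = y * exp (- x * t)" using t by simp
      finally have "(\<integral>z. norm (?F t z) \<partial>lborel_pos) \<le> y * exp (- x * t)" .
      moreover have "(\<integral>z. norm (?F t z) \<partial>lborel_pos) \<ge> 0" by (rule Bochner_Integration.integral_nonneg) auto
      ultimately show "norm (\<integral>z. norm (case_prod ?F (t, z)) \<partial>lborel_pos) \<le> y * exp (- x * t)" by simp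
    qed
  qed
  have "integrable lborel_pos (\<lambda>t. \<integral>z. ?F t z \<partial>lborel_pos)" using pos_pos.integrable_fst[OF int] .
  then show "integrable lborel_pos (\<lambda>t. exp (- t * x) * sin (t * y) * ((t * sin c - cos c) / (1 + t\<^sup>2)))"
    by (subst Bochner_Integration.integrable_cong[OF refl inner[symmetric]]) auto
  have "(\<integral>z. cauchy_kernel y (x + z) * sin (c - z) \<partial>lborel_pos) = (\<integral>z. (1/pi) * (\<integral>t. ?F t z \<partial>lborel_pos) \<partial>lborel_pos)"
  proof (rule Bochner_Integration.integral_cong[OF refl])
    fix z assume "z \<in> space lborel_pos" then have z: "x + z > 0" using x by simp
    show "cauchy_kernel y (x + z) * sin (c - z) = (1/pi) * (\<integral>t. ?F t z \<partial>lborel_pos)"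
      unfolding cauchy_kernel_laplace(2)[OF z] by simp
  qed
  also have "\<dots> = (1/pi) * (\<integral>z. (\<integral>t. ?F t z \<partial>lborel_pos) \<partial>lborel_pos)" by (rule Bochner_Integration.integral_mult_right_zero)
  also have "(\<integral>z. (\<integral>t. ?F t z \<partial>lborel_pos) \<partial>lborel_pos) = (\<integral>t. (\<integral>z. ?F t z \<partial>lborel_pos) \<partial>lborel_pos)"
    by (rule pos_pos.Fubini_integral[OF int])
  also have "\<dots> = (\<integral>t. exp (- t * x) * sin (t * y) * ((t * sin c - cos c) / (1 + t\<^sup>2)) \<partial>lborel_pos)"
    by (rule Bochner_Integration.integral_cong[OF refl]) (use inner in auto)
  finally show "(\<integral>z. cauchy_kernel y (x + z) * sin (c - z) \<partial>lborel_pos) = (1/pi) * (\<integral>t. exp (- t * x) * sin (t * y) * ((t * sin c - cos c) / (1 + t\<^sup>2)) \<partial>lborel_pos)" .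
qed

lemma cauchy_kernel_bounded_integrable:
  assumes y: "y > 0" and f: "f \<in> borel_measurable borel" "\<And>z. \<bar>f z\<bar> \<le> C"
  shows "integrable lborel (\<lambda>z. cauchy_kernel y (z - x) * f z)"
proof (rule Bochner_Integration.integrable_bound[where f="\<lambda>z. C * cauchy_kernel y (z - x)"])
  show "integrable lborel (\<lambda>z. C * cauchy_kernel y (z - x))" by (intro integrable_mult_right cauchy_kernel_integrable y)
  show "(\<lambda>z. cauchy_kernel y (z - x) * f z) \<in> borel_measurable lborel" using f(1) by measurable
  have "norm (cauchy_kernel y (z - x) * f z) \<le> norm (C * cauchy_kernel y (z - x))" for z
  proof -
    have "\<bar>f z\<bar> \<le> \<bar>C\<bar>" using f(2)[of z] by linarith
    then show ?thesis using cauchy_kernel_pos[OF y, of "z - x"]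
      by (simp add: abs_mult mult.commute mult_right_mono)
  qed
  then show "AE z in lborel. norm (cauchy_kernel y (z - x) * f z) \<le> norm (C * cauchy_kernel y (z - x))" by simp
qed

text \<open>On the whole line the Poisson integral of \<open>sin (z + c)\<close> is \<open>exp (- y) * sin (x + c)\<close>; the part over the
negative half-line is subtracted.\<close>
lemma poisson_sin:
  assumes x: "x > 0" and y: "y > 0"
  shows "(\<integral>z. cauchy_kernel y (z - x) * sin (z + c) \<partial>lborel_pos) = exp (- y) * sin (x + c) - (\<integral>z. cauchy_kernel y (x + z) * sin (c - z) \<partial>lborel_pos)"
proof -
  let ?f = "\<lambda>z. cauchy_kernel y (z - x) * sin (z + c)"
  have int: "integrable lborel ?f" by (rule cauchy_kernel_bounded_integrable[OF y, where C=1]) auto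
  let ?g = "\<lambda>z. cis c * (of_real (cauchy_kernel y (z - x)) * exp (\<i> * of_real (1 * z)))"
  have intg: "integrable lborel ?g"
  proof (intro integrable_mult_right)
    show "integrable lborel (\<lambda>z. complex_of_real (cauchy_kernel y (z - x)) * exp (\<i> * of_real (1 * z)))"
      by (rule Bochner_Integration.integrable_bound[OF cauchy_kernel_integrable[OF y, of x]]) (auto simp: norm_mult norm_exp_eq_Re)
  qed
  have im: "Im (?g z) = ?f z" for z by (simp add: Im_exp Re_exp sin_add algebra_simps)
  have "integral\<^sup>L lborel ?f = Im (integral\<^sup>L lborel ?g)" using integral_Im[OF intg] unfolding im .
  also have "\<dots> = Im (cis c * exp (\<i> * of_real (1 * x) - of_real (1 * y)))"
    unfolding Bochner_Integration.integral_mult_right_zero using cauchy_charfn[OF y, of 1 x] by simp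
  also have "\<dots> = exp (- y) * sin (x + c)" by (simp add: Im_exp Re_exp sin_add algebra_simps)
  finally have 1: "integral\<^sup>L lborel ?f = exp (- y) * sin (x + c)" .
  have 2: "integral\<^sup>L lborel ?f = (\<integral>z. ?f z \<partial>lborel_pos) + (\<integral>z. ?f (- z) \<partial>lborel_pos)"
    by (rule lborel_split(2)[OF _ int]) measurable
  have 3: "?f (- z) = cauchy_kernel y (x + z) * sin (c - z)" for z
    by (simp add: cauchy_kernel_def power2_eq_square algebra_simps)
  show ?thesis using 1 2 unfolding 3 by simp
qed

text \<open>The eigenfunction for the eigenvalue \<open>1\<close>, extended by zero.\<close>
definition psi_ext :: "real \<Rightarrow> real" where "psi_ext z = (if z > 0 then sin (z + pi/8) - r_fun z else 0)"

lemma psi_ext_measurable [measurable]: "psi_ext \<in> borel_measurable borel" unfolding psi_ext_def by measurable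

definition psi_sup :: real where "psi_sup = 1 + (\<integral>t. rho t \<partial>lborel_pos)"

lemma psi_ext_bound: "\<bar>psi_ext z\<bar> \<le> psi_sup"
proof -
  have I: "0 \<le> (\<integral>t. rho t \<partial>lborel_pos)" by (rule Bochner_Integration.integral_nonneg) (use rho_nonneg in auto)
  show ?thesis
  proof (cases "z > 0")
    case True
    then have "0 \<le> r_fun z" "r_fun z \<le> (\<integral>t. rho t \<partial>lborel_pos)" using r_fun_bounds[of z] by auto
    moreover have "\<bar>sin (z + pi/8)\<bar> \<le> 1" by (rule abs_sin_le_one)
    ultimately have "\<bar>sin (z + pi/8) - r_fun z\<bar> \<le> 1 + (\<integral>t. rho t \<partial>lborel_pos)" by linarith
    then show ?thesis using True by (simp add: psi_ext_def psi_sup_def)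
  qed (use I in \<open>simp add: psi_ext_def psi_sup_def\<close>)
qed

text \<open>When the formulas for the sine and for \<open>r\<close> are subtracted, the rational terms
\<open>(cos (\<pi>/8) - t sin (\<pi>/8)) / (1 + t\<^sup>2)\<close> cancel.\<close>
lemma poisson_psi_ext:
  assumes x: "x > 0" and y: "y > 0"
  shows "(\<integral>z. cauchy_kernel y (z - x) * psi_ext z \<partial>lborel) = exp (- y) * sin (x + pi/8) - (\<integral>t. rho t * exp (- t * x) * (cos (t * y) - sin (t * y) / t) \<partial>lborel_pos)"
proof -
  let ?c = "pi/8"
  have "(\<integral>z. cauchy_kernel y (z - x) * psi_ext z \<partial>lborel) = (\<integral>z. cauchy_kernel y (z - x) * sin (z + ?c) - cauchy_kernel y (z - x) * r_fun z \<partial>lborel_pos)"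
    unfolding integral_lborel_pos set_lebesgue_integral_def psi_ext_def
    by (intro Bochner_Integration.integral_cong refl) (simp add: right_diff_distrib)
  also have "\<dots> = (\<integral>z. cauchy_kernel y (z - x) * sin (z + ?c) \<partial>lborel_pos) - (\<integral>z. cauchy_kernel y (z - x) * r_fun z \<partial>lborel_pos)"
  proof (rule Bochner_Integration.integral_diff)
    have "integrable lborel (\<lambda>z. cauchy_kernel y (z - x) * sin (z + ?c))"
      by (rule cauchy_kernel_bounded_integrable[OF y, where C=1]) auto
    then show "integrable lborel_pos (\<lambda>z. cauchy_kernel y (z - x) * sin (z + ?c))" by (subst (asm) lborel_split(1)) auto
    have ck: "integrable lborel_pos (\<lambda>z. cauchy_kernel y (z - x))" using cauchy_kernel_integrable[OF y, of x] by (subst (asm) lborel_split(1)) auto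
    show "integrable lborel_pos (\<lambda>z. cauchy_kernel y (z - x) * r_fun z)"
    proof (rule lborel_pos_integrable_bound[where g="\<lambda>z. cauchy_kernel y (z - x) * (\<integral>t. rho t \<partial>lborel_pos)"])
      show "integrable lborel_pos (\<lambda>z. cauchy_kernel y (z - x) * (\<integral>t. rho t \<partial>lborel_pos))" by (intro integrable_mult_left ck)
      show "(\<lambda>z. cauchy_kernel y (z - x) * r_fun z) \<in> borel_measurable lborel_pos" by (intro borel_measurable_lborel_pos) measurable
      show "norm (cauchy_kernel y (z - x) * r_fun z) \<le> cauchy_kernel y (z - x) * (\<integral>t. rho t \<partial>lborel_pos)" if "z > 0" for z
        using r_fun_bounds[of z] that cauchy_kernel_pos[OF y, of "z - x"] by (simp add: abs_mult mult_left_mono)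
    qed
  qed
  also have "(\<integral>z. cauchy_kernel y (z - x) * r_fun z \<partial>lborel_pos) = (1/pi) * Re (fourier_ext (of_real x + \<i> * of_real y))"
    by (rule poisson_r[OF y])
  also have "(\<integral>z. cauchy_kernel y (z - x) * sin (z + ?c) \<partial>lborel_pos) = exp (- y) * sin (x + ?c) - (1/pi) * (\<integral>t. exp (- t * x) * sin (t * y) * ((t * sin ?c - cos ?c) / (1 + t\<^sup>2)) \<partial>lborel_pos)"
    unfolding poisson_sin[OF x y] poisson_sin_negative(2)[OF x y] ..
  also have "\<dots> - (1/pi) * Re (fourier_ext (of_real x + \<i> * of_real y)) = exp (- y) * sin (x + ?c) - (1/pi) * ((\<integral>t. exp (- t * x) * sin (t * y) * ((t * sin ?c - cos ?c) / (1 + t\<^sup>2)) \<partial>lborel_pos) + Re (fourier_ext (of_real x + \<i> * of_real y)))"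
    by (simp add: algebra_simps)
  also have "(\<integral>t. exp (- t * x) * sin (t * y) * ((t * sin ?c - cos ?c) / (1 + t\<^sup>2)) \<partial>lborel_pos) + Re (fourier_ext (of_real x + \<i> * of_real y))
     = (\<integral>t. pi * (rho t * exp (- t * x) * (cos (t * y) - sin (t * y) / t)) \<partial>lborel_pos)"
    unfolding Re_fourier_ext_right(2)[OF x y] Bochner_Integration.integral_add[OF poisson_sin_negative(1)[OF x y] Re_fourier_ext_right(1)[OF x y], symmetric]
  proof (rule Bochner_Integration.integral_cong[OF refl])
    fix t
    have "(cos ?c - t * sin ?c) / (1 + t\<^sup>2) = - ((t * sin ?c - cos ?c) / (1 + t\<^sup>2))" by (simp add: minus_divide_left)
    then show "exp (- t * x) * sin (t * y) * ((t * sin ?c - cos ?c) / (1 + t\<^sup>2)) + exp (- t * x) * (pi * rho t * cos (t * y) + sin (t * y) * ((cos ?c - t * sin ?c) / (1 + t\<^sup>2) - pi * rho t / t))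
      = pi * (rho t * exp (- t * x) * (cos (t * y) - sin (t * y) / t))"
      by (simp only:) (simp add: algebra_simps)
  qed
  also have "\<dots> = pi * (\<integral>t. rho t * exp (- t * x) * (cos (t * y) - sin (t * y) / t) \<partial>lborel_pos)"
    by (rule Bochner_Integration.integral_mult_right_zero)
  finally show ?thesis by simp
qed

section \<open>The defect of the eigenvalue equation for small times\<close>

text \<open>The amount by which the free semigroup fails to multiply the extended eigenfunction by \<open>exp (- h)\<close>.\<close>
definition defect :: "real \<Rightarrow> real \<Rightarrow> real" where
  "defect h x = (\<integral>z. cauchy_kernel h (z - x) * psi_ext z \<partial>lborel) - exp (- h) * psi_ext x"

definition defect_symbol :: "real \<Rightarrow> real \<Rightarrow> real" where
  "defect_symbol t h = exp (- h) - cos (t * h) + sin (t * h) / t"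

lemma defect_measurable [measurable]: "defect h \<in> borel_measurable borel"
  unfolding defect_def cauchy_kernel_def by measurable

lemma sin_div_bound: "t > 0 \<Longrightarrow> h > 0 \<Longrightarrow> \<bar>sin (t * h) / t\<bar> \<le> h" for t h :: real
  using abs_sin_x_le_abs_x[of "t * h"] by (simp add: abs_divide divide_le_eq abs_mult mult.commute)

lemma one_minus_cos_bounds:
  fixes z :: real assumes "z \<ge> 0"
  shows "0 \<le> 1 - cos z" "1 - cos z \<le> z" "1 - cos z \<le> z\<^sup>2 / 2"
proof -
  have e: "1 - cos z = 2 * (sin (z/2))\<^sup>2" using cos_double_sin[of "z/2"] by simp
  have s: "\<bar>sin (z/2)\<bar> \<le> z / 2" "\<bar>sin (z/2)\<bar> \<le> 1" using abs_sin_x_le_abs_x[of "z/2"] assms by auto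
  show "0 \<le> 1 - cos z" by simp
  have "\<bar>sin (z/2)\<bar> * \<bar>sin (z/2)\<bar> \<le> (z/2) * 1" using s assms by (intro mult_mono) auto
  then show "1 - cos z \<le> z" unfolding e by (simp add: power2_eq_square abs_mult[symmetric])
  have "\<bar>sin (z/2)\<bar> * \<bar>sin (z/2)\<bar> \<le> (z/2) * (z/2)" using s assms by (intro mult_mono) auto
  then show "1 - cos z \<le> z\<^sup>2 / 2" unfolding e by (simp add: power2_eq_square abs_mult[symmetric])
qed

lemma sin_second_order: "\<bar>sin z - z\<bar> \<le> z\<^sup>2 / 2" for z :: real
proof -
  have "\<bar>sin z - (\<Sum>m<2. sin_coeff m * z ^ m)\<bar> \<le> inverse (fact 2) * \<bar>z\<bar> ^ 2"
    by (rule Maclaurin_sin_bound)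
  moreover have "(\<Sum>m<2. sin_coeff m * z ^ m) = z" by (simp add: sin_coeff_def numeral_2_eq_2)
  ultimately show ?thesis by simp
qed

lemma defect_symbol_bound_1:
  assumes "t > 0" "h > 0" shows "\<bar>defect_symbol t h\<bar> \<le> h * (2 + t)"
proof -
  have "t * h \<ge> 0" using assms by simp
  note c = one_minus_cos_bounds[OF this]
  have "exp (- h) \<le> 1" "exp (- h) \<ge> 1 - h" using assms exp_ge_add_one_self[of "-h"] by auto
  then have "\<bar>exp (- h) - 1\<bar> \<le> h" using assms by linarith
  moreover have "\<bar>defect_symbol t h\<bar> \<le> \<bar>exp (- h) - 1\<bar> + \<bar>1 - cos (t * h)\<bar> + \<bar>sin (t * h) / t\<bar>"
    unfolding defect_symbol_def by linarith
  ultimately have "\<bar>defect_symbol t h\<bar> \<le> h + t * h + h" using c sin_div_bound[OF assms] by linarith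
  then show ?thesis by (simp add: algebra_simps)
qed

text \<open>The three terms \<open>exp (- h) - 1 + h\<close>, \<open>1 - cos (t h)\<close> and \<open>sin (t h) / t - h\<close> are of second order in \<open>h\<close>, and their
leading parts \<open>- 1 + h + 1 - h\<close> cancel: \<open>exp (- h) - cos (t h) + sin (t h) / t\<close> has no term of order \<open>0\<close> or \<open>1\<close>.\<close>
lemma defect_symbol_bound_2:
  assumes t: "t > 0" and h: "h > 0" shows "\<bar>defect_symbol t h\<bar> \<le> 2 * h\<^sup>2 * (1 + t\<^sup>2)"
proof -
  have th: "t * h \<ge> 0" using assms by simp
  have e: "0 \<le> exp (- h) - 1 + h" "exp (- h) - 1 + h \<le> h\<^sup>2"
  proof -
    show "0 \<le> exp (- h) - 1 + h" using exp_ge_add_one_self[of "-h"] by simp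
    have "exp (- h) \<le> 1 / (1 + h)"
      using exp_ge_add_one_self[of h] h by (simp add: exp_minus inverse_eq_divide frac_le)
    also have "\<dots> \<le> 1 - h + h\<^sup>2"
    proof -
      have "1 \<le> (1 - h + h\<^sup>2) * (1 + h)" using h by (simp add: algebra_simps power2_eq_square)
      then show ?thesis using h by (simp add: divide_le_eq)
    qed
    finally show "exp (- h) - 1 + h \<le> h\<^sup>2" by simp
  qed
  have s: "\<bar>sin (t * h) / t - h\<bar> \<le> t * h\<^sup>2 / 2"
  proof -
    have "sin (t * h) / t - h = (sin (t * h) - t * h) / t" using t by (simp add: diff_divide_distrib)
    then have "\<bar>sin (t * h) / t - h\<bar> = \<bar>sin (t * h) - t * h\<bar> / t" using t by (simp only: abs_divide abs_of_pos)
    also have "\<dots> \<le> ((t * h)\<^sup>2 / 2) / t" using sin_second_order[of "t * h"] t by (intro divide_right_mono) auto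
    also have "\<dots> = t * h\<^sup>2 / 2" using t by (simp add: power2_eq_square)
    finally show ?thesis .
  qed
  have "t * h\<^sup>2 / 2 \<le> (1 + t\<^sup>2) / 4 * h\<^sup>2"
  proof -
    have "0 \<le> (1 - t)\<^sup>2" by simp
    then have "t / 2 \<le> (1 + t\<^sup>2) / 4" by (simp add: power2_eq_square algebra_simps)
    then show ?thesis using mult_right_mono[of "t / 2" "(1 + t\<^sup>2) / 4" "h\<^sup>2"] by simp
  qed
  moreover have "\<bar>defect_symbol t h\<bar> \<le> \<bar>exp (- h) - 1 + h\<bar> + \<bar>1 - cos (t * h)\<bar> + \<bar>sin (t * h) / t - h\<bar>"
    unfolding defect_symbol_def by linarith
  moreover have "1 - cos (t * h) \<le> t\<^sup>2 * h\<^sup>2 / 2" using one_minus_cos_bounds(3)[OF th] by (simp add: power_mult_distrib)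
  ultimately have "\<bar>defect_symbol t h\<bar> \<le> h\<^sup>2 + t\<^sup>2 * h\<^sup>2 / 2 + (1 + t\<^sup>2) / 4 * h\<^sup>2"
    using e s one_minus_cos_bounds(1)[OF th] by linarith
  also have "\<dots> \<le> 2 * h\<^sup>2 * (1 + t\<^sup>2)"
  proof -
    have *: "a + b / 2 + (a / 4 + b / 4) \<le> 2 * a + 2 * b" if "0 \<le> a" "0 \<le> b" for a b :: real
      using that by linarith
    have "(1 + t\<^sup>2) / 4 * h\<^sup>2 = h\<^sup>2 / 4 + t\<^sup>2 * h\<^sup>2 / 4" by (simp add: algebra_simps add_divide_distrib)
    moreover have "2 * h\<^sup>2 * (1 + t\<^sup>2) = 2 * h\<^sup>2 + 2 * (t\<^sup>2 * h\<^sup>2)" by (simp add: algebra_simps)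
    ultimately show ?thesis using *[of "h\<^sup>2" "t\<^sup>2 * h\<^sup>2"] by (simp only:) simp
  qed
  finally show ?thesis .
qed

lemma defect_eq:
  assumes x: "x > 0" and h: "h > 0"
  shows "integrable lborel_pos (\<lambda>t. rho t * exp (- t * x) * defect_symbol t h)"
    and "defect h x = (\<integral>t. rho t * exp (- t * x) * defect_symbol t h \<partial>lborel_pos)"
proof -
  have i1: "integrable lborel_pos (\<lambda>t. exp (- h) * (rho t * exp (- t * x)))"
    by (intro integrable_mult_right integrable_r_integrand) (use x in auto)
  have i2: "integrable lborel_pos (\<lambda>t. rho t * exp (- t * x) * (cos (t * h) - sin (t * h) / t))"
  proof (rule lborel_pos_integrable_bound[where g="\<lambda>t. rho t * exp (- t * x) * (1 + h)"])
    show "integrable lborel_pos (\<lambda>t. rho t * exp (- t * x) * (1 + h))"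
      by (intro integrable_mult_left integrable_r_integrand) (use x in auto)
    show "(\<lambda>t. rho t * exp (- t * x) * (cos (t * h) - sin (t * h) / t)) \<in> borel_measurable lborel_pos"
      by (intro borel_measurable_lborel_pos) measurable
    fix t :: real assume t: "t > 0"
    have "\<bar>cos (t * h) - sin (t * h) / t\<bar> \<le> 1 + h"
      using sin_div_bound[OF t h] abs_cos_le_one[of "t * h"] by linarith
    then show "norm (rho t * exp (- t * x) * (cos (t * h) - sin (t * h) / t)) \<le> rho t * exp (- t * x) * (1 + h)"
      using rho_nonneg[of t] t by (simp add: abs_mult mult_left_mono)
  qed
  have eq: "exp (- h) * (rho t * exp (- t * x)) - rho t * exp (- t * x) * (cos (t * h) - sin (t * h) / t) = rho t * exp (- t * x) * defect_symbol t h" for t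
    by (simp add: defect_symbol_def algebra_simps)
  show "integrable lborel_pos (\<lambda>t. rho t * exp (- t * x) * defect_symbol t h)"
    using Bochner_Integration.integrable_diff[OF i1 i2] unfolding eq .
  have "(\<integral>t. rho t * exp (- t * x) * defect_symbol t h \<partial>lborel_pos) = exp (- h) * r_fun x - (\<integral>t. rho t * exp (- t * x) * (cos (t * h) - sin (t * h) / t) \<partial>lborel_pos)"
    using Bochner_Integration.integral_diff[OF i1 i2] unfolding eq Bochner_Integration.integral_mult_right_zero r_fun_eq .
  then show "defect h x = (\<integral>t. rho t * exp (- t * x) * defect_symbol t h \<partial>lborel_pos)"
    unfolding defect_def poisson_psi_ext[OF x h] using x by (simp add: psi_ext_def algebra_simps)
qed

text \<open>The factor \<open>exp (- t x)\<close> pays for the growth \<open>1 + t\<^sup>2\<close> of the second-order bound.\<close>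
lemma defect_far:
  assumes a: "a > 0" and x: "x \<ge> a" and h: "h > 0"
  shows "\<bar>defect h x\<bar> \<le> 8 * h\<^sup>2 / a\<^sup>2"
proof -
  have x0: "x > 0" using a x by simp
  have i: "integrable lborel_pos (\<lambda>t. (2 * h\<^sup>2 * (2 / a)) * exp (- (a / 2) * t))"
    by (intro integrable_mult_right exp_lborel_pos) (use a in simp)
  have "norm (defect h x) \<le> (\<integral>t. (2 * h\<^sup>2 * (2 / a)) * exp (- (a / 2) * t) \<partial>lborel_pos)"
    unfolding defect_eq(2)[OF x0 h]
  proof (rule Bochner_Integration.integral_norm_bound_integral[OF defect_eq(1)[OF x0 h] i])
    fix t assume "t \<in> space lborel_pos" then have t: "t > 0" by simp
    have p: "1 + t\<^sup>2 > 0" by (simp add: add_pos_nonneg)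
    have "norm (rho t * exp (- t * x) * defect_symbol t h) = rho t * exp (- t * x) * \<bar>defect_symbol t h\<bar>"
      using rho_nonneg[of t] t by (simp add: abs_mult)
    also have "\<dots> \<le> t / (1 + t\<^sup>2) * exp (- (a * t)) * (2 * h\<^sup>2 * (1 + t\<^sup>2))"
      using rho_bounds(1)[OF t] defect_symbol_bound_2[OF t h] rho_nonneg[of t] t p x
      by (intro mult_mono) (auto simp: mult.commute)
    also have "\<dots> = 2 * h\<^sup>2 * (t * exp (- (a * t)))" using p by (simp add: field_simps)
    also have "\<dots> \<le> 2 * h\<^sup>2 * ((2 / a) * exp (- (a / 2) * t))"
    proof (rule mult_left_mono)
      have "a * t / 2 \<le> exp (a * t / 2)" using exp_ge_add_one_self[of "a * t / 2"] by linarith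
      then have "t \<le> (2 / a) * exp (a * t / 2)" using a by (simp add: field_simps)
      then have "t * exp (- (a * t)) \<le> (2 / a) * exp (a * t / 2) * exp (- (a * t))" by (intro mult_right_mono) auto
      also have "\<dots> = (2 / a) * exp (- (a / 2) * t)" by (simp add: mult_exp_exp field_simps)
      finally show "t * exp (- (a * t)) \<le> (2 / a) * exp (- (a / 2) * t)" .
    qed simp
    finally show "norm (rho t * exp (- t * x) * defect_symbol t h) \<le> (2 * h\<^sup>2 * (2 / a)) * exp (- (a / 2) * t)" by (simp only: mult.assoc)
  qed
  also have "\<dots> = (2 * h\<^sup>2 * (2 / a)) * (1 / (a / 2))"
    unfolding Bochner_Integration.integral_mult_right_zero using exp_lborel_pos(2)[of "a / 2"] a by simp
  also have "\<dots> = 8 * h\<^sup>2 / a\<^sup>2" using a by (simp add: power2_eq_square)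
  finally show ?thesis by simp
qed

text \<open>Integrating \<open>exp (- t x)\<close> over \<open>x > 0\<close> gives \<open>1 / t\<close>, so this bounds the \<open>L\<^sup>1\<close> norm of the defect on the positive
half-line.\<close>
definition defect_mass :: "real \<Rightarrow> real" where
  "defect_mass h = (\<integral>t. rho t / t * \<bar>defect_symbol t h\<bar> \<partial>lborel_pos)"

lemma defect_mass_majorant: "integrable lborel_pos (\<lambda>t. 2 * (1 / (1 + t\<^sup>2)) + rho t)"
  by (intro Bochner_Integration.integrable_add integrable_mult_right recip_1_sq_lborel_pos integrable_rho)

lemma defect_symbol_measurable [measurable]: "(\<lambda>t. defect_symbol t h) \<in> borel_measurable borel"
  unfolding defect_symbol_def by measurable

lemma defect_mass_integrand_bound:
  assumes t: "t > 0" and h: "h > 0"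
  shows "rho t / t * \<bar>defect_symbol t h\<bar> \<le> h * (2 * (1 / (1 + t\<^sup>2)) + rho t)"
proof -
  have "rho t / t * \<bar>defect_symbol t h\<bar> \<le> rho t / t * (h * (2 + t))"
    using defect_symbol_bound_1[OF t h] rho_nonneg[of t] t by (intro mult_left_mono) auto
  also have "\<dots> = h * (2 * (rho t / t) + rho t)" using t by (simp add: field_simps)
  also have "\<dots> \<le> h * (2 * (1 / (1 + t\<^sup>2)) + rho t)"
    using rho_bounds(2)[OF t] h by (intro mult_left_mono add_mono) auto
  finally show ?thesis .
qed

lemma defect_mass_integrable: assumes h: "h > 0" shows "integrable lborel_pos (\<lambda>t. rho t / t * \<bar>defect_symbol t h\<bar>)"
proof (rule lborel_pos_integrable_bound[where g="\<lambda>t. h * (2 * (1 / (1 + t\<^sup>2)) + rho t)"])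
  show "integrable lborel_pos (\<lambda>t. h * (2 * (1 / (1 + t\<^sup>2)) + rho t))" by (intro integrable_mult_right defect_mass_majorant)
  show "(\<lambda>t. rho t / t * \<bar>defect_symbol t h\<bar>) \<in> borel_measurable lborel_pos" by (intro borel_measurable_lborel_pos) measurable
  show "norm (rho t / t * \<bar>defect_symbol t h\<bar>) \<le> h * (2 * (1 / (1 + t\<^sup>2)) + rho t)" if "t > 0" for t
    using defect_mass_integrand_bound[OF that h] rho_nonneg[of t] that by (simp add: abs_mult)
qed

lemma defect_mass_nonneg: "defect_mass h \<ge> 0"
  unfolding defect_mass_def by (rule Bochner_Integration.integral_nonneg) (simp add: rho_nonneg)

text \<open>The second-order bound gives convergence for each \<open>t\<close>, the first-order bound an integrable majorant. The
second-order bound alone does not suffice: \<open>\<integral> rho t / t * (1 + t\<^sup>2) dt\<close> diverges.\<close>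
lemma defect_mass_small:
  assumes h: "\<And>n. h n > 0" "h \<longlonglongrightarrow> 0"
  shows "(\<lambda>n. defect_mass (h n) / h n) \<longlonglongrightarrow> 0"
proof -
  have "(\<lambda>n. \<integral>t. rho t / t * \<bar>defect_symbol t (h n)\<bar> / h n \<partial>lborel_pos) \<longlonglongrightarrow> (\<integral>t. 0 \<partial>lborel_pos)"
  proof (rule integral_dominated_convergence[where w="\<lambda>t. 2 * (1 / (1 + t\<^sup>2)) + rho t"])
    show "integrable lborel_pos (\<lambda>t. 2 * (1 / (1 + t\<^sup>2)) + rho t)" by (rule defect_mass_majorant)
    show "(\<lambda>t. rho t / t * \<bar>defect_symbol t (h n)\<bar> / h n) \<in> borel_measurable lborel_pos" for n by (intro borel_measurable_lborel_pos) measurable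
    show "AE t in lborel_pos. norm (rho t / t * \<bar>defect_symbol t (h n)\<bar> / h n) \<le> 2 * (1 / (1 + t\<^sup>2)) + rho t" for n
    proof (rule AE_I2)
      fix t assume "t \<in> space lborel_pos" then have t: "t > 0" by simp
      have "norm (rho t / t * \<bar>defect_symbol t (h n)\<bar> / h n) = rho t / t * \<bar>defect_symbol t (h n)\<bar> / h n"
        using rho_nonneg[of t] t h(1)[of n] by simp
      also have "\<dots> \<le> (h n * (2 * (1 / (1 + t\<^sup>2)) + rho t)) / h n"
        using defect_mass_integrand_bound[OF t h(1)[of n]] h(1)[of n] by (intro divide_right_mono) auto
      also have "\<dots> = 2 * (1 / (1 + t\<^sup>2)) + rho t" using h(1)[of n] by (simp only: nonzero_mult_div_cancel_left less_imp_neq[symmetric] not_False_eq_True)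
      finally show "norm (rho t / t * \<bar>defect_symbol t (h n)\<bar> / h n) \<le> 2 * (1 / (1 + t\<^sup>2)) + rho t" .
    qed
    show "AE t in lborel_pos. (\<lambda>n. rho t / t * \<bar>defect_symbol t (h n)\<bar> / h n) \<longlonglongrightarrow> 0"
    proof (rule AE_I2)
      fix t assume "t \<in> space lborel_pos" then have t: "t > 0" by simp
      show "(\<lambda>n. rho t / t * \<bar>defect_symbol t (h n)\<bar> / h n) \<longlonglongrightarrow> 0"
      proof (rule Lim_null_comparison)
        have "norm (rho t / t * \<bar>defect_symbol t (h n)\<bar> / h n) \<le> (rho t / t * (2 * (1 + t\<^sup>2))) * h n" for n
        proof -
          have "norm (rho t / t * \<bar>defect_symbol t (h n)\<bar> / h n) = rho t / t * \<bar>defect_symbol t (h n)\<bar> / h n"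
            using rho_nonneg[of t] t h(1)[of n] by simp
          also have "\<dots> \<le> rho t / t * (2 * (h n)\<^sup>2 * (1 + t\<^sup>2)) / h n"
            using defect_symbol_bound_2[OF t h(1)[of n]] rho_nonneg[of t] t h(1)[of n]
            by (intro divide_right_mono mult_left_mono) auto
          also have "\<dots> = (rho t / t * (2 * (1 + t\<^sup>2))) * h n"
            using h(1)[of n] by (simp add: power2_eq_square)
          finally show ?thesis .
        qed
        then show "\<forall>\<^sub>F n in sequentially. norm (rho t / t * \<bar>defect_symbol t (h n)\<bar> / h n) \<le> (rho t / t * (2 * (1 + t\<^sup>2))) * h n"
          by simp
        have "(\<lambda>n. (rho t / t * (2 * (1 + t\<^sup>2))) * h n) \<longlonglongrightarrow> (rho t / t * (2 * (1 + t\<^sup>2))) * 0"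
          by (intro tendsto_intros h(2))
        then show "(\<lambda>n. (rho t / t * (2 * (1 + t\<^sup>2))) * h n) \<longlonglongrightarrow> 0" by simp
      qed
    qed
  qed simp
  then show ?thesis unfolding defect_mass_def by (simp only: Bochner_Integration.integral_divide_zero Bochner_Integration.integral_zero)
qed

lemma defect_L1: assumes h: "h > 0" shows "(\<integral>\<^sup>+x. ennreal \<bar>defect h x\<bar> \<partial>lborel_pos) \<le> ennreal (defect_mass h)"
proof -
  have "(\<integral>\<^sup>+x. ennreal \<bar>defect h x\<bar> \<partial>lborel_pos) \<le> (\<integral>\<^sup>+x. (\<integral>\<^sup>+t. ennreal (rho t * \<bar>defect_symbol t h\<bar>) * ennreal (exp (- t * x)) \<partial>lborel_pos) \<partial>lborel_pos)"
  proof (rule nn_integral_mono)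
    fix x assume "x \<in> space lborel_pos" then have x: "x > 0" by simp
    have "ennreal \<bar>defect h x\<bar> \<le> (\<integral>\<^sup>+t. norm (rho t * exp (- t * x) * defect_symbol t h) \<partial>lborel_pos)"
      using integral_norm_bound_ennreal[OF defect_eq(1)[OF x h]] defect_eq(2)[OF x h] by simp
    also have "\<dots> = (\<integral>\<^sup>+t. ennreal (rho t * \<bar>defect_symbol t h\<bar>) * ennreal (exp (- t * x)) \<partial>lborel_pos)"
      by (rule nn_integral_cong) (auto simp: ennreal_mult''[symmetric] rho_nonneg abs_mult mult_ac)
    finally show "ennreal \<bar>defect h x\<bar> \<le> (\<integral>\<^sup>+t. ennreal (rho t * \<bar>defect_symbol t h\<bar>) * ennreal (exp (- t * x)) \<partial>lborel_pos)" .
  qed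
  also have "\<dots> = (\<integral>\<^sup>+t. (\<integral>\<^sup>+x. ennreal (rho t * \<bar>defect_symbol t h\<bar>) * ennreal (exp (- t * x)) \<partial>lborel_pos) \<partial>lborel_pos)"
  proof (rule pos_pos.Fubini')
    have [measurable]: "(\<lambda>t. defect_symbol t h) \<in> borel_measurable lborel_pos" "rho \<in> borel_measurable lborel_pos" by (intro borel_measurable_lborel_pos; measurable)+
    show "(\<lambda>(t, x). ennreal (rho t * \<bar>defect_symbol t h\<bar>) * ennreal (exp (- t * x))) \<in> borel_measurable (lborel_pos \<Otimes>\<^sub>M lborel_pos)"
      by measurable
  qed
  also have "\<dots> = (\<integral>\<^sup>+t. ennreal (rho t / t * \<bar>defect_symbol t h\<bar>) \<partial>lborel_pos)"
  proof (rule nn_integral_cong)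
    fix t assume "t \<in> space lborel_pos" then have t: "t > 0" by simp
    have "(\<integral>\<^sup>+x. ennreal (exp (- t * x)) \<partial>lborel_pos) = ennreal (1 / t)"
      by (subst nn_integral_eq_integral[OF exp_lborel_pos(1)[OF t]]) (auto simp: exp_lborel_pos(2)[OF t, simplified])
    then show "(\<integral>\<^sup>+x. ennreal (rho t * \<bar>defect_symbol t h\<bar>) * ennreal (exp (- t * x)) \<partial>lborel_pos) = ennreal (rho t / t * \<bar>defect_symbol t h\<bar>)"
      using t rho_nonneg[of t] by (subst nn_integral_cmult) (auto simp: ennreal_mult''[symmetric] intro!: borel_measurable_lborel_pos)
  qed
  also have "\<dots> = ennreal (defect_mass h)" unfolding defect_mass_def
    by (rule nn_integral_eq_integral[OF defect_mass_integrable[OF h]]) (auto simp: rho_nonneg)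
  finally show ?thesis .
qed

lemma cauchy_kernel_total: "y > 0 \<Longrightarrow> (\<integral>\<^sup>+z. ennreal (cauchy_kernel y (z - x)) \<partial>lborel) = 1"
proof -
  assume y: "y > 0"
  have "complex_of_real (\<integral>z. cauchy_kernel y (z - x) \<partial>lborel) = 1"
    using cauchy_charfn[OF y, of 0 x] by (simp add: integral_complex_of_real)
  then have 1: "(\<integral>z. cauchy_kernel y (z - x) \<partial>lborel) = 1" by (metis of_real_eq_1_iff)
  have "(\<integral>\<^sup>+z. ennreal (cauchy_kernel y (z - x)) \<partial>lborel) = ennreal (\<integral>z. cauchy_kernel y (z - x) \<partial>lborel)"
    by (rule nn_integral_eq_integral[OF cauchy_kernel_integrable[OF y]]) (use cauchy_kernel_pos[OF y] in \<open>auto intro!: less_imp_le\<close>)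
  then show ?thesis using 1 by simp
qed

text \<open>The position \<open>z\<close> of the process at time \<open>s\<close> has density \<open>cauchy_kernel s (z - x)\<close>. For \<open>z < x/2\<close> this density is
at most \<open>4 T / x\<^sup>2\<close> and the \<open>L\<^sup>1\<close> bound on the defect is used; for \<open>z \<ge> x/2\<close> the uniform bound is used.\<close>
lemma defect_expectation:
  assumes x: "x > 0" and s: "0 < s" "s \<le> T" and h: "h > 0"
  shows "(\<integral>\<^sup>+z. ennreal (cauchy_kernel s (z - x) * \<bar>defect h z\<bar>) \<partial>lborel_pos) \<le> ennreal (4 * T / x\<^sup>2 * defect_mass h + 32 * h\<^sup>2 / x\<^sup>2)"
proof -
  have cn: "cauchy_kernel s v \<ge> 0" for v using cauchy_kernel_pos[OF s(1), of v] by simp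
  have m: "(\<lambda>z. ennreal \<bar>defect h z\<bar>) \<in> borel_measurable lborel_pos" by (intro borel_measurable_lborel_pos) measurable
  have mk: "(\<lambda>z. ennreal (cauchy_kernel s (z - x))) \<in> borel_measurable lborel_pos" by (intro borel_measurable_lborel_pos) measurable
  have "(\<integral>\<^sup>+z. ennreal (cauchy_kernel s (z - x) * \<bar>defect h z\<bar>) \<partial>lborel_pos)
     \<le> (\<integral>\<^sup>+z. ennreal (4 * T / x\<^sup>2) * ennreal \<bar>defect h z\<bar> + ennreal (32 * h\<^sup>2 / x\<^sup>2) * ennreal (cauchy_kernel s (z - x)) \<partial>lborel_pos)"
  proof (rule nn_integral_mono)
    fix z assume "z \<in> space lborel_pos" then have z: "z > 0" by simp
    have "cauchy_kernel s (z - x) * \<bar>defect h z\<bar> \<le> 4 * T / x\<^sup>2 * \<bar>defect h z\<bar> + 32 * h\<^sup>2 / x\<^sup>2 * cauchy_kernel s (z - x)"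
    proof (cases "z \<ge> x / 2")
      case True
      have "\<bar>defect h z\<bar> \<le> 8 * h\<^sup>2 / (x / 2)\<^sup>2" using defect_far[of "x/2" z h] True x h by simp
      also have "\<dots> = 32 * h\<^sup>2 / x\<^sup>2" by (simp add: power2_eq_square)
      finally have "cauchy_kernel s (z - x) * \<bar>defect h z\<bar> \<le> cauchy_kernel s (z - x) * (32 * h\<^sup>2 / x\<^sup>2)"
        using cn by (intro mult_left_mono)
      moreover have "0 \<le> 4 * T / x\<^sup>2 * \<bar>defect h z\<bar>" using s by simp
      ultimately show ?thesis by (simp add: mult.commute)
    next
      case False
      have "(x/2)\<^sup>2 \<le> (z - x)\<^sup>2" using False x by (intro abs_le_square_iff[THEN iffD1]) auto
      then have "x\<^sup>2 / 4 \<le> s\<^sup>2 + (z - x)\<^sup>2" by (simp add: power2_eq_square add_increasing)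
      then have "s / (s\<^sup>2 + (z - x)\<^sup>2) \<le> T / (x\<^sup>2 / 4)" using x s by (intro frac_le) auto
      moreover have "cauchy_kernel s (z - x) \<le> s / (s\<^sup>2 + (z - x)\<^sup>2)"
      proof -
        have "1 / pi * (s / (s\<^sup>2 + (z - x)\<^sup>2)) \<le> 1 * (s / (s\<^sup>2 + (z - x)\<^sup>2))"
          using s pi_gt3 by (intro mult_right_mono) auto
        then show ?thesis by (simp add: cauchy_kernel_def)
      qed
      ultimately have "cauchy_kernel s (z - x) \<le> 4 * T / x\<^sup>2" by (simp add: mult.commute)
      then have "cauchy_kernel s (z - x) * \<bar>defect h z\<bar> \<le> 4 * T / x\<^sup>2 * \<bar>defect h z\<bar>" by (intro mult_right_mono) auto
      moreover have "0 \<le> 32 * h\<^sup>2 / x\<^sup>2 * cauchy_kernel s (z - x)" using cn[of "z - x"] by simp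
      ultimately show ?thesis by linarith
    qed
    then have "ennreal (cauchy_kernel s (z - x) * \<bar>defect h z\<bar>) \<le> ennreal (4 * T / x\<^sup>2 * \<bar>defect h z\<bar> + 32 * h\<^sup>2 / x\<^sup>2 * cauchy_kernel s (z - x))"
      by (rule ennreal_leI)
    also have "\<dots> = ennreal (4 * T / x\<^sup>2) * ennreal \<bar>defect h z\<bar> + ennreal (32 * h\<^sup>2 / x\<^sup>2) * ennreal (cauchy_kernel s (z - x))"
    proof -
      have "ennreal (4 * T / x\<^sup>2 * \<bar>defect h z\<bar>) = ennreal (4 * T / x\<^sup>2) * ennreal \<bar>defect h z\<bar>"
        by (rule ennreal_mult) (use s in auto)
      moreover have "ennreal (32 * h\<^sup>2 / x\<^sup>2 * cauchy_kernel s (z - x)) = ennreal (32 * h\<^sup>2 / x\<^sup>2) * ennreal (cauchy_kernel s (z - x))"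
        by (rule ennreal_mult) (use cn in auto)
      moreover have "ennreal (4 * T / x\<^sup>2 * \<bar>defect h z\<bar> + 32 * h\<^sup>2 / x\<^sup>2 * cauchy_kernel s (z - x)) = ennreal (4 * T / x\<^sup>2 * \<bar>defect h z\<bar>) + ennreal (32 * h\<^sup>2 / x\<^sup>2 * cauchy_kernel s (z - x))"
        by (rule ennreal_plus) (use s cn in auto)
      ultimately show ?thesis by (simp only:)
    qed
    finally show "ennreal (cauchy_kernel s (z - x) * \<bar>defect h z\<bar>) \<le> ennreal (4 * T / x\<^sup>2) * ennreal \<bar>defect h z\<bar> + ennreal (32 * h\<^sup>2 / x\<^sup>2) * ennreal (cauchy_kernel s (z - x))" .
  qed
  also have "\<dots> = ennreal (4 * T / x\<^sup>2) * (\<integral>\<^sup>+z. ennreal \<bar>defect h z\<bar> \<partial>lborel_pos) + ennreal (32 * h\<^sup>2 / x\<^sup>2) * (\<integral>\<^sup>+z. ennreal (cauchy_kernel s (z - x)) \<partial>lborel_pos)"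
    using m mk by (subst nn_integral_add) (auto simp: nn_integral_cmult)
  also have "\<dots> \<le> ennreal (4 * T / x\<^sup>2) * ennreal (defect_mass h) + ennreal (32 * h\<^sup>2 / x\<^sup>2) * 1"
  proof (intro add_mono mult_left_mono defect_L1 h)
    have "(\<integral>\<^sup>+z. ennreal (cauchy_kernel s (z - x)) \<partial>lborel_pos) \<le> (\<integral>\<^sup>+z. ennreal (cauchy_kernel s (z - x)) \<partial>lborel)"
      unfolding nn_integral_lborel_pos by (intro nn_integral_mono) (auto simp: indicator_def)
    then show "(\<integral>\<^sup>+z. ennreal (cauchy_kernel s (z - x)) \<partial>lborel_pos) \<le> 1" using cauchy_kernel_total[OF s(1)] by simp
  qed auto
  also have "\<dots> = ennreal (4 * T / x\<^sup>2 * defect_mass h + 32 * h\<^sup>2 / x\<^sup>2)"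
  proof -
    have "ennreal (4 * T / x\<^sup>2 * defect_mass h) = ennreal (4 * T / x\<^sup>2) * ennreal (defect_mass h)"
      by (rule ennreal_mult) (use s defect_mass_nonneg in auto)
    moreover have "ennreal (4 * T / x\<^sup>2 * defect_mass h + 32 * h\<^sup>2 / x\<^sup>2) = ennreal (4 * T / x\<^sup>2 * defect_mass h) + ennreal (32 * h\<^sup>2 / x\<^sup>2)"
      by (rule ennreal_plus) (use s defect_mass_nonneg in auto)
    ultimately show ?thesis by (simp only: mult_1_right)
  qed
  finally show ?thesis .
qed

lemma cauchy_kernel_scale: "c > 0 \<Longrightarrow> y > 0 \<Longrightarrow> c * cauchy_kernel (c * y) (c * u) = cauchy_kernel y u"
proof -
  assume c: "c > 0" "y > 0"
  have "(c * y)\<^sup>2 + (c * u)\<^sup>2 = (c * c) * (y\<^sup>2 + u\<^sup>2)" by (simp add: power2_eq_square algebra_simps)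
  then show ?thesis using c unfolding cauchy_kernel_def by simp
qed

lemma poisson_defect_scaled:
  assumes mu: "\<mu> > 0" and h: "h > 0"
  shows "(\<integral>z. cauchy_kernel h (z - x) * psi_ext (\<mu> * z) \<partial>lborel) = exp (- \<mu> * h) * psi_ext (\<mu> * x) + defect (\<mu> * h) (\<mu> * x)"
proof -
  have "(\<integral>z. cauchy_kernel (\<mu> * h) (z - \<mu> * x) * psi_ext z \<partial>lborel) = \<bar>\<mu>\<bar> *\<^sub>R (\<integral>z. cauchy_kernel (\<mu> * h) (0 + \<mu> * z - \<mu> * x) * psi_ext (0 + \<mu> * z) \<partial>lborel)"
    by (rule lborel_integral_real_affine) (use mu in auto)
  also have "\<dots> = (\<integral>z. \<mu> * (cauchy_kernel (\<mu> * h) (\<mu> * (z - x)) * psi_ext (\<mu> * z)) \<partial>lborel)"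
    unfolding Bochner_Integration.integral_mult_right_zero using mu by (simp add: right_diff_distrib)
  also have "\<dots> = (\<integral>z. cauchy_kernel h (z - x) * psi_ext (\<mu> * z) \<partial>lborel)"
    unfolding mult.assoc[symmetric] cauchy_kernel_scale[OF mu h] ..
  finally show ?thesis by (simp add: defect_def)
qed

lemma defect_expectation_scaled:
  assumes mu: "\<mu> > 0" and x: "x > 0" and s: "0 < s" "s \<le> T" and h: "h > 0"
  shows "(\<integral>\<^sup>+z. ennreal (cauchy_kernel s (z - x) * \<bar>defect (\<mu> * h) (\<mu> * z)\<bar>) \<partial>lborel_pos)
    \<le> ennreal (4 * (\<mu> * T) / (\<mu> * x)\<^sup>2 * defect_mass (\<mu> * h) + 32 * (\<mu> * h)\<^sup>2 / (\<mu> * x)\<^sup>2)"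
proof -
  let ?f = "\<lambda>z. ennreal (cauchy_kernel (\<mu> * s) (z - \<mu> * x) * \<bar>defect (\<mu> * h) z\<bar>) * indicator {0<..} z"
  have "(\<integral>\<^sup>+z. ?f z \<partial>lborel) = ennreal \<bar>\<mu>\<bar> * (\<integral>\<^sup>+z. ?f (0 + \<mu> * z) \<partial>lborel)"
    by (rule nn_integral_real_affine) (use mu in auto)
  also have "\<dots> = (\<integral>\<^sup>+z. ennreal \<bar>\<mu>\<bar> * ?f (0 + \<mu> * z) \<partial>lborel)"
    by (rule nn_integral_cmult[symmetric]) measurable
  also have "\<dots> = (\<integral>\<^sup>+z. ennreal (cauchy_kernel s (z - x) * \<bar>defect (\<mu> * h) (\<mu> * z)\<bar>) * indicator {0<..} z \<partial>lborel)"
  proof (rule nn_integral_cong)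
    fix z
    have ind: "indicator {0<..} (0 + \<mu> * z) = (indicator {0<..} z :: ennreal)" using mu by (auto simp: indicator_def zero_less_mult_iff)
    have "ennreal \<bar>\<mu>\<bar> * ennreal (cauchy_kernel (\<mu> * s) (0 + \<mu> * z - \<mu> * x) * \<bar>defect (\<mu> * h) (0 + \<mu> * z)\<bar>)
        = ennreal (\<mu> * cauchy_kernel (\<mu> * s) (\<mu> * (z - x)) * \<bar>defect (\<mu> * h) (\<mu> * z)\<bar>)"
      using mu by (simp add: ennreal_mult'[symmetric] right_diff_distrib mult.assoc)
    then show "ennreal \<bar>\<mu>\<bar> * ?f (0 + \<mu> * z) = ennreal (cauchy_kernel s (z - x) * \<bar>defect (\<mu> * h) (\<mu> * z)\<bar>) * indicator {0<..} z"
      unfolding ind mult.assoc[symmetric] cauchy_kernel_scale[OF mu s(1)] by simp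
  qed
  finally have "(\<integral>\<^sup>+z. ennreal (cauchy_kernel s (z - x) * \<bar>defect (\<mu> * h) (\<mu> * z)\<bar>) \<partial>lborel_pos) = (\<integral>\<^sup>+z. ennreal (cauchy_kernel (\<mu> * s) (z - \<mu> * x) * \<bar>defect (\<mu> * h) z\<bar>) \<partial>lborel_pos)"
    unfolding nn_integral_lborel_pos by simp
  also have "\<dots> \<le> ennreal (4 * (\<mu> * T) / (\<mu> * x)\<^sup>2 * defect_mass (\<mu> * h) + 32 * (\<mu> * h)\<^sup>2 / (\<mu> * x)\<^sup>2)"
    by (rule defect_expectation) (use mu x s h in auto)
  finally show ?thesis .
qed

lemma r_fun_continuous: "continuous_on {0<..} r_fun"
proof -
  have "\<forall>x\<in>{0..}. continuous (at x within {0..}) r_fun"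
  proof
    fix x :: real assume x: "x \<in> {0..}"
    show "continuous (at x within {0..}) r_fun"
      unfolding continuous_within_sequentially comp_def
    proof (intro allI impI)
      fix u assume u: "(\<forall>n. u n \<in> {0..}) \<and> u \<longlonglongrightarrow> x"
      show "(\<lambda>n. r_fun (u n)) \<longlonglongrightarrow> r_fun x"
        unfolding r_fun_eq
      proof (rule integral_dominated_convergence[where w=rho])
        show "(\<lambda>t. rho t * exp (- t * x)) \<in> borel_measurable lborel_pos" "(\<lambda>t. rho t * exp (- t * u n)) \<in> borel_measurable lborel_pos" for n
          by (intro borel_measurable_lborel_pos; measurable)+
        show "AE t in lborel_pos. (\<lambda>n. rho t * exp (- t * u n)) \<longlonglongrightarrow> rho t * exp (- t * x)"
          by (intro AE_I2 tendsto_intros) (use u in auto)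
        show "AE t in lborel_pos. norm (rho t * exp (- t * u n)) \<le> rho t" for n
          by (rule AE_I2) (use u rho_nonneg in \<open>auto simp: abs_mult mult_left_le\<close>)
      qed (rule integrable_rho)
    qed
  qed
  then have "continuous_on {0..} r_fun" by (simp add: continuous_on_eq_continuous_within)
  then show ?thesis by (rule continuous_on_subset) auto
qed

lemma defect_bounded: assumes "h > 0" shows "\<bar>defect h z\<bar> \<le> 2 * psi_sup"
proof -
  have i: "integrable lborel (\<lambda>w. cauchy_kernel h (w - z) * psi_ext w)"
    by (rule cauchy_kernel_bounded_integrable[OF assms _ psi_ext_bound]) measurable
  have P: "psi_sup \<ge> 0" using psi_ext_bound[of 0] by (rule order_trans[OF abs_ge_zero])
  have "norm (\<integral>w. cauchy_kernel h (w - z) * psi_ext w \<partial>lborel) \<le> (\<integral>w. cauchy_kernel h (w - z) * psi_sup \<partial>lborel)"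
  proof (rule Bochner_Integration.integral_norm_bound_integral[OF i])
    show "integrable lborel (\<lambda>w. cauchy_kernel h (w - z) * psi_sup)" by (intro integrable_mult_left cauchy_kernel_integrable assms)
    show "norm (cauchy_kernel h (w - z) * psi_ext w) \<le> cauchy_kernel h (w - z) * psi_sup" for w
      using psi_ext_bound[of w] cauchy_kernel_pos[OF assms, of "w - z"] by (simp add: abs_mult mult_left_mono)
  qed
  also have "\<dots> = psi_sup"
  proof -
    have "ennreal (\<integral>w. cauchy_kernel h (w - z) \<partial>lborel) = 1"
      using nn_integral_eq_integral[OF cauchy_kernel_integrable[OF assms, of z]] cauchy_kernel_total[OF assms, of z] cauchy_kernel_pos[OF assms]
      by (auto intro: less_imp_le)
    then have "(\<integral>w. cauchy_kernel h (w - z) \<partial>lborel) = 1" by simp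
    then show ?thesis by simp
  qed
  finally have 1: "\<bar>\<integral>w. cauchy_kernel h (w - z) * psi_ext w \<partial>lborel\<bar> \<le> psi_sup" by simp
  have "\<bar>exp (- h) * psi_ext z\<bar> \<le> 1 * psi_sup"
    unfolding abs_mult using psi_ext_bound[of z] assms by (intro mult_mono) auto
  then show ?thesis using 1 unfolding defect_def by linarith
qed

section \<open>The Cauchy process killed at grid times\<close>

text \<open>By independence the variable with the density can be integrated out first. It is presented as a function
\<open>e\<close> of \<open>V\<close>, so that \<open>U\<close> and \<open>V\<close> may both be vectors of increments.\<close>
lemma (in prob_space) indep_var_density_expectation:
  fixes F :: "'b \<times> real \<Rightarrow> real" and \<phi> :: "real \<Rightarrow> real"
  assumes ind: "indep_var S U S' V" and e[measurable]: "e \<in> borel_measurable S'"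
    and V: "distributed M lborel (\<lambda>\<omega>. e (V \<omega>)) (\<lambda>v. ennreal (\<phi> v))" and \<phi>: "\<And>v. \<phi> v \<ge> 0" "\<phi> \<in> borel_measurable borel"
    and F[measurable]: "F \<in> borel_measurable (S \<Otimes>\<^sub>M borel)" and C: "\<And>p. \<bar>F p\<bar> \<le> C"
  shows "expectation (\<lambda>\<omega>. F (U \<omega>, e (V \<omega>))) = expectation (\<lambda>\<omega>. \<integral>v. \<phi> v * F (U \<omega>, v) \<partial>lborel)"
proof -
  note [measurable] = \<phi>(2)
  have rv[measurable]: "random_variable S U" "random_variable S' V"
    using ind unfolding indep_var_distribution_eq by auto
  have eq: "distr M S U \<Otimes>\<^sub>M distr M S' V = distr M (S \<Otimes>\<^sub>M S') (\<lambda>x. (U x, V x))"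
    using ind unfolding indep_var_distribution_eq by auto
  interpret U: prob_space "distr M S U" by (rule prob_space_distr) measurable
  interpret V: prob_space "distr M S' V" by (rule prob_space_distr) measurable
  interpret UV: pair_prob_space "distr M S U" "distr M S' V" ..
  let ?G = "\<lambda>p. F (fst p, e (snd p))"
  have G [measurable]: "?G \<in> borel_measurable (S \<Otimes>\<^sub>M S')" by measurable
  have dV: "distr M borel (\<lambda>\<omega>. e (V \<omega>)) = density lborel (\<lambda>v. ennreal (\<phi> v))"
  proof -
    have "distr M borel (\<lambda>\<omega>. e (V \<omega>)) = distr M lborel (\<lambda>\<omega>. e (V \<omega>))" by (rule distr_cong) auto
    then show ?thesis using distributed_distr_eq_density[OF V] by simp
  qed
  have "expectation (\<lambda>\<omega>. F (U \<omega>, e (V \<omega>))) = (\<integral>p. ?G p \<partial>distr M (S \<Otimes>\<^sub>M S') (\<lambda>x. (U x, V x)))"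
    by (subst integral_distr) auto
  also have "\<dots> = (\<integral>p. ?G p \<partial>(distr M S U \<Otimes>\<^sub>M distr M S' V))" unfolding eq ..
  also have "\<dots> = (\<integral>u. (\<integral>v. ?G (u, v) \<partial>distr M S' V) \<partial>distr M S U)"
  proof (rule UV.integral_fst'[symmetric])
    show "integrable (distr M S U \<Otimes>\<^sub>M distr M S' V) ?G"
    proof (rule UV.integrable_const_bound[where B=C])
      show "?G \<in> borel_measurable (distr M S U \<Otimes>\<^sub>M distr M S' V)" by measurable
    qed (use C in auto)
  qed
  also have "\<dots> = (\<integral>u. (\<integral>v. \<phi> v * F (u, v) \<partial>lborel) \<partial>distr M S U)"
  proof (rule Bochner_Integration.integral_cong[OF refl])
    fix u assume u: "u \<in> space (distr M S U)"
    then have [measurable]: "(\<lambda>v. F (u, v)) \<in> borel_measurable borel" by simp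
    have "(\<integral>v. ?G (u, v) \<partial>distr M S' V) = expectation (\<lambda>\<omega>. F (u, e (V \<omega>)))"
      by (subst integral_distr) auto
    also have "\<dots> = (\<integral>v. F (u, v) \<partial>distr M borel (\<lambda>\<omega>. e (V \<omega>)))"
      by (subst integral_distr) auto
    also have "\<dots> = (\<integral>v. \<phi> v * F (u, v) \<partial>lborel)"
      unfolding dV by (subst integral_density) (use \<phi> in auto)
    finally show "(\<integral>v. ?G (u, v) \<partial>distr M S' V) = (\<integral>v. \<phi> v * F (u, v) \<partial>lborel)" .
  qed
  also have "\<dots> = expectation (\<lambda>\<omega>. \<integral>v. \<phi> v * F (U \<omega>, v) \<partial>lborel)"
    by (rule integral_distr) measurable
  finally show ?thesis .
qed

lemma (in prob_space) integrable_bounded: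
  fixes f :: "'a \<Rightarrow> real"
  assumes "f \<in> borel_measurable M" "\<And>\<omega>. \<bar>f \<omega>\<bar> \<le> C"
  shows "integrable M f"
  by (rule integrable_const_bound[where B=C]) (use assms in auto)

context cauchy_process_from
begin

text \<open>One increment is independent of the vector of all the others.\<close>
lemma increments_vector_indep:
  assumes \<tau>: "0 \<le> \<tau> 0" "strict_mono \<tau>" and k: "k < m"
  shows "indep_var (PiM ({..<m} - {k}) (\<lambda>_. borel)) (\<lambda>\<omega>. restrict (\<lambda>i. X (\<tau> (Suc i)) \<omega> - X (\<tau> i) \<omega>) ({..<m} - {k}))
     (PiM {k} (\<lambda>_. borel)) (\<lambda>\<omega>. restrict (\<lambda>i. X (\<tau> (Suc i)) \<omega> - X (\<tau> i) \<omega>) {k})"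
proof -
  let ?Y = "\<lambda>i \<omega>. X (\<tau> (Suc i)) \<omega> - X (\<tau> i) \<omega>"
  have "strict_mono_on {..m} \<tau>" using \<tau>(2) by (auto simp: strict_mono_on_def strict_mono_def)
  from indep_increments[OF \<tau>(1) this]
  have "indep_vars (\<lambda>_. borel) ?Y {..<m}" .
  then show ?thesis by (rule indep_var_restrict) (use k in auto)
qed

text \<open>Survival at the first \<open>k\<close> grid times of mesh \<open>h\<close>. Time \<open>0\<close> is left out, since the starting point is
positive almost surely.\<close>
definition positive_at :: "real \<Rightarrow> nat \<Rightarrow> 'a \<Rightarrow> bool" where
  "positive_at h k \<omega> \<longleftrightarrow> (\<forall>j\<in>{1..k}. X (real j * h) \<omega> > 0)"

lemma positive_at_measurable:
  assumes "h \<ge> 0" shows "Measurable.pred M (positive_at h k)"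
proof -
  have [measurable]: "X (real j * h) \<in> borel_measurable M" for j by (rule measurable_X) (use assms in simp)
  show ?thesis unfolding positive_at_def by measurable
qed

text \<open>The position at time \<open>k h\<close> and the event of survival are functions of the first \<open>k\<close> increments, so the last increment
can be integrated out against its density.\<close>
lemma markov_step:
  assumes h: "h > 0" and f[measurable]: "f \<in> borel_measurable borel" and C: "\<And>z. \<bar>f z\<bar> \<le> C"
  shows "expectation (\<lambda>\<omega>. of_bool (positive_at h k \<omega>) * f (X (real (Suc k) * h) \<omega>))
    = expectation (\<lambda>\<omega>. of_bool (positive_at h k \<omega>) * (\<integral>z. cauchy_kernel h (z - X (real k * h) \<omega>) * f z \<partial>lborel))"
proof -
  define \<tau> where "\<tau> i = real i * h" for i :: nat
  have \<tau>: "0 \<le> \<tau> 0" "strict_mono \<tau>" using h by (auto simp: \<tau>_def strict_mono_def)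
  define I where "I = {..<Suc k} - {k}"
  have I: "I = {..<k}" by (auto simp: I_def)
  define U where "U \<omega> = restrict (\<lambda>i. X (\<tau> (Suc i)) \<omega> - X (\<tau> i) \<omega>) I" for \<omega>
  define V where "V \<omega> = X (\<tau> (Suc k)) \<omega> - X (\<tau> k) \<omega>" for \<omega>
  define V' where "V' \<omega> = restrict (\<lambda>i. X (\<tau> (Suc i)) \<omega> - X (\<tau> i) \<omega>) {k}" for \<omega>
  have V': "V' \<omega> k = V \<omega>" for \<omega> by (simp add: V'_def V_def)
  have ind: "indep_var (PiM I (\<lambda>_. borel)) U (PiM {k} (\<lambda>_. borel)) V'"
    using increments_vector_indep[OF \<tau>, of k "Suc k"] unfolding U_def V'_def I_def by simp
  have ev: "(\<lambda>f. f k) \<in> borel_measurable (PiM {k} (\<lambda>_. borel))" by (rule measurable_component_singleton) simp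
  have V: "distributed M lborel V (\<lambda>v. ennreal (cauchy_kernel h v))"
    using increments_distributed[of "\<tau> k" "\<tau> (Suc k)"] h unfolding V_def by (simp add: \<tau>_def algebra_simps)
  define p where "p j u = x + (\<Sum>i<j. u i)" for j and u :: "nat \<Rightarrow> real"
  have p_meas [measurable]: "p j \<in> borel_measurable (PiM I (\<lambda>_. borel))" if "j \<le> k" for j
    unfolding p_def by (intro borel_measurable_add borel_measurable_const borel_measurable_sum measurable_component_singleton) (use that I in auto)
  define F where "F q = of_bool (\<forall>j\<in>{1..k}. p j (fst q) > 0) * f (p k (fst q) + snd q)" for q :: "(nat \<Rightarrow> real) \<times> real"
  have F_meas: "F \<in> borel_measurable (PiM I (\<lambda>_. borel) \<Otimes>\<^sub>M borel)"
  proof -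
    have [measurable]: "(\<lambda>q. p j (fst q)) \<in> borel_measurable (PiM I (\<lambda>_. borel) \<Otimes>\<^sub>M borel)" if "j \<le> k" for j
      by (rule measurable_compose[OF measurable_fst p_meas[OF that]])
    have "Measurable.pred (PiM I (\<lambda>_. borel) \<Otimes>\<^sub>M borel) (\<lambda>q. \<forall>j\<in>{1..k}. p j (fst q) > 0)"
      by (intro pred_intros_finite) auto
    moreover have "(\<lambda>q. f (p k (fst q) + snd q)) \<in> borel_measurable (PiM I (\<lambda>_. borel) \<Otimes>\<^sub>M borel)" by measurable
    ultimately show ?thesis unfolding F_def by measurable
  qed
  have F_bd: "\<bar>F q\<bar> \<le> \<bar>C\<bar>" for q using C[of "p k (fst q) + snd q"] by (auto simp: F_def abs_mult)
  have pos: "cauchy_kernel h v \<ge> 0" for v using cauchy_kernel_pos[OF h, of v] by simp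
  note main = indep_var_density_expectation[OF ind ev, unfolded V', OF V pos cauchy_kernel_measurable F_meas F_bd]
  have pX: "p j (U \<omega>) = X (real j * h) \<omega>" if "X 0 \<omega> = x" "j \<le> k" for j \<omega>
  proof -
    have "(\<Sum>i<j. U \<omega> i) = (\<Sum>i<j. X (\<tau> (Suc i)) \<omega> - X (\<tau> i) \<omega>)"
      by (rule sum.cong) (use that I in \<open>auto simp: U_def\<close>)
    also have "\<dots> = X (\<tau> j) \<omega> - X (\<tau> 0) \<omega>" by (rule sum_lessThan_telescope)
    finally show ?thesis using that by (simp add: p_def \<tau>_def)
  qed
  have XV: "X (real (Suc k) * h) \<omega> = X (real k * h) \<omega> + V \<omega>" for \<omega> by (simp add: V_def \<tau>_def)
  have rvX [measurable]: "X (real j * h) \<in> borel_measurable M" for j by (rule measurable_X) (use h in simp)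
  have [measurable]: "Measurable.pred M (positive_at h k)" by (rule positive_at_measurable) (use h in simp)
  have [measurable]: "V \<in> borel_measurable M" unfolding V_def \<tau>_def by measurable
  have rvU [measurable]: "U \<in> measurable M (PiM I (\<lambda>_. borel))"
    using ind unfolding indep_var_distribution_eq by auto
  have posU: "positive_at h k \<omega> \<longleftrightarrow> (\<forall>j\<in>{1..k}. p j (U \<omega>) > 0)" if "X 0 \<omega> = x" for \<omega>
    unfolding positive_at_def using pX[OF that] by auto
  have "expectation (\<lambda>\<omega>. of_bool (positive_at h k \<omega>) * f (X (real (Suc k) * h) \<omega>)) = expectation (\<lambda>\<omega>. F (U \<omega>, V \<omega>))"
  proof (rule integral_cong_AE)
    show "AE \<omega> in M. of_bool (positive_at h k \<omega>) * f (X (real (Suc k) * h) \<omega>) = F (U \<omega>, V \<omega>)"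
      using start by eventually_elim (simp add: F_def posU pX XV del: of_nat_Suc)
    show "(\<lambda>\<omega>. F (U \<omega>, V \<omega>)) \<in> borel_measurable M" 
      by (rule measurable_compose[OF _ F_meas]) measurable
  qed measurable
  also note main
  also have "expectation (\<lambda>\<omega>. \<integral>v. cauchy_kernel h v * F (U \<omega>, v) \<partial>lborel)
     = expectation (\<lambda>\<omega>. of_bool (positive_at h k \<omega>) * (\<integral>z. cauchy_kernel h (z - X (real k * h) \<omega>) * f z \<partial>lborel))"
  proof (rule integral_cong_AE)
    show "AE \<omega> in M. (\<integral>v. cauchy_kernel h v * F (U \<omega>, v) \<partial>lborel)
      = of_bool (positive_at h k \<omega>) * (\<integral>z. cauchy_kernel h (z - X (real k * h) \<omega>) * f z \<partial>lborel)"
      using start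
    proof eventually_elim
      fix \<omega> assume \<omega>: "X 0 \<omega> = x"
      have "(\<integral>v. cauchy_kernel h v * F (U \<omega>, v) \<partial>lborel) = (\<integral>v. of_bool (positive_at h k \<omega>) * (cauchy_kernel h v * f (X (real k * h) \<omega> + v)) \<partial>lborel)"
        by (simp add: F_def posU[OF \<omega>] pX[OF \<omega>] mult.left_commute)
      also have "\<dots> = of_bool (positive_at h k \<omega>) * (\<integral>v. cauchy_kernel h v * f (X (real k * h) \<omega> + v) \<partial>lborel)"
        by (rule Bochner_Integration.integral_mult_right_zero)
      also have "(\<integral>v. cauchy_kernel h v * f (X (real k * h) \<omega> + v) \<partial>lborel) = (\<integral>z. cauchy_kernel h (z - X (real k * h) \<omega>) * f z \<partial>lborel)"
        using lborel_integral_real_affine[of 1 "\<lambda>z. cauchy_kernel h (z - X (real k * h) \<omega>) * f z" "X (real k * h) \<omega>"] by simp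
      finally show "(\<integral>v. cauchy_kernel h v * F (U \<omega>, v) \<partial>lborel)
        = of_bool (positive_at h k \<omega>) * (\<integral>z. cauchy_kernel h (z - X (real k * h) \<omega>) * f z \<partial>lborel)" .
    qed
    have "(\<lambda>u. \<integral>v. cauchy_kernel h v * F (u, v) \<partial>lborel) \<in> borel_measurable (PiM I (\<lambda>_. borel))"
      using F_meas by measurable
    from measurable_compose[OF rvU this]
    show "(\<lambda>\<omega>. \<integral>v. cauchy_kernel h v * F (U \<omega>, v) \<partial>lborel) \<in> borel_measurable M" .
    have "(\<lambda>u. \<integral>z. cauchy_kernel h (z - u) * f z \<partial>lborel) \<in> borel_measurable borel"
      unfolding cauchy_kernel_def by measurable
    from measurable_compose[OF rvX[of k] this]
    have [measurable]: "(\<lambda>\<omega>. \<integral>z. cauchy_kernel h (z - X (real k * h) \<omega>) * f z \<partial>lborel) \<in> borel_measurable M" .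
    show "(\<lambda>\<omega>. of_bool (positive_at h k \<omega>) * (\<integral>z. cauchy_kernel h (z - X (real k * h) \<omega>) * f z \<partial>lborel)) \<in> borel_measurable M"
      by measurable
  qed
  finally show ?thesis .
qed

text \<open>The bound on the error made in one step of length \<open>h\<close>, for the starting point \<open>x\<close> and the parameter \<open>\<mu>\<close>.\<close>
definition step_error :: "real \<Rightarrow> real \<Rightarrow> real \<Rightarrow> real" where
  "step_error \<mu> T h = 4 * (\<mu> * T) / (\<mu> * x)\<^sup>2 * defect_mass (\<mu> * h) + 32 * (\<mu> * h)\<^sup>2 / (\<mu> * x)\<^sup>2"

lemma step_error_nonneg: "\<mu> > 0 \<Longrightarrow> T \<ge> 0 \<Longrightarrow> step_error \<mu> T h \<ge> 0"
  unfolding step_error_def by (intro add_nonneg_nonneg mult_nonneg_nonneg divide_nonneg_nonneg defect_mass_nonneg) auto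

lemma step_error_bound:
  assumes x: "x > 0" and mu: "\<mu> > 0" and h: "h > 0" and T: "real k * h \<le> T"
  shows "expectation (\<lambda>\<omega>. of_bool (positive_at h k \<omega>) * \<bar>defect (\<mu> * h) (\<mu> * X (real k * h) \<omega>)\<bar>) \<le> step_error \<mu> T h"
proof (cases "k = 0")
  case True
  have mh: "\<mu> * h > 0" using mu h by simp
  have T0: "T \<ge> 0" using True T by simp
  have "expectation (\<lambda>\<omega>. of_bool (positive_at h k \<omega>) * \<bar>defect (\<mu> * h) (\<mu> * X (real k * h) \<omega>)\<bar>) = expectation (\<lambda>\<omega>. \<bar>defect (\<mu> * h) (\<mu> * x)\<bar>)"
  proof (rule integral_cong_AE)
    have [measurable]: "X 0 \<in> borel_measurable M" by (rule measurable_X) simp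
    have [measurable]: "Measurable.pred M (positive_at h 0)" by (rule positive_at_measurable) (use h in simp)
    show "(\<lambda>\<omega>. of_bool (positive_at h k \<omega>) * \<bar>defect (\<mu> * h) (\<mu> * X (real k * h) \<omega>)\<bar>) \<in> borel_measurable M"
      unfolding True of_nat_0 mult_zero_left by measurable
    show "AE \<omega> in M. of_bool (positive_at h k \<omega>) * \<bar>defect (\<mu> * h) (\<mu> * X (real k * h) \<omega>)\<bar> = \<bar>defect (\<mu> * h) (\<mu> * x)\<bar>"
      using start by eventually_elim (simp add: True positive_at_def)
  qed simp
  also have "\<dots> = \<bar>defect (\<mu> * h) (\<mu> * x)\<bar>" by (simp add: prob_space)
  also have "\<dots> \<le> 8 * (\<mu> * h)\<^sup>2 / (\<mu> * x)\<^sup>2" by (rule defect_far) (use mu x mh in auto)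
  also have "\<dots> \<le> 32 * (\<mu> * h)\<^sup>2 / (\<mu> * x)\<^sup>2" by (intro divide_right_mono) auto
  also have "\<dots> \<le> step_error \<mu> T h" unfolding step_error_def using mu T0 defect_mass_nonneg[of "\<mu> * h"] by simp
  finally show ?thesis .
next
  case False
  define s where "s = real k * h"
  have s: "s > 0" "s \<le> T" using False h T by (auto simp: s_def)
  define g where "g z = ennreal (of_bool (x + z > 0) * \<bar>defect (\<mu> * h) (\<mu> * (x + z))\<bar>)" for z
  have g [measurable]: "g \<in> borel_measurable borel" unfolding g_def by measurable
  have [measurable]: "X s \<in> borel_measurable M" "X 0 \<in> borel_measurable M" by (rule measurable_X; use s in simp)+
  have [measurable]: "Measurable.pred M (positive_at h k)" by (rule positive_at_measurable) (use h in simp)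
  have d: "distributed M lborel (\<lambda>\<omega>. X s \<omega> - X 0 \<omega>) (\<lambda>y. ennreal (cauchy_kernel s y))"
    using increments_distributed[of 0 s] s by simp
  have "ennreal (expectation (\<lambda>\<omega>. of_bool (positive_at h k \<omega>) * \<bar>defect (\<mu> * h) (\<mu> * X s \<omega>)\<bar>))
      = (\<integral>\<^sup>+\<omega>. ennreal (of_bool (positive_at h k \<omega>) * \<bar>defect (\<mu> * h) (\<mu> * X s \<omega>)\<bar>) \<partial>M)"
  proof (rule nn_integral_eq_integral[symmetric])
    show "integrable M (\<lambda>\<omega>. of_bool (positive_at h k \<omega>) * \<bar>defect (\<mu> * h) (\<mu> * X s \<omega>)\<bar>)"
      using defect_bounded[of "\<mu> * h"] mu h order_trans[OF abs_ge_zero defect_bounded[of "\<mu> * h" 0]]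
      by (intro integrable_bounded[where C="2 * psi_sup"]) auto
  qed auto
  also have "\<dots> \<le> (\<integral>\<^sup>+\<omega>. g (X s \<omega> - X 0 \<omega>) \<partial>M)"
  proof (rule nn_integral_mono_AE)
    show "AE \<omega> in M. ennreal (of_bool (positive_at h k \<omega>) * \<bar>defect (\<mu> * h) (\<mu> * X s \<omega>)\<bar>) \<le> g (X s \<omega> - X 0 \<omega>)"
      using start
    proof eventually_elim
      fix \<omega> assume \<omega>: "X 0 \<omega> = x"
      have "positive_at h k \<omega> \<Longrightarrow> X s \<omega> > 0" using False unfolding positive_at_def s_def by auto
      then show "ennreal (of_bool (positive_at h k \<omega>) * \<bar>defect (\<mu> * h) (\<mu> * X s \<omega>)\<bar>) \<le> g (X s \<omega> - X 0 \<omega>)"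
        unfolding g_def \<omega> by (intro ennreal_leI) auto
    qed
  qed
  also have "\<dots> = (\<integral>\<^sup>+y. ennreal (cauchy_kernel s y) * g y \<partial>lborel)"
    by (rule distributed_nn_integral[OF d, symmetric]) measurable
  also have "\<dots> = (\<integral>\<^sup>+z. ennreal (cauchy_kernel s (z - x)) * g (z - x) \<partial>lborel)"
    using nn_integral_real_affine[of "\<lambda>y. ennreal (cauchy_kernel s y) * g y" 1 "-x"] by simp
  also have "\<dots> = (\<integral>\<^sup>+z. ennreal (cauchy_kernel s (z - x) * \<bar>defect (\<mu> * h) (\<mu> * z)\<bar>) \<partial>lborel_pos)"
    unfolding nn_integral_lborel_pos
  proof (rule nn_integral_cong)
    fix z
    show "ennreal (cauchy_kernel s (z - x)) * g (z - x) = ennreal (cauchy_kernel s (z - x) * \<bar>defect (\<mu> * h) (\<mu> * z)\<bar>) * indicator {0<..} z"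
      using cauchy_kernel_pos[OF s(1), of "z - x"] by (auto simp: g_def indicator_def ennreal_mult')
  qed
  also have "\<dots> \<le> ennreal (step_error \<mu> T h)"
    unfolding step_error_def by (rule defect_expectation_scaled[OF mu x s h])
  finally have "ennreal (expectation (\<lambda>\<omega>. of_bool (positive_at h k \<omega>) * \<bar>defect (\<mu> * h) (\<mu> * X s \<omega>)\<bar>)) \<le> ennreal (step_error \<mu> T h)" .
  moreover have "step_error \<mu> T h \<ge> 0" by (rule step_error_nonneg) (use mu s in auto)
  ultimately show ?thesis unfolding s_def by (simp add: ennreal_le_iff)
qed

text \<open>Errors add up and are not amplified, because \<open>exp (- \<mu> * h) \<le> 1\<close>. Survival at the next grid time need not be
recorded in the recursion, as the eigenfunction vanishes where the process would be killed.\<close>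
lemma discrete_eigen:
  assumes x: "x > 0" and mu: "\<mu> > 0" and h: "h > 0" and T: "real k * h \<le> T"
  shows "\<bar>expectation (\<lambda>\<omega>. of_bool (positive_at h k \<omega>) * psi_ext (\<mu> * X (real k * h) \<omega>)) - exp (- \<mu> * h * real k) * psi_ext (\<mu> * x)\<bar> \<le> real k * step_error \<mu> T h"
  using T
proof (induction k)
  case 0
  have "expectation (\<lambda>\<omega>. of_bool (positive_at h 0 \<omega>) * psi_ext (\<mu> * X (real 0 * h) \<omega>)) = expectation (\<lambda>\<omega>. psi_ext (\<mu> * x))"
  proof (rule integral_cong_AE)
    have [measurable]: "X 0 \<in> borel_measurable M" by (rule measurable_X) simp
    have [measurable]: "Measurable.pred M (positive_at h 0)" by (rule positive_at_measurable) (use h in simp)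
    show "(\<lambda>\<omega>. of_bool (positive_at h 0 \<omega>) * psi_ext (\<mu> * X (real 0 * h) \<omega>)) \<in> borel_measurable M"
      unfolding of_nat_0 mult_zero_left by measurable
    show "AE \<omega> in M. of_bool (positive_at h 0 \<omega>) * psi_ext (\<mu> * X (real 0 * h) \<omega>) = psi_ext (\<mu> * x)"
      using start by eventually_elim (simp add: positive_at_def)
  qed simp
  then show ?case by (simp add: prob_space)
next
  case (Suc k)
  have kT: "real k * h \<le> T" using Suc.prems h by (simp add: algebra_simps)
  let ?b = "\<lambda>k. expectation (\<lambda>\<omega>. of_bool (positive_at h k \<omega>) * psi_ext (\<mu> * X (real k * h) \<omega>))"
  let ?E = "\<lambda>\<omega>. of_bool (positive_at h k \<omega>) * defect (\<mu> * h) (\<mu> * X (real k * h) \<omega>)"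
  have mh: "\<mu> * h > 0" using mu h by simp
  have [measurable]: "X (real k * h) \<in> borel_measurable M" by (rule measurable_X) (use h in simp)
  have [measurable]: "Measurable.pred M (positive_at h k)" by (rule positive_at_measurable) (use h in simp)
  have P: "psi_sup \<ge> 0" using psi_ext_bound[of 0] by (rule order_trans[OF abs_ge_zero])
  have i1: "integrable M (\<lambda>\<omega>. of_bool (positive_at h k \<omega>) * psi_ext (\<mu> * X (real k * h) \<omega>))"
    by (rule integrable_bounded[where C=psi_sup]) (use psi_ext_bound P in auto)
  have i2: "integrable M ?E"
    by (rule integrable_bounded[where C="2 * psi_sup"]) (use defect_bounded[OF mh] P in auto)
  have "?b (Suc k) = expectation (\<lambda>\<omega>. of_bool (positive_at h k \<omega>) * psi_ext (\<mu> * X (real (Suc k) * h) \<omega>))"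
  proof (rule Bochner_Integration.integral_cong[OF refl])
    fix \<omega>
    show "of_bool (positive_at h (Suc k) \<omega>) * psi_ext (\<mu> * X (real (Suc k) * h) \<omega>) = of_bool (positive_at h k \<omega>) * psi_ext (\<mu> * X (real (Suc k) * h) \<omega>)"
    proof (cases "X (real (Suc k) * h) \<omega> > 0")
      case True
      then have "positive_at h (Suc k) \<omega> = positive_at h k \<omega>"
        unfolding positive_at_def by (auto simp: atLeastAtMostSuc_conv)
      then show ?thesis by simp
    next
      case False
      then have "psi_ext (\<mu> * X (real (Suc k) * h) \<omega>) = 0" using mu by (simp add: psi_ext_def zero_less_mult_iff)
      then show ?thesis by simp
    qed
  qed
  also have "\<dots> = expectation (\<lambda>\<omega>. of_bool (positive_at h k \<omega>) * (\<integral>z. cauchy_kernel h (z - X (real k * h) \<omega>) * psi_ext (\<mu> * z) \<partial>lborel))"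
    by (rule markov_step[OF h _ psi_ext_bound]) measurable
  also have "\<dots> = expectation (\<lambda>\<omega>. exp (- \<mu> * h) * (of_bool (positive_at h k \<omega>) * psi_ext (\<mu> * X (real k * h) \<omega>)) + ?E \<omega>)"
    unfolding poisson_defect_scaled[OF mu h] by (simp add: algebra_simps)
  also have "\<dots> = exp (- \<mu> * h) * ?b k + expectation ?E"
    using i1 i2 by (subst Bochner_Integration.integral_add) auto
  finally have rec: "?b (Suc k) = exp (- \<mu> * h) * ?b k + expectation ?E" .
  have "\<bar>expectation ?E\<bar> \<le> expectation (\<lambda>\<omega>. \<bar>?E \<omega>\<bar>)" by (rule integral_abs_bound)
  also have "\<dots> \<le> step_error \<mu> T h"
    using step_error_bound[OF x mu h kT] by (simp add: abs_mult)
  finally have 1: "\<bar>expectation ?E\<bar> \<le> step_error \<mu> T h" .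
  have e1: "exp (- \<mu> * h) \<le> 1" using mh by simp
  have "exp (- \<mu> * h * real (Suc k)) = exp (- \<mu> * h) * exp (- \<mu> * h * real k)"
    by (simp add: exp_add[symmetric] algebra_simps)
  then have "?b (Suc k) - exp (- \<mu> * h * real (Suc k)) * psi_ext (\<mu> * x) = exp (- \<mu> * h) * (?b k - exp (- \<mu> * h * real k) * psi_ext (\<mu> * x)) + expectation ?E"
    unfolding rec by (simp add: algebra_simps)
  then have "\<bar>?b (Suc k) - exp (- \<mu> * h * real (Suc k)) * psi_ext (\<mu> * x)\<bar> \<le> exp (- \<mu> * h) * \<bar>?b k - exp (- \<mu> * h * real k) * psi_ext (\<mu> * x)\<bar> + \<bar>expectation ?E\<bar>"
    by (simp only:) (rule order_trans[OF abs_triangle_ineq], simp add: abs_mult)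
  also have "\<dots> \<le> 1 * (real k * step_error \<mu> T h) + step_error \<mu> T h"
    using Suc.IH[OF kT] e1 1 by (intro add_mono mult_mono) auto
  also have "\<dots> = real (Suc k) * step_error \<mu> T h" by (simp add: algebra_simps)
  finally show ?case .
qed

end

section \<open>From grid times to the exit time\<close>

text \<open>The times are the multiples of \<open>T / 2^(m+n)\<close> in \<open>[T/2^m, T]\<close>.\<close>
definition touches_zero :: "real \<Rightarrow> nat \<Rightarrow> (real \<Rightarrow> real) \<Rightarrow> bool" where
  "touches_zero T m w \<longleftrightarrow>
     (\<forall>n. \<forall>i\<le>2^(m+n) - 2^n. w (T / 2^m + real i * (T / 2^(m+n))) > 0) \<and>
     (\<forall>k. \<exists>n. \<exists>i\<le>2^(m+n) - 2^n. w (T / 2^m + real i * (T / 2^(m+n))) < 1 / real (Suc k))"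

context cauchy_process_from
begin

text \<open>The minimum of the positions is \<open>x\<close> plus the first increment plus a function \<open>L\<close> of the later ones. Given the later
increments it falls into \<open>(0, \<delta>)\<close> exactly if the first increment falls into an interval of length \<open>\<delta>\<close>, and its
density is at most \<open>1 / \<epsilon>\<close>. The bound does not depend on the number of times.\<close>
lemma rare_near_zero:
  fixes m :: nat
  assumes \<epsilon>: "\<epsilon> > 0" and d: "d > 0" and \<delta>: "\<delta> > 0"
  shows "prob {\<omega>\<in>space M. (\<forall>i\<in>{..m}. X (\<epsilon> + real i * d) \<omega> > 0) \<and> (\<exists>i\<in>{..m}. X (\<epsilon> + real i * d) \<omega> < \<delta>)} \<le> \<delta> / \<epsilon>"
    (is "prob ?E \<le> _")
proof -
  \<comment> \<open>The first increment is over \<open>[0, \<epsilon>]\<close>; it is the one that is integrated out.\<close>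
  define \<tau> where "\<tau> i = (case i of 0 \<Rightarrow> 0 | Suc j \<Rightarrow> \<epsilon> + real j * d)" for i
  have \<tau>0: "0 \<le> \<tau> 0" by (simp add: \<tau>_def)
  have \<tau>m: "strict_mono \<tau>"
    unfolding strict_mono_Suc_iff using \<epsilon> d by (auto simp: \<tau>_def algebra_simps split: nat.split)
  define I where "I = {..<Suc m} - {0}"
  have I: "I = {1..m}" by (auto simp: I_def)
  define U where "U \<omega> = restrict (\<lambda>i. X (\<tau> (Suc i)) \<omega> - X (\<tau> i) \<omega>) I" for \<omega>
  define V where "V \<omega> = X \<epsilon> \<omega> - X 0 \<omega>" for \<omega>
  define V' where "V' \<omega> = restrict (\<lambda>i. X (\<tau> (Suc i)) \<omega> - X (\<tau> i) \<omega>) {0}" for \<omega>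
  have V': "V' \<omega> 0 = V \<omega>" for \<omega> by (simp add: V'_def V_def \<tau>_def)
  have ind: "indep_var (PiM I (\<lambda>_. borel)) U (PiM {0} (\<lambda>_. borel)) V'"
    using increments_vector_indep[OF \<tau>0 \<tau>m, of 0 "Suc m"] unfolding U_def V'_def I_def by simp
  have ev: "(\<lambda>f. f 0) \<in> borel_measurable (PiM {0::nat} (\<lambda>_. borel))" by (rule measurable_component_singleton) simp
  have V: "distributed M lborel V (\<lambda>v. ennreal (cauchy_kernel \<epsilon> v))"
    using increments_distributed[of 0 \<epsilon>] \<epsilon> unfolding V_def by simp
  define p where "p j u = (\<Sum>i\<in>{1..j}. u i)" for j and u :: "nat \<Rightarrow> real"
  have p_meas: "p j \<in> borel_measurable (PiM I (\<lambda>_. borel))" if "j \<le> m" for j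
    unfolding p_def by (intro borel_measurable_sum measurable_component_singleton) (use that I in auto)
  define F where "F q = (of_bool ((\<forall>j\<in>{..m}. x + snd q + p j (fst q) > 0) \<and> (\<exists>j\<in>{..m}. x + snd q + p j (fst q) < \<delta>)) :: real)" for q :: "(nat \<Rightarrow> real) \<times> real"
  have F_meas: "F \<in> borel_measurable (PiM I (\<lambda>_. borel) \<Otimes>\<^sub>M borel)"
  proof -
    have [measurable]: "(\<lambda>q. p j (fst q)) \<in> borel_measurable (PiM I (\<lambda>_. borel) \<Otimes>\<^sub>M borel)" if "j \<le> m" for j
      by (rule measurable_compose[OF measurable_fst p_meas[OF that]])
    have "Measurable.pred (PiM I (\<lambda>_. borel) \<Otimes>\<^sub>M borel) (\<lambda>q. \<forall>j\<in>{..m}. x + snd q + p j (fst q) > 0)"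
      "Measurable.pred (PiM I (\<lambda>_. borel) \<Otimes>\<^sub>M borel) (\<lambda>q. \<exists>j\<in>{..m}. x + snd q + p j (fst q) < \<delta>)"
      by (intro pred_intros_finite; auto)+
    then show ?thesis unfolding F_def by measurable
  qed
  have F_bd: "\<bar>F q\<bar> \<le> 1" for q by (simp add: F_def)
  have pos: "cauchy_kernel \<epsilon> v \<ge> 0" for v using cauchy_kernel_pos[OF \<epsilon>, of v] by simp
  have max: "cauchy_kernel \<epsilon> v \<le> 1 / \<epsilon>" for v
  proof -
    have "\<epsilon> / (\<epsilon>\<^sup>2 + v\<^sup>2) \<le> 1 / \<epsilon>" using \<epsilon> by (simp add: divide_simps power2_eq_square add_pos_nonneg)
    moreover have "1 / pi * (\<epsilon> / (\<epsilon>\<^sup>2 + v\<^sup>2)) \<le> 1 * (\<epsilon> / (\<epsilon>\<^sup>2 + v\<^sup>2))"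
      using \<epsilon> pi_gt3 by (intro mult_right_mono) auto
    ultimately show ?thesis by (simp add: cauchy_kernel_def)
  qed
  note main = indep_var_density_expectation[OF ind ev, unfolded V', OF V pos cauchy_kernel_measurable F_meas F_bd]
  have rvX: "X s \<in> borel_measurable M" if "s \<ge> 0" for s by (rule measurable_X[OF that])
  have [measurable]: "X (\<epsilon> + real i * d) \<in> borel_measurable M" for i by (rule rvX) (use \<epsilon> d in simp)
  have rvU: "U \<in> measurable M (PiM I (\<lambda>_. borel))" using ind unfolding indep_var_distribution_eq by auto
  have rvV: "V \<in> borel_measurable M" unfolding V_def using \<epsilon> by (intro borel_measurable_diff rvX) auto
  have pX: "x + V \<omega> + p j (U \<omega>) = X (\<epsilon> + real j * d) \<omega>" if "X 0 \<omega> = x" "j \<le> m" for j \<omega>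
  proof -
    have "p j (U \<omega>) = (\<Sum>i\<in>{1..j}. X (\<tau> (Suc i)) \<omega> - X (\<tau> i) \<omega>)"
      unfolding p_def by (rule sum.cong) (use that I in \<open>auto simp: U_def\<close>)
    also have "\<dots> = X (\<tau> (Suc j)) \<omega> - X (\<tau> 1) \<omega>" by (rule sum_Suc_diff) simp
    finally show ?thesis using that by (simp add: V_def \<tau>_def)
  qed
  have "prob ?E = expectation (indicator ?E)" by simp
  also have "\<dots> = expectation (\<lambda>\<omega>. F (U \<omega>, V \<omega>))"
  proof (rule integral_cong_AE)
    show "(\<lambda>\<omega>. F (U \<omega>, V \<omega>)) \<in> borel_measurable M"
      by (rule measurable_compose[OF _ F_meas]) (intro measurable_Pair rvU rvV)
    show "AE \<omega> in M. indicator ?E \<omega> = F (U \<omega>, V \<omega>)"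
      using start AE_space[of M]
    proof eventually_elim
      fix \<omega> assume "X 0 \<omega> = x" "\<omega> \<in> space M"
      then show "indicator ?E \<omega> = F (U \<omega>, V \<omega>)" by (simp add: F_def pX indicator_def)
    qed
  qed measurable
  also have "\<dots> = expectation (\<lambda>\<omega>. \<integral>v. cauchy_kernel \<epsilon> v * F (U \<omega>, v) \<partial>lborel)" by (rule main)
  also have "\<dots> \<le> \<delta> / \<epsilon>"
  proof (rule integral_le_const)
    have inner: "0 \<le> (\<integral>v. cauchy_kernel \<epsilon> v * F (u, v) \<partial>lborel) \<and> (\<integral>v. cauchy_kernel \<epsilon> v * F (u, v) \<partial>lborel) \<le> \<delta> / \<epsilon>"
      if u: "u \<in> space (PiM I (\<lambda>_. borel))" for u
    proof
      define L where "L = Min ((\<lambda>j. p j u) ` {..m})"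
      have Lmin: "L \<le> p j u" if "j \<le> m" for j unfolding L_def using that by (intro Min_le) auto
      have "L \<in> (\<lambda>j. p j u) ` {..m}" unfolding L_def by (rule Min_in) auto
      then obtain j0 where j0: "j0 \<le> m" "L = p j0 u" by auto
      have Fm: "(\<lambda>v. F (u, v)) \<in> borel_measurable borel" by (rule measurable_compose[OF measurable_Pair1'[OF u] F_meas])
      have F1: "cauchy_kernel \<epsilon> v * F (u, v) \<le> (1 / \<epsilon>) * indicator {- x - L .. - x - L + \<delta>} v" for v
      proof (cases "F (u, v) = 0")
        case False
        then have "\<forall>j\<in>{..m}. x + v + p j u > 0" "\<exists>j\<in>{..m}. x + v + p j u < \<delta>" by (auto simp: F_def split: if_splits)
        then have "x + v + L > 0" "x + v + L < \<delta>" using j0 Lmin by (auto intro: le_less_trans[OF add_left_mono])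
        then have "v \<in> {- x - L .. - x - L + \<delta>}" by auto
        moreover have "F (u, v) = 1" using False by (simp add: F_def)
        ultimately show ?thesis using max[of v] by simp
      next
        case True
        then show ?thesis using \<epsilon> by simp
      qed
      show "0 \<le> (\<integral>v. cauchy_kernel \<epsilon> v * F (u, v) \<partial>lborel)"
        by (rule Bochner_Integration.integral_nonneg) (use pos in \<open>simp add: F_def\<close>)
      have "(\<integral>v. cauchy_kernel \<epsilon> v * F (u, v) \<partial>lborel) \<le> (\<integral>v. (1 / \<epsilon>) * indicator {- x - L .. - x - L + \<delta>} v \<partial>lborel)"
      proof (rule integral_mono)
        show "integrable lborel (\<lambda>v. cauchy_kernel \<epsilon> v * F (u, v))"
          using cauchy_kernel_bounded_integrable[OF \<epsilon> Fm, of 1 0] F_bd by simp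
        show "integrable lborel (\<lambda>v. (1 / \<epsilon>) * indicator {- x - L .. - x - L + \<delta>} v)"
          by (intro integrable_mult_right integrable_real_indicator) (auto simp: emeasure_lborel_Icc_eq)
      qed (rule F1)
      also have "\<dots> = \<delta> / \<epsilon>" using \<delta> by simp
      finally show "(\<integral>v. cauchy_kernel \<epsilon> v * F (u, v) \<partial>lborel) \<le> \<delta> / \<epsilon>" .
    qed
    have U_sp: "U \<omega> \<in> space (PiM I (\<lambda>_. borel))" for \<omega> by (simp add: U_def space_PiM)
    show "AE \<omega> in M. (\<integral>v. cauchy_kernel \<epsilon> v * F (U \<omega>, v) \<partial>lborel) \<le> \<delta> / \<epsilon>"
      using inner[OF U_sp] by simp
    show "integrable M (\<lambda>\<omega>. \<integral>v. cauchy_kernel \<epsilon> v * F (U \<omega>, v) \<partial>lborel)"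
    proof (rule integrable_bounded[where C="\<delta> / \<epsilon>"])
      have "(\<lambda>u. \<integral>v. cauchy_kernel \<epsilon> v * F (u, v) \<partial>lborel) \<in> borel_measurable (PiM I (\<lambda>_. borel))"
        using F_meas by measurable
      from measurable_compose[OF rvU this]
      show "(\<lambda>\<omega>. \<integral>v. cauchy_kernel \<epsilon> v * F (U \<omega>, v) \<partial>lborel) \<in> borel_measurable M" .
    qed (use inner[OF U_sp] in \<open>auto simp: abs_le_iff intro: order_trans\<close>)
  qed
  finally show ?thesis .
qed

text \<open>Refining the grid increases the event that a value below \<open>1/(k+1)\<close> occurs, so the bound of \<open>rare_near_zero\<close> passes
to the limit; then let \<open>k\<close> tend to infinity.\<close>
lemma almost_never_touches:
  assumes T: "T > 0"
  shows "AE \<omega> in M. \<not> touches_zero T m (\<lambda>t. X t \<omega>)"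
proof -
  define \<epsilon> where "\<epsilon> = T / 2^m"
  define c where "c n = (2::nat)^(m+n) - 2^n" for n
  define Y where "Y n i \<omega> = X (\<epsilon> + real i * (T / 2^(m+n))) \<omega>" for n i \<omega>
  have \<epsilon>: "\<epsilon> > 0" using T by (simp add: \<epsilon>_def)
  have [measurable]: "Y n i \<in> borel_measurable M" for n i
    unfolding Y_def by (rule measurable_X) (use \<epsilon> T in simp)
  have refine: "Y n i \<omega> = Y (Suc n) (2 * i) \<omega>" for n i \<omega> by (simp add: Y_def)
  have c2: "2 * i \<le> c (Suc n)" if "i \<le> c n" for i n
  proof -
    have "c (Suc n) = 2 * c n" unfolding c_def by (simp add: diff_mult_distrib2)
    then show ?thesis using that by simp
  qed
  define R where "R k n = {\<omega>\<in>space M. (\<forall>n. \<forall>i\<in>{..c n}. Y n i \<omega> > 0) \<and> (\<exists>i\<in>{..c n}. Y n i \<omega> < 1 / real (Suc k))}" for k n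
  have R_sets [measurable]: "R k n \<in> sets M" for k n unfolding R_def by measurable
  have le: "measure M (\<Union>n. R k n) \<le> 1 / real (Suc k) / \<epsilon>" for k
  proof (rule LIMSEQ_le_const2)
    have "incseq (R k)"
    proof (rule incseq_SucI, rule subsetI)
      fix n \<omega> assume "\<omega> \<in> R k n"
      then obtain i where "i \<le> c n" "Y n i \<omega> < 1 / real (Suc k)" and rest: "\<omega> \<in> space M" "\<forall>n. \<forall>i\<in>{..c n}. Y n i \<omega> > 0"
        by (auto simp: R_def)
      then have "2 * i \<le> c (Suc n)" "Y (Suc n) (2 * i) \<omega> < 1 / real (Suc k)" using c2 refine by auto
      then show "\<omega> \<in> R k (Suc n)" using rest unfolding R_def by blast
    qed
    then show "(\<lambda>n. measure M (R k n)) \<longlonglongrightarrow> measure M (\<Union>n. R k n)"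
      by (intro finite_Lim_measure_incseq) auto
    have "measure M (R k n) \<le> 1 / real (Suc k) / \<epsilon>" for n
    proof -
      let ?E = "{\<omega>\<in>space M. (\<forall>i\<in>{..c n}. Y n i \<omega> > 0) \<and> (\<exists>i\<in>{..c n}. Y n i \<omega> < 1 / real (Suc k))}"
      have "measure M (R k n) \<le> prob ?E"
      proof (rule finite_measure_mono)
        show "R k n \<subseteq> ?E" unfolding R_def by blast
        show "?E \<in> sets M" by measurable
      qed
      also have "\<dots> \<le> 1 / real (Suc k) / \<epsilon>"
        unfolding Y_def by (rule rare_near_zero) (use \<epsilon> T in auto)
      finally show ?thesis .
    qed
    then show "\<exists>N. \<forall>n\<ge>N. measure M (R k n) \<le> 1 / real (Suc k) / \<epsilon>" by blast
  qed
  define Z where "Z = (\<Inter>k. \<Union>n. R k n)"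
  have Zs [measurable]: "Z \<in> sets M" unfolding Z_def by measurable
  have "measure M Z \<le> 0"
  proof (rule LIMSEQ_le_const)
    have "(\<lambda>k. inverse (real (Suc k)) * (1 / \<epsilon>)) \<longlonglongrightarrow> 0 * (1 / \<epsilon>)"
      by (intro tendsto_intros LIMSEQ_inverse_real_of_nat)
    then show "(\<lambda>k. 1 / real (Suc k) / \<epsilon>) \<longlonglongrightarrow> 0" by (simp add: inverse_eq_divide)
    have "measure M Z \<le> 1 / real (Suc k) / \<epsilon>" for k
      by (rule order_trans[OF finite_measure_mono le[of k]]) (auto simp: Z_def)
    then show "\<exists>N. \<forall>k\<ge>N. measure M Z \<le> 1 / real (Suc k) / \<epsilon>" by blast
  qed
  then have "Z \<in> null_sets M" using Zs by (simp add: null_sets_def emeasure_eq_measure measure_le_0_iff)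
  from AE_not_in[OF this] AE_space[of M]
  show ?thesis
  proof eventually_elim
    fix \<omega> assume \<omega>: "\<omega> \<notin> Z" "\<omega> \<in> space M"
    show "\<not> touches_zero T m (\<lambda>t. X t \<omega>)"
    proof
      assume t: "touches_zero T m (\<lambda>t. X t \<omega>)"
      have P1: "\<forall>n. \<forall>i\<in>{..c n}. Y n i \<omega> > 0"
        using t unfolding touches_zero_def Y_def c_def \<epsilon>_def Ball_def atMost_iff by blast
      have P2: "\<forall>k. \<exists>n. \<exists>i\<in>{..c n}. Y n i \<omega> < 1 / real (Suc k)"
        using t unfolding touches_zero_def Y_def c_def \<epsilon>_def Bex_def atMost_iff by blast
      have "\<omega> \<in> Z" unfolding Z_def
      proof (rule INT_I)
        fix k
        obtain n where n: "\<exists>i\<in>{..c n}. Y n i \<omega> < 1 / real (Suc k)" using P2 by blast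
        have "\<omega> \<in> R k n" unfolding R_def mem_Collect_eq by (intro conjI \<omega>(2) P1 n)
        then show "\<omega> \<in> (\<Union>n. R k n)" by (rule UN_I[OF UNIV_I])
      qed
      then show False using \<omega>(1) by simp
    qed
  qed
qed

end

text \<open>At a time \<open>s\<close> with \<open>w s \<le> 0\<close>, right continuity yields arbitrarily small values at dyadic times just after \<open>s\<close>; these
times are at least \<open>T/2^m\<close> for every \<open>m\<close> with \<open>T/2^m < s\<close>.\<close>
lemma positive_path:
  fixes w :: "real \<Rightarrow> real"
  assumes w: "cadlag w" "w 0 > 0" and T: "T > 0"
    and D: "\<And>n j. 1 \<le> j \<Longrightarrow> j \<le> 2^n \<Longrightarrow> w (real j * (T / 2^n)) > 0"
    and nt: "\<And>m. \<not> touches_zero T m w"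
    and s: "0 \<le> s" "s \<le> T"
  shows "w s > 0"
proof (rule ccontr)
  assume "\<not> w s > 0"
  then have ws: "w s \<le> 0" by simp
  have "w T > 0" using D[of 1 0] by simp
  then have s0: "0 < s" "s < T" using s w(2) ws by (auto simp: order_less_le)
  have "(\<lambda>m. T / 2 ^ m) \<longlonglongrightarrow> 0" by (rule LIMSEQ_divide_realpow_zero) simp
  then have "\<forall>\<^sub>F m in sequentially. T / 2 ^ m < s" using s0(1) by (rule order_tendstoD)
  then obtain m where m: "T / 2 ^ m < s" by (auto simp: eventually_sequentially)
  have pt: "T / 2^m + real i * (T / 2^(m+n)) = real (i + 2^n) * (T / 2^(m+n))" for i n
    by (simp add: power_add field_simps)
  have "touches_zero T m w" unfolding touches_zero_def
  proof (intro conjI allI impI)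
    fix n i assume i: "i \<le> (2::nat)^(m+n) - 2^n"
    have "(2::nat)^n \<le> 2^(m+n)" by (rule power_increasing) auto
    moreover have "(1::nat) \<le> 2^n" by simp
    ultimately have "1 \<le> i + 2^n" "i + 2^n \<le> 2^(m+n)" using i by linarith+
    then show "w (T / 2^m + real i * (T / 2^(m+n))) > 0" unfolding pt by (rule D)
  next
    fix k :: nat
    have "(w \<longlongrightarrow> w s) (at_right s)" using w(1) s unfolding cadlag_def continuous_within by auto
    moreover have "w s < 1 / real (Suc k)" using ws by (smt (verit) divide_pos_pos of_nat_0_less_iff zero_less_Suc)
    ultimately have "\<forall>\<^sub>F u in at_right s. w u < 1 / real (Suc k)" by (rule order_tendstoD)
    then obtain b where b: "b > s" "\<And>u. s < u \<Longrightarrow> u < b \<Longrightarrow> w u < 1 / real (Suc k)"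
      unfolding eventually_at_right_field by auto
    define gap where "gap = min b T - s"
    have gap: "gap > 0" using b(1) s0 by (simp add: gap_def)
    have "(\<lambda>n. (T / 2^m) / 2 ^ n) \<longlonglongrightarrow> 0" by (rule LIMSEQ_divide_realpow_zero) simp
    then have "\<forall>\<^sub>F n in sequentially. (T / 2^m) / 2 ^ n < gap" using gap by (rule order_tendstoD)
    then obtain n where n: "(T / 2^m) / 2^n < gap" by (auto simp: eventually_sequentially)
    define h where "h = T / 2^(m+n)"
    have h: "h > 0" "h < gap" using T n by (simp_all add: h_def power_add)
    \<comment> \<open>the first grid time strictly after \<open>s\<close>\<close>
    define j where "j = nat (\<lfloor>s / h\<rfloor> + 1)"
    have "real j = of_int (\<lfloor>s / h\<rfloor> + 1)" using s0 h by (simp add: j_def)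
    moreover have "s / h < of_int (\<lfloor>s / h\<rfloor> + 1)" "of_int (\<lfloor>s / h\<rfloor> + 1) \<le> s / h + 1" by linarith+
    ultimately have "s / h < real j" "real j \<le> s / h + 1" by simp_all
    then have j: "s < real j * h" "real j * h \<le> s + h" using h by (simp_all add: field_simps)
    have "T / 2^m < real j * h" using m j(1) by simp
    then have "2^n * h < real j * h" by (simp add: h_def power_add)
    then have "2^n < real j" using h by simp
    then have jn: "2^n < j" by (metis of_nat_less_iff of_nat_numeral of_nat_power)
    have "real j * h < T" using j h unfolding gap_def by linarith
    then have "real j * h < 2^(m+n) * h" by (simp add: h_def)
    then have "real j < 2^(m+n)" using h by simp
    then have jm: "j < 2^(m+n)" by (metis of_nat_less_iff of_nat_numeral of_nat_power)
    define i where "i = j - 2^n"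
    have i: "i \<le> 2^(m+n) - 2^n" "i + 2^n = j" using jn jm by (auto simp: i_def)
    have "w (real j * h) < 1 / real (Suc k)" using b(2) j h unfolding gap_def by auto
    then have "w (T / 2^m + real i * (T / 2^(m+n))) < 1 / real (Suc k)" unfolding pt i(2) h_def .
    then show "\<exists>n. \<exists>i\<le>2^(m+n) - 2^n. w (T / 2^m + real i * (T / 2^(m+n))) < 1 / real (Suc k)"
      using i(1) by blast
  qed
  then show False using nt by simp
qed

text \<open>Right continuity at \<open>T\<close> is needed, since the exit time has to be strictly larger than \<open>T\<close>.\<close>
lemma survival_iff:
  fixes X :: "real \<Rightarrow> 'a \<Rightarrow> real"
  assumes c: "cadlag (\<lambda>t. X t \<omega>)" and T: "T \<ge> 0"
  shows "\<omega> \<in> survival X {0<..} T \<longleftrightarrow> (\<forall>s\<in>{0..T}. X s \<omega> > 0)"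
proof
  assume "\<omega> \<in> survival X {0<..} T"
  then have T_less: "ereal T < Inf (ereal ` {t. 0 \<le> t \<and> X t \<omega> \<notin> {0<..}})"
    by (simp add: survival_def exit_time_def)
  show "\<forall>s\<in>{0..T}. X s \<omega> > 0"
  proof (rule ballI, rule ccontr)
    fix s assume "s \<in> {0..T}" "\<not> X s \<omega> > 0"
    then have "Inf (ereal ` {t. 0 \<le> t \<and> X t \<omega> \<notin> {0<..}}) \<le> ereal s" by (intro Inf_lower) auto
    also have "\<dots> \<le> ereal T" using \<open>s \<in> {0..T}\<close> by simp
    finally show False using T_less by simp
  qed
next
  assume pos: "\<forall>s\<in>{0..T}. X s \<omega> > 0"
  have "((\<lambda>t. X t \<omega>) \<longlongrightarrow> X T \<omega>) (at_right T)" using c T unfolding cadlag_def continuous_within by auto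
  moreover have "X T \<omega> > 0" using pos T by auto
  ultimately have "\<forall>\<^sub>F u in at_right T. X u \<omega> > 0" by (rule order_tendstoD)
  then obtain b where b: "b > T" "\<And>u. T < u \<Longrightarrow> u < b \<Longrightarrow> X u \<omega> > 0"
    unfolding eventually_at_right_field by auto
  have "ereal b \<le> Inf (ereal ` {t. 0 \<le> t \<and> X t \<omega> \<notin> {0<..}})"
  proof (rule Inf_greatest)
    fix y assume "y \<in> ereal ` {t. 0 \<le> t \<and> X t \<omega> \<notin> {0<..}}"
    then obtain t where t: "y = ereal t" "0 \<le> t" "\<not> X t \<omega> > 0" by auto
    then have "\<not> t \<le> T" using pos by auto
    then have "t \<ge> b" using b(2)[of t] t(3) by linarith
    then show "ereal b \<le> y" using t by simp
  qed
  moreover have "ereal T < ereal b" using b(1) by simp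
  ultimately have "ereal T < Inf (ereal ` {t. 0 \<le> t \<and> X t \<omega> \<notin> {0<..}})" by (rule less_le_trans[rotated])
  then show "\<omega> \<in> survival X {0<..} T" by (simp only: survival_def exit_time_def mem_Collect_eq)
qed

context cauchy_process_from
begin

lemma survival_AE_dyadic:
  assumes x: "x > 0" and T: "T > 0"
  shows "AE \<omega> in M. \<omega> \<in> survival X {0<..} T \<longleftrightarrow> (\<forall>n. positive_at (T / 2^n) (2^n) \<omega>)"
proof -
  have "AE \<omega> in M. \<forall>m. \<not> touches_zero T m (\<lambda>t. X t \<omega>)"
    using almost_never_touches[OF T] by (simp add: AE_all_countable)
  with start cadlag_paths show ?thesis
  proof eventually_elim
    fix \<omega> assume \<omega>: "X 0 \<omega> = x" "cadlag (\<lambda>t. X t \<omega>)" "\<forall>m. \<not> touches_zero T m (\<lambda>t. X t \<omega>)"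
    show "\<omega> \<in> survival X {0<..} T \<longleftrightarrow> (\<forall>n. positive_at (T / 2^n) (2^n) \<omega>)"
      unfolding survival_iff[where X=X and \<omega>=\<omega>, OF \<omega>(2) less_imp_le[OF T]]
    proof
      assume pos: "\<forall>s\<in>{0..T}. X s \<omega> > 0"
      show "\<forall>n. positive_at (T / 2^n) (2^n) \<omega>"
        unfolding positive_at_def
      proof (intro allI ballI)
        fix n j assume j: "j \<in> {1..(2::nat)^n}"
        have "real j \<le> 2^n" using j by (simp add: of_nat_le_iff[of j "2^n", symmetric] del: of_nat_le_iff)
        then have "real j * (T / 2^n) \<le> T" using T by (simp add: field_simps)
        then show "X (real j * (T / 2^n)) \<omega> > 0" using pos T by auto
      qed
    next
      assume "\<forall>n. positive_at (T / 2^n) (2^n) \<omega>"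
      then have D: "X (real j * (T / 2^n)) \<omega> > 0" if "1 \<le> j" "j \<le> 2^n" for n j
        using that unfolding positive_at_def by auto
      show "\<forall>s\<in>{0..T}. X s \<omega> > 0"
        using positive_path[OF \<omega>(2) _ T D] \<omega> x by auto
    qed
  qed
qed

text \<open>There are \<open>2^n\<close> steps of length \<open>h = T / 2^n\<close>, and the error of one step is \<open>o(h)\<close>.\<close>
lemma step_error_limit:
  assumes mu: "\<mu> > 0" and T: "T > 0"
  shows "(\<lambda>n. 2^n * step_error \<mu> T (T / 2^n)) \<longlonglongrightarrow> 0"
proof -
  define h where "h n = \<mu> * (T / 2^n)" for n :: nat
  have h: "h n > 0" for n using mu T by (simp add: h_def)
  have "(\<lambda>n. (\<mu> * T) / 2^n) \<longlonglongrightarrow> 0" by (rule LIMSEQ_divide_realpow_zero) simp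
  moreover have "h = (\<lambda>n. (\<mu> * T) / 2^n)" by (simp add: h_def fun_eq_iff)
  ultimately have h0: "h \<longlonglongrightarrow> 0" by simp
  have "(\<lambda>n. 4 * (\<mu> * T) / (\<mu> * x)\<^sup>2 * (\<mu> * T) * (defect_mass (h n) / h n) + 32 * (\<mu> * T) / (\<mu> * x)\<^sup>2 * h n) \<longlonglongrightarrow>
    4 * (\<mu> * T) / (\<mu> * x)\<^sup>2 * (\<mu> * T) * 0 + 32 * (\<mu> * T) / (\<mu> * x)\<^sup>2 * 0"
    by (intro tendsto_intros defect_mass_small h h0)
  moreover have "2^n * step_error \<mu> T (T / 2^n) = 4 * (\<mu> * T) / (\<mu> * x)\<^sup>2 * (\<mu> * T) * (defect_mass (h n) / h n) + 32 * (\<mu> * T) / (\<mu> * x)\<^sup>2 * h n" for n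
  proof -
    have e: "2^n * h n = \<mu> * T" by (simp add: h_def)
    then have e1: "\<mu> * T * (defect_mass (h n) / h n) = 2^n * defect_mass (h n)" using h[of n] by (simp add: field_simps)
    have e2: "\<mu> * T * h n = 2^n * (h n)\<^sup>2" by (simp only: e[symmetric] power2_eq_square mult.assoc)
    have e3: "2^n * step_error \<mu> T (T / 2^n) = 4 * (\<mu> * T) / (\<mu> * x)\<^sup>2 * (2^n * defect_mass (h n)) + 32 * (2^n * (h n)\<^sup>2) / (\<mu> * x)\<^sup>2"
      unfolding step_error_def h_def[symmetric] by (simp only: distrib_left mult.left_commute times_divide_eq_right)
    have e4: "4 * (\<mu> * T) / (\<mu> * x)\<^sup>2 * (\<mu> * T) * (defect_mass (h n) / h n) = 4 * (\<mu> * T) / (\<mu> * x)\<^sup>2 * (\<mu> * T * (defect_mass (h n) / h n))"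
      by (simp only: mult.assoc)
    have e5: "32 * (\<mu> * T) / (\<mu> * x)\<^sup>2 * h n = 32 * (\<mu> * T * h n) / (\<mu> * x)\<^sup>2" by simp
    show ?thesis by (simp only: e3 e4 e5 e1 e2)
  qed
  ultimately show ?thesis by simp
qed

text \<open>On the dyadic grids the events of survival decrease, so their indicators converge.\<close>
lemma eigen_dyadic:
  assumes x: "x > 0" and mu: "\<mu> > 0" and T: "T > 0"
  shows "expectation (\<lambda>\<omega>. of_bool (\<forall>n. positive_at (T / 2^n) (2^n) \<omega>) * psi_ext (\<mu> * X T \<omega>)) = exp (- \<mu> * T) * psi_ext (\<mu> * x)"
proof -
  have [measurable]: "X T \<in> borel_measurable M" by (rule measurable_X) (use T in simp)
  have [measurable]: "Measurable.pred M (positive_at (T / 2^n) (2^n))" for n by (rule positive_at_measurable) (use T in simp)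
  have P: "psi_sup \<ge> 0" using psi_ext_bound[of 0] by (rule order_trans[OF abs_ge_zero])
  let ?b = "\<lambda>n. expectation (\<lambda>\<omega>. of_bool (positive_at (T / 2^n) (2^n) \<omega>) * psi_ext (\<mu> * X T \<omega>))"
  have "?b \<longlonglongrightarrow> exp (- \<mu> * T) * psi_ext (\<mu> * x)"
  proof (rule LIM_zero_cancel, rule Lim_null_comparison)
    have "norm (?b n - exp (- \<mu> * T) * psi_ext (\<mu> * x)) \<le> 2^n * step_error \<mu> T (T / 2^n)" for n
      using discrete_eigen[OF x mu, of "T / 2^n" "2^n" T] T by (simp add: mult.assoc)
    then show "\<forall>\<^sub>F n in sequentially. norm (?b n - exp (- \<mu> * T) * psi_ext (\<mu> * x)) \<le> 2^n * step_error \<mu> T (T / 2^n)" by simp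
    show "(\<lambda>n. 2^n * step_error \<mu> T (T / 2^n)) \<longlonglongrightarrow> 0" by (rule step_error_limit[OF mu T])
  qed
  moreover have "?b \<longlonglongrightarrow> expectation (\<lambda>\<omega>. of_bool (\<forall>n. positive_at (T / 2^n) (2^n) \<omega>) * psi_ext (\<mu> * X T \<omega>))"
  proof (rule integral_dominated_convergence[where w="\<lambda>_. psi_sup"])
    show "AE \<omega> in M. (\<lambda>n. of_bool (positive_at (T / 2^n) (2^n) \<omega>) * psi_ext (\<mu> * X T \<omega>)) \<longlonglongrightarrow> of_bool (\<forall>n. positive_at (T / 2^n) (2^n) \<omega>) * psi_ext (\<mu> * X T \<omega>)"
    proof (rule AE_I2, rule tendsto_eventually)
      fix \<omega>
      have mono: "positive_at (T / 2^n) (2^n) \<omega>" if "positive_at (T / 2^Suc n) (2^Suc n) \<omega>" for n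
        unfolding positive_at_def
      proof
        fix j assume j: "j \<in> {1..(2::nat)^n}"
        then have "2 * j \<in> {1..2^Suc n}" by auto
        then have "X (real (2 * j) * (T / 2^Suc n)) \<omega> > 0" using that unfolding positive_at_def by blast
        then show "X (real j * (T / 2^n)) \<omega> > 0" by simp
      qed
      have mono': "positive_at (T / 2^n) (2^n) \<omega>" if "n \<le> n'" "positive_at (T / 2^n') (2^n') \<omega>" for n n'
        using that by (induction n' rule: dec_induct) (use mono in blast)+
      show "\<forall>\<^sub>F n in sequentially. of_bool (positive_at (T / 2^n) (2^n) \<omega>) * psi_ext (\<mu> * X T \<omega>) = of_bool (\<forall>n. positive_at (T / 2^n) (2^n) \<omega>) * psi_ext (\<mu> * X T \<omega>)"
      proof (cases "\<forall>n. positive_at (T / 2^n) (2^n) \<omega>")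
        case False
        then obtain n0 where n0: "\<not> positive_at (T / 2^n0) (2^n0) \<omega>" by blast
        show ?thesis using eventually_ge_at_top[of n0]
        proof eventually_elim
          fix n assume "n0 \<le> n"
          then have "\<not> positive_at (T / 2^n) (2^n) \<omega>" using mono' n0 by blast
          then show "of_bool (positive_at (T / 2^n) (2^n) \<omega>) * psi_ext (\<mu> * X T \<omega>) = of_bool (\<forall>n. positive_at (T / 2^n) (2^n) \<omega>) * psi_ext (\<mu> * X T \<omega>)"
            using False by simp
        qed
      qed simp
    qed
    show "AE \<omega> in M. norm (of_bool (positive_at (T / 2^n) (2^n) \<omega>) * psi_ext (\<mu> * X T \<omega>)) \<le> psi_sup" for n
      using psi_ext_bound P by (intro AE_I2) auto
  qed measurable
  ultimately show ?thesis by (rule LIMSEQ_unique[rotated])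
qed

lemma psi_eq_psi_ext: "\<mu> > 0 \<Longrightarrow> z > 0 \<Longrightarrow> psi \<mu> z = psi_ext (\<mu> * z)"
  by (simp add: psi_def psi_ext_def)

lemma psi_measurable: "psi \<mu> \<in> borel_measurable borel"
  unfolding psi_def by measurable

text \<open>In the completed space the survival event may be replaced by any measurable event that is almost surely
equal to it.\<close>
lemma killed_expectation:
  assumes T: "T \<ge> 0" and G: "Measurable.pred M G"
    and ae: "AE \<omega> in M. \<omega> \<in> survival X {0<..} T \<longleftrightarrow> G \<omega>"
    and mu: "\<mu> > 0"
  shows "set_integrable (completion M) (survival X {0<..} T) (\<lambda>\<omega>. psi \<mu> (X T \<omega>))"
    and "(LINT \<omega>:survival X {0<..} T|completion M. psi \<mu> (X T \<omega>)) = expectation (\<lambda>\<omega>. of_bool (G \<omega>) * psi_ext (\<mu> * X T \<omega>))"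
proof -
  have XT [measurable]: "X T \<in> borel_measurable M" by (rule measurable_X[OF T])
  note [measurable] = G
  define f where "f \<omega> = of_bool (G \<omega>) * psi_ext (\<mu> * X T \<omega>)" for \<omega>
  define g where "g \<omega> = indicator (survival X {0<..} T) \<omega> *\<^sub>R psi \<mu> (X T \<omega>)" for \<omega>
  have P: "psi_sup \<ge> 0" using psi_ext_bound[of 0] by (rule order_trans[OF abs_ge_zero])
  have fm: "f \<in> borel_measurable M" unfolding f_def by measurable
  have fi: "integrable M f" by (rule integrable_bounded[OF fm, where C=psi_sup]) (use psi_ext_bound P in \<open>auto simp: f_def\<close>)
  have "survival X {0<..} T \<inter> space M \<in> sets (completion M)"
  proof (rule completion.in_sets_AE[where A="{\<omega>\<in>space M. G \<omega>}"])
    show "{\<omega>\<in>space M. G \<omega>} \<in> sets (completion M)" by (rule sets_completionI_sets) measurable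
    show "AE \<omega> in completion M. \<omega> \<in> {\<omega>\<in>space M. G \<omega>} \<longleftrightarrow> \<omega> \<in> survival X {0<..} T \<inter> space M"
      by (rule AE_completion) (use ae in eventually_elim, auto)
  qed simp
  then have "(\<lambda>\<omega>. indicator (survival X {0<..} T \<inter> space M) \<omega> *\<^sub>R psi \<mu> (X T \<omega>)) \<in> borel_measurable (completion M)"
    by (intro borel_measurable_scaleR borel_measurable_indicator measurable_compose[OF measurable_completion[OF XT] psi_measurable])
  then have gm: "g \<in> borel_measurable (completion M)"
    by (rule measurable_cong[THEN iffD1, rotated]) (auto simp: g_def indicator_def)
  have "AE \<omega> in M. g \<omega> = f \<omega>"
    using ae cadlag_paths
  proof eventually_elim
    fix \<omega> assume \<omega>: "\<omega> \<in> survival X {0<..} T \<longleftrightarrow> G \<omega>" "cadlag (\<lambda>t. X t \<omega>)"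
    show "g \<omega> = f \<omega>"
    proof (cases "G \<omega>")
      case True
      then have "X T \<omega> > 0" using \<omega> survival_iff[where X=X and \<omega>=\<omega>, OF \<omega>(2) T] T by auto
      then show ?thesis using True \<omega>(1) mu by (simp add: g_def f_def psi_eq_psi_ext)
    qed (use \<omega>(1) in \<open>simp add: g_def f_def\<close>)
  qed
  then have gf: "AE \<omega> in completion M. g \<omega> = f \<omega>" by (rule AE_completion)
  have fc: "integrable (completion M) f" using fi by (simp add: integrable_completion fm)
  have gi: "integrable (completion M) g"
    by (rule integrable_cong_AE_imp[OF fc gm]) (use gf in eventually_elim, simp)
  then show "set_integrable (completion M) (survival X {0<..} T) (\<lambda>\<omega>. psi \<mu> (X T \<omega>))"
    unfolding set_integrable_def g_def .
  have "integral\<^sup>L (completion M) g = integral\<^sup>L (completion M) f"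
    by (rule integral_cong_AE[OF gm measurable_completion[OF fm] gf])
  also have "\<dots> = integral\<^sup>L M f" by (rule integral_completion[OF fm])
  finally show "(LINT \<omega>:survival X {0<..} T|completion M. psi \<mu> (X T \<omega>)) = expectation (\<lambda>\<omega>. of_bool (G \<omega>) * psi_ext (\<mu> * X T \<omega>))"
    unfolding set_lebesgue_integral_def g_def f_def .
qed

lemma killed_eigen:
  assumes x: "x > 0" and mu: "\<mu> > 0" and T: "T \<ge> 0"
  shows "set_integrable (completion M) (survival X {0<..} T) (\<lambda>\<omega>. psi \<mu> (X T \<omega>))"
    and "(LINT \<omega>:survival X {0<..} T|completion M. psi \<mu> (X T \<omega>)) = exp (- \<mu> * T) * psi \<mu> x"
proof -
  have "set_integrable (completion M) (survival X {0<..} T) (\<lambda>\<omega>. psi \<mu> (X T \<omega>)) \<and>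
    (LINT \<omega>:survival X {0<..} T|completion M. psi \<mu> (X T \<omega>)) = exp (- \<mu> * T) * psi \<mu> x"
  proof (cases "T = 0")
    case True
    have ae: "AE \<omega> in M. \<omega> \<in> survival X {0<..} T \<longleftrightarrow> True"
      using start cadlag_paths
    proof eventually_elim
      fix \<omega> assume "X 0 \<omega> = x" "cadlag (\<lambda>t. X t \<omega>)"
      then show "\<omega> \<in> survival X {0<..} T \<longleftrightarrow> True" using survival_iff[of X \<omega> T] x True by auto
    qed
    have "expectation (\<lambda>\<omega>. of_bool True * psi_ext (\<mu> * X T \<omega>)) = expectation (\<lambda>\<omega>. psi_ext (\<mu> * x))"
    proof (rule integral_cong_AE)
      have [measurable]: "X T \<in> borel_measurable M" by (rule measurable_X[OF T])
      show "(\<lambda>\<omega>. of_bool True * psi_ext (\<mu> * X T \<omega>)) \<in> borel_measurable M" by measurable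
      show "AE \<omega> in M. of_bool True * psi_ext (\<mu> * X T \<omega>) = psi_ext (\<mu> * x)"
        using start by eventually_elim (simp add: True)
    qed simp
    then show ?thesis using killed_expectation[OF T _ ae mu] True x mu by (simp add: psi_eq_psi_ext prob_space)
  next
    case False
    then have T0: "T > 0" using T by simp
    have "Measurable.pred M (positive_at (T / 2^n) (2^n))" for n by (rule positive_at_measurable) (use T in simp)
    then have "Measurable.pred M (\<lambda>\<omega>. \<forall>n. positive_at (T / 2^n) (2^n) \<omega>)" by measurable
    from killed_expectation[OF T this survival_AE_dyadic[OF x T0] mu]
    show ?thesis using eigen_dyadic[OF x mu T0] x mu by (simp add: psi_eq_psi_ext)
  qed
  then show "set_integrable (completion M) (survival X {0<..} T) (\<lambda>\<omega>. psi \<mu> (X T \<omega>))"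
    "(LINT \<omega>:survival X {0<..} T|completion M. psi \<mu> (X T \<omega>)) = exp (- \<mu> * T) * psi \<mu> x" by auto
qed

end

text \<open>The eigenfunction is not zero where the sine is \<open>-1\<close>, because \<open>r\<close> is nonnegative.\<close>
theorem theorem2:
  fixes P :: "real \<Rightarrow> 'a measure" and X :: "real \<Rightarrow> 'a \<Rightarrow> real" and \<mu> :: real
  assumes "cauchy_process P X"
    and "0 < \<mu>"
  shows "continuous_on {0<..} (psi \<mu>)
       \<and> (\<exists>x>0. psi \<mu> x \<noteq> 0)
       \<and> (\<forall>t\<ge>0. \<forall>x>0.
            killed_integrable P X {0<..} t (psi \<mu>) x
          \<and> killed_semigroup P X {0<..} t (psi \<mu>) x = exp (- \<mu> * t) * psi \<mu> x)"
proof (intro conjI allI impI)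
  note mu = assms(2)
  have "continuous_on {0<..} (\<lambda>x. r_fun (\<mu> * x))"
    by (rule continuous_on_compose2[OF r_fun_continuous]) (use mu in \<open>auto intro!: continuous_intros\<close>)
  then show "continuous_on {0<..} (psi \<mu>)" unfolding psi_def by (intro continuous_intros)
  \<comment> \<open>the first positive point where the sine takes the value \<open>-1\<close>\<close>
  define x0 where "x0 = (3 * pi / 2 - pi / 8) / \<mu>"
  have x0: "x0 > 0" using mu pi_gt_zero by (simp add: x0_def)
  have "\<mu> * x0 = 3 * pi / 2 - pi / 8" using mu by (simp add: x0_def)
  then have "\<mu> * x0 + pi / 8 = 3 / 2 * pi" by simp
  then have "sin (\<mu> * x0 + pi / 8) = -1" by (simp only: sin_3over2_pi)
  moreover have "r_fun (\<mu> * x0) \<ge> 0" using r_fun_bounds(1)[of "\<mu> * x0"] mu x0 by simp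
  ultimately have "psi \<mu> x0 \<noteq> 0" by (simp add: psi_def)
  then show "\<exists>x>0. psi \<mu> x \<noteq> 0" using x0 by blast
  fix t x :: real assume t: "0 \<le> t" and x: "0 < x"
  interpret cauchy_process_from "P x" X x using assms(1) by (simp add: cauchy_process_def)
  show "killed_integrable P X {0<..} t (psi \<mu>) x"
    unfolding killed_integrable_def by (rule killed_eigen(1)[OF x mu t])
  show "killed_semigroup P X {0<..} t (psi \<mu>) x = exp (- \<mu> * t) * psi \<mu> x"
    unfolding killed_semigroup_def by (rule killed_eigen(2)[OF x mu t])
qed

end
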